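(* Let $R$ be a commutative ring with unit and let $\mathscr{G}$ be an ample groupoid. Then the following are equivalent: (1) $R\mathscr{G}$ is semisimple. (2) $R\mathscr{G}$ is locally semisimple. (3) $\mathscr{G}$ is discrete and the group ring $R\mathscr{G}_x^x$ is semisimple for all isotropy groups $\mathscr{G}_x^x$. (4) $R\mathscr{G}\cong\bigoplus_{\alpha\in J}M_{\mathscr{O}_\alpha}(R\mathscr{G}_{x_\alpha}^{x_\alpha})$, where $x_\alpha$, $\alpha\in J$, represent the orbits, $\mathscr{O}_\alpha$ is the orbit of $x_\alpha$, $\mathscr{G}_{x_\alpha}^{x_\alpha}$ is the isotropy group at $x_\alpha$, and the group rings $R\mathscr{G}_{x_\alpha}^{x_\alpha}$ are semisimple.
   Context: Groupoids. A groupoid $\mathscr{G}$ is a small category in which every arrow is invertible, identified with its set of arrows; $\mathscr{G}^{(0)}$ is its set of units, $d(g)=g^{-1}g$, $r(g)=gg^{-1}$. A topological groupoid has a topology making multiplication and inversion continuous, with $\mathscr{G}^{(0)}$ carrying the subspace topology. All topological groupoids are locally compact with locally compact Hausdorff unit space ($\mathscr{G}$ itself need not be Hausdorff). It is etale if $d,r:\mathscr{G}\to\mathscr{G}^{(0)}$ are local homeomorphisms. An open bisection is an open $U\subseteq\mathscr{G}$ such that $d|_U$ and $r|_U$ are injective (hence homeomorphisms onto open subsets of $\mathscr{G}^{(0)}$). An ample groupoid is an etale groupoid with Hausdorff unit space and a basis of compact open bisections. The isotropy group at $x\in\mathscr{G}^{(0)}$ is $\mathscr{G}_x^x=\{g: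 d(g)=x=r(g)\}$; the orbit of $x$ is the set of $y\in\mathscr{G}^{(0)}$ for which there is an arrow $g$ with $d(g)=x$, $r(g)=y$. The $x_\alpha$, $\alpha\in J$, form a set of orbit representatives, one for each orbit. Groupoid algebra. $R\mathscr{G}$ is the $R$-submodule of $R^{\mathscr{G}}$ spanned by the characteristic functions $\chi_U$ of compact open bisections $U$, with the convolution product $(f_1*f_2)(g)=\sum_{d(h)=d(g)}f_1(gh^{-1})f_2(h)$. It is a ring with local units (a set of local units of a ring $A$ is a set $E$ of idempotents such that for every finite subset $x_1,\dots,x_n$ of $A$ there is $e\in E$ with $ex_i=x_ie=x_i$ for all $i$). $R\mathscr{G}_x^x$ is the group ring of $\mathscr{G}_x^x$ over $R$. Semisimplicity. A simple left (right) $A$-module is a nonzero module with no proper nonzero submodules that is not annihilated by $A$. A semisimple module is a direct sum of simple modules. A left (right) semisimple ring is a ring with local units that is semisimple as a left (right) module over itself; left and right semisimplicity are equivalent, so the adjectives are omitted. A ring $A$ with local units is locally semisimple if $eAe$ is a semisimple ring for every idempotent $e\in A$. Matrices. For a set $X$ and a ring $S$, $M_X(S)$ is the ring of $X\times X$ matrices over $S$ with only finitely many nonzero entries. *)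

theory Defs
  imports "HOL-Algebra.Module" "HOL-Analysis.Abstract_Topological_Spaces"
begin

section \<open>Rings without unit, modules and semisimplicity\<close>

text \<open>
  A ring need not have a unit here. It is represented by the ring record of the library; the
  locale below does not constrain the field \<open>one\<close>, which is \<open>undefined\<close> in
  the constructions that have no unit in general.
\<close>

locale nonunital_ring = abelian_group A for A (structure) +
  assumes m_closed: "\<lbrakk>a \<in> carrier A; b \<in> carrier A\<rbrakk> \<Longrightarrow> a \<otimes> b \<in> carrier A"
    and m_assoc: "\<lbrakk>a \<in> carrier A; b \<in> carrier A; c \<in> carrier A\<rbrakk>
      \<Longrightarrow> (a \<otimes> b) \<otimes> c = a \<otimes> (b \<otimes> c)"
    and l_distr: "\<lbrakk>a \<in> carrier A; b \<in> carrier A; c \<in> carrier A\<rbrakk>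
      \<Longrightarrow> (a \<oplus> b) \<otimes> c = a \<otimes> c \<oplus> b \<otimes> c"
    and r_distr: "\<lbrakk>a \<in> carrier A; b \<in> carrier A; c \<in> carrier A\<rbrakk>
      \<Longrightarrow> c \<otimes> (a \<oplus> b) = c \<otimes> a \<oplus> c \<otimes> b"

definition idempotents :: "('a, 'm) ring_scheme \<Rightarrow> 'a set" where
  "idempotents A = {e \<in> carrier A. e \<otimes>\<^bsub>A\<^esub> e = e}"

definition has_local_units :: "('a, 'm) ring_scheme \<Rightarrow> bool" where
  "has_local_units A \<longleftrightarrow>
     (\<exists>E \<subseteq> idempotents A. \<forall>F. finite F \<and> F \<subseteq> carrier A \<longrightarrow>
        (\<exists>e\<in>E. \<forall>a\<in>F. e \<otimes>\<^bsub>A\<^esub> a = a \<and> a \<otimes>\<^bsub>A\<^esub> e = a))"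

locale left_module = A: nonunital_ring A + M: abelian_group M
  for A :: "('a, 'n) ring_scheme" (structure) and M :: "('a, 'b, 'm) module_scheme" (structure) +
  assumes smult_closed: "\<lbrakk>a \<in> carrier A; x \<in> carrier M\<rbrakk> \<Longrightarrow> a \<odot>\<^bsub>M\<^esub> x \<in> carrier M"
    and smult_l_distr: "\<lbrakk>a \<in> carrier A; b \<in> carrier A; x \<in> carrier M\<rbrakk>
      \<Longrightarrow> (a \<oplus>\<^bsub>A\<^esub> b) \<odot>\<^bsub>M\<^esub> x = a \<odot>\<^bsub>M\<^esub> x \<oplus>\<^bsub>M\<^esub> b \<odot>\<^bsub>M\<^esub> x"
    and smult_r_distr: "\<lbrakk>a \<in> carrier A; x \<in> carrier M; y \<in> carrier M\<rbrakk>
      \<Longrightarrow> a \<odot>\<^bsub>M\<^esub> (x \<oplus>\<^bsub>M\<^esub> y) = a \<odot>\<^bsub>M\<^esub> x \<oplus>\<^bsub>M\<^esub> a \<odot>\<^bsub>M\<^esub> y"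
    and smult_assoc: "\<lbrakk>a \<in> carrier A; b \<in> carrier A; x \<in> carrier M\<rbrakk>
      \<Longrightarrow> (a \<otimes>\<^bsub>A\<^esub> b) \<odot>\<^bsub>M\<^esub> x = a \<odot>\<^bsub>M\<^esub> (b \<odot>\<^bsub>M\<^esub> x)"

text \<open>The library predicate \<open>submodule\<close> makes sense over rings without unit.\<close>

definition simple_module :: "('a, 'n) ring_scheme \<Rightarrow> ('a, 'b, 'm) module_scheme \<Rightarrow> bool" where
  "simple_module A M \<longleftrightarrow>
     left_module A M \<and>
     carrier M \<noteq> {\<zero>\<^bsub>M\<^esub>} \<and>
     (\<forall>N. submodule N A M \<longrightarrow> N = {\<zero>\<^bsub>M\<^esub>} \<or> N = carrier M) \<and>
     \<not> (\<forall>a\<in>carrier A. \<forall>x\<in>carrier M. a \<odot>\<^bsub>M\<^esub> x = \<zero>\<^bsub>M\<^esub>)"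

text \<open>
  Internal direct sum: every element is in a unique way a finite sum of elements of the summands.
  A set of summands, rather than a family, is enough below, as the summands are nonzero.
\<close>

definition is_direct_sum :: "('a, 'b, 'm) module_scheme \<Rightarrow> 'b set set \<Rightarrow> bool" where
  "is_direct_sum M S \<longleftrightarrow>
     (\<forall>N\<in>S. N \<subseteq> carrier M) \<and>
     (\<forall>x\<in>carrier M. \<exists>!f. f \<in> (\<Pi>\<^sub>E N\<in>S. N) \<and> finite {N \<in> S. f N \<noteq> \<zero>\<^bsub>M\<^esub>} \<and>
        x = (\<Oplus>\<^bsub>M\<^esub>N\<in>{N \<in> S. f N \<noteq> \<zero>\<^bsub>M\<^esub>}. f N))"

definition semisimple_module :: "('a, 'n) ring_scheme \<Rightarrow> ('a, 'b, 'm) module_scheme \<Rightarrow> bool" where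
  "semisimple_module A M \<longleftrightarrow>
     left_module A M \<and>
     (\<exists>S. (\<forall>N\<in>S. submodule N A M \<and> simple_module A (M\<lparr>carrier := N\<rparr>)) \<and> is_direct_sum M S)"

definition regular_module :: "('a, 'm) ring_scheme \<Rightarrow> ('a, 'a) module" where
  "regular_module A =
     \<lparr>carrier = carrier A, mult = mult A, one = one A, zero = zero A, add = add A, smult = mult A\<rparr>"

definition semisimple_ring :: "('a, 'm) ring_scheme \<Rightarrow> bool" where
  "semisimple_ring A \<longleftrightarrow>
     nonunital_ring A \<and> has_local_units A \<and> semisimple_module A (regular_module A)"

definition corner_ring :: "('a, 'm) ring_scheme \<Rightarrow> 'a \<Rightarrow> 'a ring" where
  "corner_ring A e =
     \<lparr>carrier = {e \<otimes>\<^bsub>A\<^esub> a \<otimes>\<^bsub>A\<^esub> e | a. a \<in> carrier A},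
      mult = mult A, one = e, zero = zero A, add = add A\<rparr>"

definition locally_semisimple_ring :: "('a, 'm) ring_scheme \<Rightarrow> bool" where
  "locally_semisimple_ring A \<longleftrightarrow>
     nonunital_ring A \<and> has_local_units A \<and> (\<forall>e\<in>idempotents A. semisimple_ring (corner_ring A e))"

section \<open>Isomorphisms, direct sums and matrices\<close>

text \<open>
  Algebras over a ring of type \<open>'r\<close> are represented by module records, with
  \<open>smult\<close> the action of \<open>'r\<close>; they are rings by forgetting \<open>smult\<close>.
\<close>

definition ring_isos :: "('a, 'm) ring_scheme \<Rightarrow> ('b, 'n) ring_scheme \<Rightarrow> ('a \<Rightarrow> 'b) set" where
  "ring_isos A B = {\<phi>. bij_betw \<phi> (carrier A) (carrier B) \<and>
     (\<forall>a\<in>carrier A. \<forall>b\<in>carrier A. \<phi> (a \<oplus>\<^bsub>A\<^esub> b) = \<phi> a \<oplus>\<^bsub>B\<^esub> \<phi> b \<and> \<phi> (a \<otimes>\<^bsub>A\<^esub> b) = \<phi> a \<otimes>\<^bsub>B\<^esub> \<phi> b)}"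

definition ring_isomorphic :: "('a, 'm) ring_scheme \<Rightarrow> ('b, 'n) ring_scheme \<Rightarrow> bool" where
  "ring_isomorphic A B \<longleftrightarrow> ring_isos A B \<noteq> {}"

definition algebra_isomorphic ::
  "('r, 'a, 'm) module_scheme \<Rightarrow> ('r, 'b, 'n) module_scheme \<Rightarrow> bool" where
  "algebra_isomorphic A B \<longleftrightarrow>
     (\<exists>\<phi>\<in>ring_isos A B. \<forall>r. \<forall>a\<in>carrier A. \<phi> (r \<odot>\<^bsub>A\<^esub> a) = r \<odot>\<^bsub>B\<^esub> \<phi> a)"

definition direct_sum_algebra ::
  "'j set \<Rightarrow> ('j \<Rightarrow> ('r, 'a, 'm) module_scheme) \<Rightarrow> ('r, 'j \<Rightarrow> 'a) module" where
  "direct_sum_algebra J A =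
     \<lparr>carrier = {f \<in> (\<Pi>\<^sub>E j\<in>J. carrier (A j)). finite {j \<in> J. f j \<noteq> \<zero>\<^bsub>A j\<^esub>}},
      mult = (\<lambda>f g. \<lambda>j\<in>J. f j \<otimes>\<^bsub>A j\<^esub> g j),
      one = undefined,
      zero = (\<lambda>j\<in>J. \<zero>\<^bsub>A j\<^esub>),
      add = (\<lambda>f g. \<lambda>j\<in>J. f j \<oplus>\<^bsub>A j\<^esub> g j),
      smult = (\<lambda>r f. \<lambda>j\<in>J. r \<odot>\<^bsub>A j\<^esub> f j)\<rparr>"

text \<open>
  Matrices indexed by \<open>X\<close> with finitely many nonzero entries; the entries at positions
  outside \<open>X \<times> X\<close> are \<open>\<zero>\<close> by convention. The sum in the
  product omits the (possibly infinitely many) zero terms, as \<open>finsum\<close> requires a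
  finite index set.
\<close>

definition matrix_algebra ::
  "'i set \<Rightarrow> ('r, 'a, 'm) module_scheme \<Rightarrow> ('r, 'i \<Rightarrow> 'i \<Rightarrow> 'a) module" where
  "matrix_algebra X S =
     \<lparr>carrier = {M. (\<forall>i j. M i j \<in> carrier S) \<and>
                    (\<forall>i j. i \<notin> X \<or> j \<notin> X \<longrightarrow> M i j = \<zero>\<^bsub>S\<^esub>) \<and>
                    finite {(i, j). M i j \<noteq> \<zero>\<^bsub>S\<^esub>}},
      mult = (\<lambda>M N i k. \<Oplus>\<^bsub>S\<^esub>j\<in>{j \<in> X. M i j \<noteq> \<zero>\<^bsub>S\<^esub>}. M i j \<otimes>\<^bsub>S\<^esub> N j k),
      one = undefined,
      zero = (\<lambda>i j. \<zero>\<^bsub>S\<^esub>),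
      add = (\<lambda>M N i j. M i j \<oplus>\<^bsub>S\<^esub> N i j),
      smult = (\<lambda>r M i j. r \<odot>\<^bsub>S\<^esub> M i j)\<rparr>"

text \<open>
  The group ring consists of the finitely supported functions on the group, extended by \<open>0\<close>
  outside the carrier. In the convolution, \<open>(f\<^sub>1 * f\<^sub>2)(g)\<close> is the sum of
  \<open>f\<^sub>1(g h\<^sup>-\<^sup>1) f\<^sub>2(h)\<close> over all \<open>h\<close>, restricted
  to the finitely many \<open>h\<close> with \<open>f\<^sub>2(h) \<noteq> 0\<close>.
\<close>

definition group_algebra ::
  "'r::comm_ring_1 itself \<Rightarrow> ('h, 'm) monoid_scheme \<Rightarrow> ('r, 'h \<Rightarrow> 'r) module" where
  "group_algebra R H =
     \<lparr>carrier = {f. finite {h. f h \<noteq> 0} \<and> {h. f h \<noteq> 0} \<subseteq> carrier H},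
      mult = (\<lambda>f1 f2 g. if g \<in> carrier H
                then \<Sum>h\<in>{h \<in> carrier H. f2 h \<noteq> 0}. f1 (g \<otimes>\<^bsub>H\<^esub> inv\<^bsub>H\<^esub> h) * f2 h else 0),
      one = (\<lambda>g. if g = \<one>\<^bsub>H\<^esub> then 1 else 0),
      zero = (\<lambda>g. 0),
      add = (\<lambda>f1 f2 g. f1 g + f2 g),
      smult = (\<lambda>r f g. r * f g)\<rparr>"

section \<open>Groupoids\<close>

text \<open>
  A groupoid is identified with its set of arrows and its objects with the identity arrows.
  The product \<open>gcomp G g h\<close> is meaningful if \<open>dsrc G g = rng G h\<close>.
\<close>

record 'g top_groupoid =
  arrows :: "'g set"
  gcomp :: "'g \<Rightarrow> 'g \<Rightarrow> 'g"
  ginv :: "'g \<Rightarrow> 'g"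
  gtop :: "'g topology"

definition dsrc :: "('g, 'm) top_groupoid_scheme \<Rightarrow> 'g \<Rightarrow> 'g" where
  "dsrc G g = gcomp G (ginv G g) g"

definition rng :: "('g, 'm) top_groupoid_scheme \<Rightarrow> 'g \<Rightarrow> 'g" where
  "rng G g = gcomp G g (ginv G g)"

definition units :: "('g, 'm) top_groupoid_scheme \<Rightarrow> 'g set" where
  "units G = dsrc G ` arrows G"

locale groupoid =
  fixes G :: "('g, 'm) top_groupoid_scheme"
  assumes ginv_closed: "g \<in> arrows G \<Longrightarrow> ginv G g \<in> arrows G"
    and dsrc_closed: "g \<in> arrows G \<Longrightarrow> dsrc G g \<in> arrows G"
    and rng_closed: "g \<in> arrows G \<Longrightarrow> rng G g \<in> arrows G"
    and dsrc_ginv: "g \<in> arrows G \<Longrightarrow> dsrc G (ginv G g) = rng G g"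
    and rng_ginv: "g \<in> arrows G \<Longrightarrow> rng G (ginv G g) = dsrc G g"
    and dsrc_dsrc: "g \<in> arrows G \<Longrightarrow> dsrc G (dsrc G g) = dsrc G g"
    and rng_dsrc: "g \<in> arrows G \<Longrightarrow> rng G (dsrc G g) = dsrc G g"
    and dsrc_rng: "g \<in> arrows G \<Longrightarrow> dsrc G (rng G g) = rng G g"
    and rng_rng: "g \<in> arrows G \<Longrightarrow> rng G (rng G g) = rng G g"
    and gcomp_closed: "\<lbrakk>g \<in> arrows G; h \<in> arrows G; dsrc G g = rng G h\<rbrakk> \<Longrightarrow> gcomp G g h \<in> arrows G"
    and dsrc_gcomp: "\<lbrakk>g \<in> arrows G; h \<in> arrows G; dsrc G g = rng G h\<rbrakk>
      \<Longrightarrow> dsrc G (gcomp G g h) = dsrc G h"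
    and rng_gcomp: "\<lbrakk>g \<in> arrows G; h \<in> arrows G; dsrc G g = rng G h\<rbrakk>
      \<Longrightarrow> rng G (gcomp G g h) = rng G g"
    and gcomp_assoc: "\<lbrakk>g \<in> arrows G; h \<in> arrows G; k \<in> arrows G; dsrc G g = rng G h; dsrc G h = rng G k\<rbrakk>
      \<Longrightarrow> gcomp G (gcomp G g h) k = gcomp G g (gcomp G h k)"
    and gcomp_dsrc: "g \<in> arrows G \<Longrightarrow> gcomp G g (dsrc G g) = g"
    and rng_gcomp_unit: "g \<in> arrows G \<Longrightarrow> gcomp G (rng G g) g = g"

definition isotropy_group :: "('g, 'm) top_groupoid_scheme \<Rightarrow> 'g \<Rightarrow> 'g monoid" where
  "isotropy_group G x =
     \<lparr>carrier = {g \<in> arrows G. dsrc G g = x \<and> rng G g = x}, mult = gcomp G, one = x\<rparr>"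

definition orbit :: "('g, 'm) top_groupoid_scheme \<Rightarrow> 'g \<Rightarrow> 'g set" where
  "orbit G x = {y \<in> units G. \<exists>g\<in>arrows G. dsrc G g = x \<and> rng G g = y}"

definition orbit_representatives ::
  "('g, 'm) top_groupoid_scheme \<Rightarrow> 'j set \<Rightarrow> ('j \<Rightarrow> 'g) \<Rightarrow> bool" where
  "orbit_representatives G J x \<longleftrightarrow>
     (\<forall>\<alpha>\<in>J. x \<alpha> \<in> units G) \<and> (\<forall>y\<in>units G. \<exists>!\<alpha>. \<alpha> \<in> J \<and> y \<in> orbit G (x \<alpha>))"

abbreviation unit_space :: "('g, 'm) top_groupoid_scheme \<Rightarrow> 'g topology" where
  "unit_space G \<equiv> subtopology (gtop G) (units G)"

text \<open>The arrow space itself is not required to be Hausdorff.\<close>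

definition topological_groupoid :: "('g, 'm) top_groupoid_scheme \<Rightarrow> bool" where
  "topological_groupoid G \<longleftrightarrow>
     groupoid G \<and> topspace (gtop G) = arrows G \<and>
     continuous_map
       (subtopology (prod_topology (gtop G) (gtop G))
          {(g, h). g \<in> arrows G \<and> h \<in> arrows G \<and> dsrc G g = rng G h})
       (gtop G) (\<lambda>(g, h). gcomp G g h) \<and>
     continuous_map (gtop G) (gtop G) (ginv G) \<and>
     locally_compact_space (gtop G) \<and>
     locally_compact_space (unit_space G) \<and> Hausdorff_space (unit_space G)"

definition local_homeomorphism :: "'a topology \<Rightarrow> 'b topology \<Rightarrow> ('a \<Rightarrow> 'b) \<Rightarrow> bool" where
  "local_homeomorphism X Y f \<longleftrightarrow>
     (\<forall>x\<in>topspace X. \<exists>U. openin X U \<and> x \<in> U \<and> openin Y (f ` U) \<and>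
        homeomorphic_map (subtopology X U) (subtopology Y (f ` U)) f)"

definition etale_groupoid :: "('g, 'm) top_groupoid_scheme \<Rightarrow> bool" where
  "etale_groupoid G \<longleftrightarrow>
     topological_groupoid G \<and>
     local_homeomorphism (gtop G) (unit_space G) (dsrc G) \<and>
     local_homeomorphism (gtop G) (unit_space G) (rng G)"

definition open_bisection :: "('g, 'm) top_groupoid_scheme \<Rightarrow> 'g set \<Rightarrow> bool" where
  "open_bisection G U \<longleftrightarrow> openin (gtop G) U \<and> inj_on (dsrc G) U \<and> inj_on (rng G) U"

definition compact_open_bisection :: "('g, 'm) top_groupoid_scheme \<Rightarrow> 'g set \<Rightarrow> bool" where
  "compact_open_bisection G U \<longleftrightarrow> open_bisection G U \<and> compactin (gtop G) U"

definition ample_groupoid :: "('g, 'm) top_groupoid_scheme \<Rightarrow> bool" where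
  "ample_groupoid G \<longleftrightarrow>
     etale_groupoid G \<and> Hausdorff_space (unit_space G) \<and>
     openin (gtop G) = arbitrary union_of (compact_open_bisection G)"

definition discrete_groupoid :: "('g, 'm) top_groupoid_scheme \<Rightarrow> bool" where
  "discrete_groupoid G \<longleftrightarrow> gtop G = discrete_topology (arrows G)"

text \<open>
  The carrier is the set of linear combinations of characteristic functions of compact open
  bisections, which vanish outside the arrows. An element is nonzero at only finitely many arrows
  with a given source, so restricting the convolution sum to \<open>f\<^sub>2(h) \<noteq> 0\<close>
  makes it a finite sum without changing it.
\<close>

definition groupoid_algebra ::
  "'r::comm_ring_1 itself \<Rightarrow> ('g, 'm) top_groupoid_scheme \<Rightarrow> ('r, 'g \<Rightarrow> 'r) module" where
  "groupoid_algebra R G =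
     \<lparr>carrier = {f. \<exists>\<U> c. finite \<U> \<and> (\<forall>U\<in>\<U>. compact_open_bisection G U) \<and>
                        f = (\<lambda>g. \<Sum>U\<in>\<U>. c U * indicator U g)},
      mult = (\<lambda>f1 f2 g. if g \<in> arrows G
                then \<Sum>h\<in>{h \<in> arrows G. dsrc G h = dsrc G g \<and> f2 h \<noteq> 0}.
                       f1 (gcomp G g (ginv G h)) * f2 h
                else 0),
      one = undefined,
      zero = (\<lambda>g. 0),
      add = (\<lambda>f1 f2 g. f1 g + f2 g),
      smult = (\<lambda>r f g. r * f g)\<rparr>"

end

theory Submission
  imports Defs
begin

text \<open>
  Everything rests on an elementwise form of semisimplicity. Call \<open>v\<close> in a left module a
  simple vector if \<open>v\<close> is nonzero, \<open>v \<in> Av\<close>, and \<open>v \<in> Aav\<close> whenever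
  \<open>av \<noteq> 0\<close>; these are the nonzero elements of the simple submodules. A module is
  semisimple iff each of its elements is a finite sum of simple vectors
  (\<open>socle_imp_semisimple_module\<close>, by Zorn's lemma, and
  \<open>semisimple_module_imp_socle\<close>). For a ring acting on itself these sums form a two-sided
  ideal, the socle, and multiplying a simple vector by \<open>e\<close> on both sides gives zero or a
  simple vector of the corner \<open>eAe\<close>. Hence semisimple rings are locally semisimple.

  Let \<open>A\<close> be the algebra of an ample groupoid and suppose that \<open>A\<close> is locally
  semisimple. Take a unit \<open>x\<close>, a compact open neighbourhood \<open>U\<close> of \<open>x\<close> in
  the unit space, and write the characteristic function \<open>e\<close> of \<open>U\<close> as a sum of
  simple vectors of \<open>eAe\<close>. Let \<open>v\<close> be one of them. If \<open>v\<close> vanishes on all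
  arrows with range in some neighbourhood of \<open>x\<close>, it can be disregarded near \<open>x\<close>.
  Otherwise the characteristic function \<open>f\<close> of any small compact open neighbourhood of
  \<open>x\<close> satisfies \<open>f * v \<noteq> 0\<close>, so \<open>v = b * (f * v)\<close> for some \<open>b\<close>:
  every source of an arrow in the support of \<open>v\<close> is also the source of such an arrow with
  range arbitrarily near \<open>x\<close>. As the support is covered by finitely many bisections, that
  arrow can be taken with range \<open>x\<close>, and then the support is finite. Together, \<open>e\<close>
  has finite support near \<open>x\<close>, so \<open>x\<close> is isolated, and the groupoid is discrete.

  For a discrete groupoid, \<open>A\<close> is the convolution algebra \<open>D\<close> of finitely supported
  functions, and the group ring of the isotropy group at \<open>x\<close> is the corner of \<open>D\<close> at
  the point mass of \<open>x\<close>. This gives the semisimplicity of the group rings. Conversely, a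
  simple vector of that corner is simple in \<open>D\<close>, because a nonzero multiple of it can be
  translated by an arrow so that it is nonzero at \<open>x\<close>; hence if the group rings at orbit
  representatives are semisimple, the point masses of all units lie in the socle and \<open>D\<close> is
  semisimple (\<open>finite_support_semisimple\<close>).

  Finally, \<open>D\<close> is isomorphic to the direct sum of matrix algebras for every groupoid: after a
  choice of an arrow from its orbit representative to each unit, an arrow amounts to its range, its
  source and an isotropy element. So if \<open>A\<close> is isomorphic to the direct sum, it is
  isomorphic to \<open>D\<close>, and it is semisimple when the group rings are.
\<close>

section \<open>Simple vectors and the socle\<close>

text \<open>
  A nonzero vector is of this kind iff \<open>Av\<close> is a simple submodule that contains
  \<open>v\<close>. The condition \<open>v \<in> Av\<close> replaces the action of a unit, which \<open>A\<close> may
  lack.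
\<close>

definition simple_vectors :: "('a, 'n) ring_scheme \<Rightarrow> ('a, 'b, 'm) module_scheme \<Rightarrow> 'b set" where
  "simple_vectors A M =
     {v \<in> carrier M. v \<noteq> \<zero>\<^bsub>M\<^esub> \<and> (\<exists>a\<in>carrier A. a \<odot>\<^bsub>M\<^esub> v = v) \<and>
        (\<forall>a\<in>carrier A. a \<odot>\<^bsub>M\<^esub> v \<noteq> \<zero>\<^bsub>M\<^esub> \<longrightarrow>
           (\<exists>b\<in>carrier A. b \<odot>\<^bsub>M\<^esub> (a \<odot>\<^bsub>M\<^esub> v) = v))}"

inductive_set socle :: "('a, 'n) ring_scheme \<Rightarrow> ('a, 'b, 'm) module_scheme \<Rightarrow> 'b set"
  for A :: "('a, 'n) ring_scheme" and M :: "('a, 'b, 'm) module_scheme" where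
  zero: "\<zero>\<^bsub>M\<^esub> \<in> socle A M"
| add: "\<lbrakk>v \<in> simple_vectors A M; x \<in> socle A M\<rbrakk> \<Longrightarrow> v \<oplus>\<^bsub>M\<^esub> x \<in> socle A M"

context left_module
begin

lemma smult_zero_left [simp]:
  assumes "x \<in> carrier M" shows "\<zero>\<^bsub>A\<^esub> \<odot>\<^bsub>M\<^esub> x = \<zero>\<^bsub>M\<^esub>"
  using smult_l_distr[of "\<zero>\<^bsub>A\<^esub>" "\<zero>\<^bsub>A\<^esub>" x] smult_closed[of "\<zero>\<^bsub>A\<^esub>" x] assms
  by (metis A.l_zero A.zero_closed M.add.l_cancel_one)

lemma smult_zero_right [simp]:
  assumes "a \<in> carrier A" shows "a \<odot>\<^bsub>M\<^esub> \<zero>\<^bsub>M\<^esub> = \<zero>\<^bsub>M\<^esub>"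
  using smult_r_distr[of a "\<zero>\<^bsub>M\<^esub>" "\<zero>\<^bsub>M\<^esub>"] smult_closed[of a "\<zero>\<^bsub>M\<^esub>"] assms
  by (metis M.l_zero M.zero_closed M.add.l_cancel_one)

lemma smult_minus_left:
  assumes "a \<in> carrier A" "x \<in> carrier M"
  shows "(\<ominus>\<^bsub>A\<^esub> a) \<odot>\<^bsub>M\<^esub> x = \<ominus>\<^bsub>M\<^esub> (a \<odot>\<^bsub>M\<^esub> x)"
  using smult_l_distr[of "\<ominus>\<^bsub>A\<^esub> a" a x] assms smult_closed
  by (metis A.a_inv_closed A.l_neg M.minus_equality smult_zero_left)

lemma smult_minus_right:
  assumes "a \<in> carrier A" "x \<in> carrier M"
  shows "a \<odot>\<^bsub>M\<^esub> (\<ominus>\<^bsub>M\<^esub> x) = \<ominus>\<^bsub>M\<^esub> (a \<odot>\<^bsub>M\<^esub> x)"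
  using smult_r_distr[of a "\<ominus>\<^bsub>M\<^esub> x" x] assms smult_closed
  by (metis M.a_inv_closed M.l_neg M.minus_equality smult_zero_right)

lemma submoduleI:
  assumes "H \<subseteq> carrier M" "\<zero>\<^bsub>M\<^esub> \<in> H" "\<And>x. x \<in> H \<Longrightarrow> \<ominus>\<^bsub>M\<^esub> x \<in> H"
    "\<And>x y. \<lbrakk>x \<in> H; y \<in> H\<rbrakk> \<Longrightarrow> x \<oplus>\<^bsub>M\<^esub> y \<in> H"
    "\<And>a x. \<lbrakk>a \<in> carrier A; x \<in> H\<rbrakk> \<Longrightarrow> a \<odot>\<^bsub>M\<^esub> x \<in> H"
  shows "submodule H A M"
  using assms by (intro submodule.intro subgroup.intro) (simp_all add: a_inv_def submodule_axioms_def)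

lemma submoduleD:
  assumes "submodule H A M"
  shows "H \<subseteq> carrier M" "\<zero>\<^bsub>M\<^esub> \<in> H" "\<And>x. x \<in> H \<Longrightarrow> \<ominus>\<^bsub>M\<^esub> x \<in> H"
    "\<And>x y. \<lbrakk>x \<in> H; y \<in> H\<rbrakk> \<Longrightarrow> x \<oplus>\<^bsub>M\<^esub> y \<in> H"
    "\<And>a x. \<lbrakk>a \<in> carrier A; x \<in> H\<rbrakk> \<Longrightarrow> a \<odot>\<^bsub>M\<^esub> x \<in> H"
proof -
  have sg: "subgroup H (add_monoid M)" using assms by (rule submodule.axioms)
  show "H \<subseteq> carrier M" "\<zero>\<^bsub>M\<^esub> \<in> H" "\<And>x. x \<in> H \<Longrightarrow> \<ominus>\<^bsub>M\<^esub> x \<in> H"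
    "\<And>x y. \<lbrakk>x \<in> H; y \<in> H\<rbrakk> \<Longrightarrow> x \<oplus>\<^bsub>M\<^esub> y \<in> H"
    using subgroup.subset[OF sg] subgroup.one_closed[OF sg] subgroup.m_closed[OF sg]
      subgroup.m_inv_closed[OF sg] by (auto simp: a_inv_def)
  show "\<And>a x. \<lbrakk>a \<in> carrier A; x \<in> H\<rbrakk> \<Longrightarrow> a \<odot>\<^bsub>M\<^esub> x \<in> H"
    using assms by (rule submodule.smult_closed)
qed

lemma submodule_left_module:
  assumes "submodule H A M" shows "left_module A (M\<lparr>carrier := H\<rparr>)"
proof -
  note H = submoduleD[OF assms]
  have "abelian_group (M\<lparr>carrier := H\<rparr>)"
  proof (rule abelian_groupI)
    fix x assume "x \<in> carrier (M\<lparr>carrier := H\<rparr>)"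
    then show "\<exists>y\<in>carrier (M\<lparr>carrier := H\<rparr>). y \<oplus>\<^bsub>M\<lparr>carrier := H\<rparr>\<^esub> x = \<zero>\<^bsub>M\<lparr>carrier := H\<rparr>\<^esub>"
      using H(1) H(3)[of x] M.l_neg[of x] by auto
  qed (use H in \<open>auto simp: M.add.m_ac subset_iff\<close>)
  then show ?thesis
    using H unfolding left_module_def left_module_axioms_def
    by (auto simp: A.nonunital_ring_axioms smult_l_distr smult_r_distr smult_assoc subset_iff)
qed

lemma cyclic_submodule:
  assumes "v \<in> carrier M" shows "submodule ((\<lambda>a. a \<odot>\<^bsub>M\<^esub> v) ` carrier A) A M"
proof (rule submoduleI, goal_cases)
  case 1 then show ?case using assms smult_closed by auto
next
  case 2 then show ?case using assms by (force intro: rev_image_eqI[of "\<zero>\<^bsub>A\<^esub>"])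
next
  case (3 x) then show ?case using assms
    by (auto simp: smult_minus_left[symmetric])
next
  case (4 x y) then show ?case using assms
    by (auto simp: smult_l_distr[symmetric])
next
  case (5 a x) then show ?case using assms
    by (auto simp: smult_assoc[symmetric] A.m_closed)
qed

text \<open>
  A nonzero submodule of \<open>Av\<close> contains some \<open>av \<noteq> 0\<close>, from which
  \<open>v\<close> and hence all of \<open>Av\<close> is recovered.
\<close>

lemma simple_vector_cyclic_simple:
  assumes "v \<in> simple_vectors A M"
  shows "simple_module A (M\<lparr>carrier := (\<lambda>a. a \<odot>\<^bsub>M\<^esub> v) ` carrier A\<rparr>)"
    and "v \<in> (\<lambda>a. a \<odot>\<^bsub>M\<^esub> v) ` carrier A"
proof -
  define N where "N = (\<lambda>a. a \<odot>\<^bsub>M\<^esub> v) ` carrier A"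
  have v: "v \<in> carrier M" "v \<noteq> \<zero>\<^bsub>M\<^esub>"
    and ret: "\<And>a. \<lbrakk>a \<in> carrier A; a \<odot>\<^bsub>M\<^esub> v \<noteq> \<zero>\<^bsub>M\<^esub>\<rbrakk> \<Longrightarrow> \<exists>b\<in>carrier A. b \<odot>\<^bsub>M\<^esub> (a \<odot>\<^bsub>M\<^esub> v) = v"
    using assms by (auto simp: simple_vectors_def)
  obtain e where e: "e \<in> carrier A" "e \<odot>\<^bsub>M\<^esub> v = v"
    using assms by (auto simp: simple_vectors_def)
  show vN: "v \<in> (\<lambda>a. a \<odot>\<^bsub>M\<^esub> v) ` carrier A" using e by force
  have sub: "submodule N A M" unfolding N_def using v(1) by (rule cyclic_submodule)
  have "K = {\<zero>\<^bsub>M\<^esub>} \<or> K = N" if K: "submodule K A (M\<lparr>carrier := N\<rparr>)" for K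
  proof -
    note K' = left_module.submoduleD[OF submodule_left_module[OF sub] K, simplified]
    show ?thesis
    proof (cases "K = {\<zero>\<^bsub>M\<^esub>}")
      case False
      then obtain w where w: "w \<in> K" "w \<noteq> \<zero>\<^bsub>M\<^esub>" using K'(2) by auto
      then obtain a where "a \<in> carrier A" "w = a \<odot>\<^bsub>M\<^esub> v" using K'(1) by (auto simp: N_def)
      with ret w obtain b where "b \<in> carrier A" "b \<odot>\<^bsub>M\<^esub> w = v" by auto
      then have "v \<in> K" using K'(5) w by force
      then have "N \<subseteq> K" using K'(5) by (auto simp: N_def)
      then show ?thesis using K'(1) by auto
    qed simp
  qed
  moreover have "N \<noteq> {\<zero>\<^bsub>M\<^esub>}" using vN v(2) by (auto simp: N_def)
  moreover have "\<not> (\<forall>a\<in>carrier A. \<forall>x\<in>N. a \<odot>\<^bsub>M\<^esub> x = \<zero>\<^bsub>M\<^esub>)"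
    using vN e v(2) unfolding N_def by metis
  ultimately have "simple_module A (M\<lparr>carrier := N\<rparr>)"
    unfolding simple_module_def using submodule_left_module[OF sub] by simp
  then show "simple_module A (M\<lparr>carrier := (\<lambda>a. a \<odot>\<^bsub>M\<^esub> v) ` carrier A\<rparr>)" by (simp add: N_def)
qed

lemma socle_subset: "socle A M \<subseteq> carrier M"
proof
  fix x assume "x \<in> socle A M"
  then show "x \<in> carrier M" by induct (auto simp: simple_vectors_def)
qed

lemma simple_vector_in_socle: "v \<in> simple_vectors A M \<Longrightarrow> v \<in> socle A M"
  using socle.add[OF _ socle.zero, of v A M] by (simp add: simple_vectors_def)

lemma socle_closed_add:
  assumes "x \<in> socle A M" "y \<in> socle A M" shows "x \<oplus>\<^bsub>M\<^esub> y \<in> socle A M"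
  using assms(1)
proof induct
  case zero then show ?case using assms(2) socle_subset by auto
next
  case (add v x)
  have "v \<oplus>\<^bsub>M\<^esub> (x \<oplus>\<^bsub>M\<^esub> y) \<in> socle A M" by (intro socle.add[OF add(1) add(3)])
  moreover have "v \<in> carrier M" "x \<in> carrier M" "y \<in> carrier M"
    using add assms(2) socle_subset by (auto simp: simple_vectors_def)
  ultimately show ?case by (simp add: M.a_assoc)
qed

end

text \<open>
  The vectors annihilated by \<open>A\<close> form a proper submodule, which is therefore zero. So
  \<open>Aw\<close> is nonzero for \<open>w \<noteq> 0\<close>, and by simplicity it is the whole module.
\<close>

lemma simple_module_nonzero_simple_vector:
  assumes simple: "simple_module A M" and w: "w \<in> carrier M" "w \<noteq> \<zero>\<^bsub>M\<^esub>"
  shows "w \<in> simple_vectors A M"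
proof -
  interpret left_module A M using simple by (simp add: simple_module_def)
  have alt: "N = {\<zero>\<^bsub>M\<^esub>} \<or> N = carrier M" if "submodule N A M" for N
    using simple that by (auto simp: simple_module_def)
  define Z where "Z = {u \<in> carrier M. \<forall>a\<in>carrier A. a \<odot>\<^bsub>M\<^esub> u = \<zero>\<^bsub>M\<^esub>}"
  have "submodule Z A M"
    by (rule submoduleI)
       (auto simp: Z_def smult_r_distr smult_minus_right smult_closed smult_assoc[symmetric] A.m_closed)
  moreover have "Z \<noteq> carrier M" using simple by (auto simp: simple_module_def Z_def)
  ultimately have Z: "Z = {\<zero>\<^bsub>M\<^esub>}" using alt by blast
  have gen: "(\<lambda>a. a \<odot>\<^bsub>M\<^esub> u) ` carrier A = carrier M" if "u \<in> carrier M" "u \<noteq> \<zero>\<^bsub>M\<^esub>" for u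
  proof -
    have "u \<notin> Z" using that Z by simp
    then have "(\<lambda>a. a \<odot>\<^bsub>M\<^esub> u) ` carrier A \<noteq> {\<zero>\<^bsub>M\<^esub>}" using that by (auto simp: Z_def)
    then show ?thesis using alt[OF cyclic_submodule] that by blast
  qed
  show ?thesis
    unfolding simple_vectors_def using w gen smult_closed
    by (smt (verit, best) image_iff mem_Collect_eq)
qed

lemma (in left_module) simple_submodule_simple_vector:
  assumes "submodule N A M" "simple_module A (M\<lparr>carrier := N\<rparr>)" "w \<in> N" "w \<noteq> \<zero>\<^bsub>M\<^esub>"
  shows "w \<in> simple_vectors A M"
  using simple_module_nonzero_simple_vector[OF assms(2), of w] assms submoduleD(1)[OF assms(1)]
  by (auto simp: simple_vectors_def)

lemma semisimple_module_imp_socle: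
  assumes "semisimple_module A M" shows "carrier M \<subseteq> socle A M"
proof
  fix x assume x: "x \<in> carrier M"
  interpret left_module A M using assms by (simp add: semisimple_module_def)
  obtain S where S: "\<And>N. N \<in> S \<Longrightarrow> submodule N A M"
      "\<And>N. N \<in> S \<Longrightarrow> simple_module A (M\<lparr>carrier := N\<rparr>)" "is_direct_sum M S"
    using assms by (auto simp: semisimple_module_def)
  then obtain f where f: "f \<in> (\<Pi>\<^sub>E N\<in>S. N)" "finite {N \<in> S. f N \<noteq> \<zero>\<^bsub>M\<^esub>}"
      "x = (\<Oplus>\<^bsub>M\<^esub>N\<in>{N \<in> S. f N \<noteq> \<zero>\<^bsub>M\<^esub>}. f N)"
    using x unfolding is_direct_sum_def by blast
  have simple: "f N \<in> simple_vectors A M" if "N \<in> S" "f N \<noteq> \<zero>\<^bsub>M\<^esub>" for N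
    using simple_submodule_simple_vector[of N "f N"] S that f(1) by (auto simp: PiE_iff)
  have "(\<Oplus>\<^bsub>M\<^esub>N\<in>T. f N) \<in> socle A M" if "finite T" "T \<subseteq> {N \<in> S. f N \<noteq> \<zero>\<^bsub>M\<^esub>}" for T
    using that
  proof induct
    case empty then show ?case by (simp add: socle.zero)
  next
    case (insert N T)
    have "f \<in> T \<rightarrow> carrier M" "f N \<in> carrier M"
      using insert simple by (auto simp: simple_vectors_def)
    then show ?case using insert simple by (auto intro: socle.add)
  qed
  from this[OF f(2) order.refl] show "x \<in> socle A M" by (simp add: f(3))
qed

text \<open>
  The families of submodules are indexed by themselves, in accordance with
  \<open>is_direct_sum\<close>.
\<close>

definition family_sum :: "('a, 'b, 'm) module_scheme \<Rightarrow> 'b set set \<Rightarrow> 'b set" where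
  "family_sum M S = {finsum M f T | T f. finite T \<and> T \<subseteq> S \<and> (\<forall>N\<in>T. f N \<in> N)}"

definition independent_family :: "('a, 'b, 'm) module_scheme \<Rightarrow> 'b set set \<Rightarrow> bool" where
  "independent_family M S \<longleftrightarrow>
     (\<forall>T f. finite T \<longrightarrow> T \<subseteq> S \<longrightarrow> (\<forall>N\<in>T. f N \<in> N) \<longrightarrow> finsum M f T = \<zero>\<^bsub>M\<^esub> \<longrightarrow>
        (\<forall>N\<in>T. f N = \<zero>\<^bsub>M\<^esub>))"

lemma independent_familyD:
  assumes "independent_family M S" "finite T" "T \<subseteq> S" "\<forall>N\<in>T. f N \<in> N"
    "finsum M f T = \<zero>\<^bsub>M\<^esub>"
  shows "\<forall>N\<in>T. f N = \<zero>\<^bsub>M\<^esub>"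
  using assms(1)[unfolded independent_family_def, rule_format, OF assms(2,3) _ assms(5)] assms(4)
  by simp

lemma (in abelian_group) finsum_additive_map:
  assumes "finite T" "f \<in> T \<rightarrow> carrier G"
    and "\<And>x. x \<in> carrier G \<Longrightarrow> h x \<in> carrier G"
    and "\<And>x y. \<lbrakk>x \<in> carrier G; y \<in> carrier G\<rbrakk> \<Longrightarrow> h (x \<oplus> y) = h x \<oplus> h y"
  shows "h (finsum G f T) = (\<Oplus>N\<in>T. h (f N))"
  using assms(1,2)
proof induct
  case empty
  have "h \<zero> \<oplus> h \<zero> = h \<zero>" using assms(4)[of \<zero> \<zero>] by simp
  then show ?case using assms(3)[of \<zero>] by (simp add: add.l_cancel_one)
next
  case (insert N T)
  then have "f \<in> T \<rightarrow> carrier G" "f N \<in> carrier G" "(\<lambda>N. h (f N)) \<in> T \<rightarrow> carrier G"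
    "h (f N) \<in> carrier G" using assms(3) by auto
  then show ?case using insert assms(3,4) by simp
qed

lemma (in abelian_group) finsum_extend_zero:
  assumes "finite T'" "T \<subseteq> T'" "f \<in> T \<rightarrow> carrier G"
  shows "(\<Oplus>N\<in>T'. if N \<in> T then f N else \<zero>) = finsum G f T"
  using assms by (intro add.finprod_mono_neutral_cong_right) auto

context left_module
begin

text \<open>
  Sums over different finite subfamilies are added after extending both by zero to the union;
  negation and scalar multiplication are additive maps that preserve each summand.
\<close>

lemma submodule_family_sum:
  assumes S: "\<And>N. N \<in> S \<Longrightarrow> submodule N A M"
  shows "submodule (family_sum M S) A M"
proof -
  have fS: "f \<in> T \<rightarrow> carrier M" if "T \<subseteq> S" "\<forall>N\<in>T. f N \<in> N" for f T
    using that submoduleD(1)[OF S] by blast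
  have map: "h x \<in> family_sum M S"
    if "x \<in> family_sum M S" and h: "\<And>x. x \<in> carrier M \<Longrightarrow> h x \<in> carrier M"
      "\<And>x y. \<lbrakk>x \<in> carrier M; y \<in> carrier M\<rbrakk> \<Longrightarrow> h (x \<oplus>\<^bsub>M\<^esub> y) = h x \<oplus>\<^bsub>M\<^esub> h y"
      "\<And>N x. \<lbrakk>N \<in> S; x \<in> N\<rbrakk> \<Longrightarrow> h x \<in> N" for h x
  proof -
    obtain T f where T: "finite T" "T \<subseteq> S" "\<forall>N\<in>T. f N \<in> N" "x = finsum M f T"
      using \<open>x \<in> family_sum M S\<close> by (auto simp: family_sum_def)
    have "h x = (\<Oplus>\<^bsub>M\<^esub>N\<in>T. h (f N))"
      using M.finsum_additive_map[OF T(1) fS[OF T(2,3)] h(1,2)] T(4) by simp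
    then show ?thesis using T h(3) unfolding family_sum_def by blast
  qed
  show ?thesis
  proof (rule submoduleI, goal_cases)
    case 1 then show ?case using fS by (auto simp: family_sum_def)
  next
    case 2 show ?case unfolding family_sum_def
      by (rule CollectI, rule exI[of _ "{}"]) simp
  next
    case (3 x) then show ?case
      by (rule map) (auto simp: M.minus_add M.a_comm intro: submoduleD(3)[OF S])
  next
    case (4 x y)
    obtain T f where T: "finite T" "T \<subseteq> S" "\<forall>N\<in>T. f N \<in> N" "x = finsum M f T"
      using 4(1) by (auto simp: family_sum_def)
    obtain T' f' where T': "finite T'" "T' \<subseteq> S" "\<forall>N\<in>T'. f' N \<in> N" "y = finsum M f' T'"
      using 4(2) by (auto simp: family_sum_def)
    define g g' where "g N = (if N \<in> T then f N else \<zero>\<^bsub>M\<^esub>)"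
      and "g' N = (if N \<in> T' then f' N else \<zero>\<^bsub>M\<^esub>)" for N
    have "x = finsum M g (T \<union> T')" "y = finsum M g' (T \<union> T')"
      unfolding g_def g'_def T(4) T'(4) using T(1) T'(1) fS[OF T(2,3)] fS[OF T'(2,3)]
      by (intro M.finsum_extend_zero[symmetric]; simp)+
    moreover have "g \<in> T \<union> T' \<rightarrow> carrier M" "g' \<in> T \<union> T' \<rightarrow> carrier M"
      using fS[OF T(2,3)] fS[OF T'(2,3)] by (auto simp: g_def g'_def)
    ultimately have "x \<oplus>\<^bsub>M\<^esub> y = (\<Oplus>\<^bsub>M\<^esub>N\<in>T \<union> T'. g N \<oplus>\<^bsub>M\<^esub> g' N)"
      by (simp add: M.finsum_addf)
    moreover have "g N \<oplus>\<^bsub>M\<^esub> g' N \<in> N" if "N \<in> T \<union> T'" for N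
    proof -
      have "submodule N A M" using that T(2) T'(2) S by auto
      note N = submoduleD[OF this]
      show ?thesis using N(2,4) T(3) T'(3) by (auto simp: g_def g'_def)
    qed
    ultimately show ?case unfolding family_sum_def using T(1,2) T'(1,2)
      by (intro CollectI exI[of _ "T \<union> T'"] exI[of _ "\<lambda>N. g N \<oplus>\<^bsub>M\<^esub> g' N"]) auto
  next
    case (5 a x) then show ?case
      by (intro map[of x "\<lambda>x. a \<odot>\<^bsub>M\<^esub> x"])
         (auto simp: smult_closed smult_r_distr intro: submoduleD(5)[OF S])
  qed
qed

text \<open>
  In a vanishing sum, the term in \<open>N0\<close> is minus a sum of terms from \<open>S\<close>, so it
  lies in the trivial intersection.
\<close>

lemma independent_family_insert:
  assumes S: "\<And>N. N \<in> S \<Longrightarrow> submodule N A M" "submodule N0 A M"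
    and ind: "independent_family M S" and triv: "N0 \<inter> family_sum M S \<subseteq> {\<zero>\<^bsub>M\<^esub>}"
  shows "independent_family M (insert N0 S)"
  unfolding independent_family_def
proof (intro allI impI)
  fix T f assume T: "finite T" "T \<subseteq> insert N0 S" and f: "\<forall>N\<in>T. f N \<in> N"
    and sum0: "finsum M f T = \<zero>\<^bsub>M\<^esub>"
  define s where "s = finsum M f (T - {N0})"
  have "N \<subseteq> carrier M" if "N \<in> T" for N
    using submoduleD(1)[OF S(1)] submoduleD(1)[OF S(2)] that T(2) by blast
  then have fc: "f \<in> T \<rightarrow> carrier M" using f by blast
  have s: "s \<in> family_sum M S"
    unfolding s_def family_sum_def
    using T f by (intro CollectI exI[of _ "T - {N0}"] exI[of _ f]) auto
  note K = submoduleD[OF submodule_family_sum[OF S(1)]]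
  have s0: "s = \<zero>\<^bsub>M\<^esub> \<and> (N0 \<in> T \<longrightarrow> f N0 = \<zero>\<^bsub>M\<^esub>)"
  proof (cases "N0 \<in> T")
    case True
    have "finsum M f (insert N0 (T - {N0})) = f N0 \<oplus>\<^bsub>M\<^esub> s"
      unfolding s_def using T(1) fc True by (intro M.finsum_insert) auto
    then have *: "f N0 \<oplus>\<^bsub>M\<^esub> s = \<zero>\<^bsub>M\<^esub>" using sum0 True by (simp add: insert_absorb)
    have c: "f N0 \<in> carrier M" "s \<in> carrier M" using fc True s K(1) by auto
    then have "f N0 = \<ominus>\<^bsub>M\<^esub> s" using * by (simp add: M.minus_equality)
    then have "f N0 \<in> N0 \<inter> family_sum M S" using K(3) s f True by auto
    then have "f N0 = \<zero>\<^bsub>M\<^esub>" using triv by auto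
    then show ?thesis using * c by simp
  next
    case False then show ?thesis using sum0 by (simp add: s_def)
  qed
  moreover have "finite (T - {N0})" "T - {N0} \<subseteq> S" "\<forall>N\<in>T - {N0}. f N \<in> N"
    using T f by auto
  ultimately have "\<forall>N\<in>T - {N0}. f N = \<zero>\<^bsub>M\<^esub>"
    using s0 unfolding s_def by (intro independent_familyD[OF ind]) blast+
  then show "\<forall>N\<in>T. f N = \<zero>\<^bsub>M\<^esub>" using s0 by auto
qed

text \<open>
  Uniqueness of the decomposition: the difference of two decompositions is a vanishing sum over the
  union of their supports.
\<close>

lemma independent_family_is_direct_sum:
  assumes S: "\<And>N. N \<in> S \<Longrightarrow> submodule N A M"
    and ind: "independent_family M S" and all: "carrier M \<subseteq> family_sum M S"
  shows "is_direct_sum M S"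
  unfolding is_direct_sum_def
proof (intro conjI ballI)
  fix N assume "N \<in> S" then show "N \<subseteq> carrier M" using submoduleD(1)[OF S] by simp
next
  fix x assume x: "x \<in> carrier M"
  let ?D = "\<lambda>f. {N \<in> S. f N \<noteq> \<zero>\<^bsub>M\<^esub>}"
  have Sc: "N \<in> S \<Longrightarrow> y \<in> N \<Longrightarrow> y \<in> carrier M" for N y using submoduleD(1)[OF S] by blast
  obtain T f where T: "finite T" "T \<subseteq> S" "\<forall>N\<in>T. f N \<in> N" "x = finsum M f T"
    using x all by (auto simp: family_sum_def)
  have fc: "f \<in> T \<rightarrow> carrier M" using T Sc by blast
  define g where "g = (\<lambda>N\<in>S. if N \<in> T then f N else \<zero>\<^bsub>M\<^esub>)"
  have gT: "?D g \<subseteq> T" by (auto simp: g_def)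
  show "\<exists>!f. f \<in> (\<Pi>\<^sub>E N\<in>S. N) \<and> finite (?D f) \<and> x = finsum M f (?D f)"
  proof (rule ex1I[of _ g], intro conjI)
    show "g \<in> (\<Pi>\<^sub>E N\<in>S. N)" using T submoduleD(2)[OF S] by (auto simp: g_def)
    show "finite (?D g)" using gT T(1) finite_subset by blast
    show "x = finsum M g (?D g)"
      unfolding T(4) using T fc gT
      by (intro M.add.finprod_mono_neutral_cong_right) (auto simp: g_def subset_iff)
  next
    fix h assume h: "h \<in> (\<Pi>\<^sub>E N\<in>S. N) \<and> finite (?D h) \<and> x = finsum M h (?D h)"
    define U where "U = T \<union> ?D h"
    have U: "finite U" "U \<subseteq> S" using T h by (auto simp: U_def)
    have hc: "h \<in> U \<rightarrow> carrier M" and gc: "g \<in> U \<rightarrow> carrier M"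
      using h T Sc submoduleD(2)[OF S] U fc by (auto simp: g_def PiE_iff)
    have "x = finsum M h U"
      using h U hc unfolding U_def
      by (auto intro!: M.add.finprod_mono_neutral_cong_left)
    moreover have "x = finsum M g U"
      unfolding T(4) using U gc fc T(2)
      by (intro M.add.finprod_mono_neutral_cong_left) (auto simp: g_def U_def subset_iff)
    moreover have "finsum M (\<lambda>N. \<ominus>\<^bsub>M\<^esub> h N) U = \<ominus>\<^bsub>M\<^esub> (finsum M h U)"
      using U(1) hc by (intro M.finsum_additive_map[symmetric]) (auto simp: M.minus_add M.a_comm)
    moreover have "(\<Oplus>\<^bsub>M\<^esub>N\<in>U. g N \<oplus>\<^bsub>M\<^esub> \<ominus>\<^bsub>M\<^esub> h N) = finsum M g U \<oplus>\<^bsub>M\<^esub> finsum M (\<lambda>N. \<ominus>\<^bsub>M\<^esub> h N) U"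
      using gc hc by (intro M.finsum_addf) auto
    ultimately have "(\<Oplus>\<^bsub>M\<^esub>N\<in>U. g N \<oplus>\<^bsub>M\<^esub> \<ominus>\<^bsub>M\<^esub> h N) = \<zero>\<^bsub>M\<^esub>" using x by (simp add: M.r_neg)
    moreover have "g N \<oplus>\<^bsub>M\<^esub> \<ominus>\<^bsub>M\<^esub> h N \<in> N" if "N \<in> U" for N
    proof -
      have NS: "N \<in> S" using that U by auto
      note N = submoduleD[OF S[OF NS]]
      show ?thesis using N(2,3,4) T(3) h NS by (auto simp: g_def PiE_iff)
    qed
    ultimately have "\<forall>N\<in>U. g N \<oplus>\<^bsub>M\<^esub> \<ominus>\<^bsub>M\<^esub> h N = \<zero>\<^bsub>M\<^esub>"
      by (intro independent_familyD[OF ind U]) auto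
    then have eq: "g N = h N" if "N \<in> U" for N
    proof -
      have c: "g N \<in> carrier M" "h N \<in> carrier M" using that gc hc by auto
      have "g N \<oplus>\<^bsub>M\<^esub> \<ominus>\<^bsub>M\<^esub> h N = \<zero>\<^bsub>M\<^esub>"
        using that \<open>\<forall>N\<in>U. g N \<oplus>\<^bsub>M\<^esub> \<ominus>\<^bsub>M\<^esub> h N = \<zero>\<^bsub>M\<^esub>\<close> by simp
      then have "\<ominus>\<^bsub>M\<^esub> (\<ominus>\<^bsub>M\<^esub> h N) = g N" using c by (intro M.minus_equality) simp_all
      then show ?thesis using c by simp
    qed
    show "h = g"
    proof
      fix N show "h N = g N"
        using eq[of N] h by (cases "h N = \<zero>\<^bsub>M\<^esub>"; cases "N \<in> S") (auto simp: U_def g_def PiE_iff extensional_def)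
    qed
  qed
qed

text \<open>
  A maximal independent family of simple submodules exists, as independence only concerns finite
  subfamilies. A simple vector outside its sum \<open>K\<close> would generate a simple submodule that
  meets \<open>K\<close> trivially and could be added to the family.
\<close>

lemma socle_imp_semisimple_module:
  assumes soc: "carrier M \<subseteq> socle A M"
  shows "semisimple_module A M"
proof -
  define \<N> where "\<N> = {N. submodule N A M \<and> simple_module A (M\<lparr>carrier := N\<rparr>)}"
  define \<A> where "\<A> = {S. S \<subseteq> \<N> \<and> independent_family M S}"
  have "\<exists>S\<in>\<A>. \<forall>X\<in>\<A>. S \<subseteq> X \<longrightarrow> X = S"
  proof (rule subset_Zorn')
    fix C assume C: "subset.chain \<A> C"
    then have CA: "C \<subseteq> \<A>" by (simp add: subset.chain_def)
    have "independent_family M (\<Union>C)"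
      unfolding independent_family_def
    proof (intro allI impI)
      fix T f assume *: "finite T" "T \<subseteq> \<Union>C" "\<forall>N\<in>T. f N \<in> N" "finsum M f T = \<zero>\<^bsub>M\<^esub>"
      show "\<forall>N\<in>T. f N = \<zero>\<^bsub>M\<^esub>"
      proof (cases "C = {}")
        case True then show ?thesis using *(2) by simp
      next
        case False
        obtain S where "S \<in> C" "T \<subseteq> S"
          by (rule finite_subset_Union_chain[OF *(1,2) False C])
        then have "S \<in> \<A>" using CA by blast
        then have "independent_family M S" by (simp add: \<A>_def)
        then show ?thesis using \<open>T \<subseteq> S\<close> by (rule independent_familyD[OF _ *(1) _ *(3,4)])
      qed
    qed
    moreover have "\<Union>C \<subseteq> \<N>" using CA by (auto simp: \<A>_def)
    ultimately show "\<Union>C \<in> \<A>" by (simp add: \<A>_def)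
  qed
  then obtain S where "S \<in> \<A>" and max: "\<forall>X\<in>\<A>. S \<subseteq> X \<longrightarrow> X = S" by (elim bexE)
  then have S: "S \<subseteq> \<N>" "independent_family M S" by (simp_all add: \<A>_def)
  have Ssub: "submodule N A M" if "N \<in> S" for N using subsetD[OF S(1) that] by (simp add: \<N>_def)
  define K where "K = family_sum M S"
  have Ksub: "submodule K A M" unfolding K_def using Ssub by (rule submodule_family_sum)
  note K = submoduleD[OF Ksub]
  have simple_K: "v \<in> K" if v: "v \<in> simple_vectors A M" for v
  proof -
    define N0 where "N0 = (\<lambda>a. a \<odot>\<^bsub>M\<^esub> v) ` carrier A"
    have vc: "v \<in> carrier M" "v \<noteq> \<zero>\<^bsub>M\<^esub>" using v by (auto simp: simple_vectors_def)
    have N0: "N0 \<in> \<N>" "v \<in> N0"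
      using simple_vector_cyclic_simple[OF v] cyclic_submodule[OF vc(1)]
      by (auto simp: \<N>_def N0_def)
    show ?thesis
    proof (cases "N0 \<inter> K \<subseteq> {\<zero>\<^bsub>M\<^esub>}")
      case True
      then have "insert N0 S \<in> \<A>"
        using independent_family_insert[OF Ssub _ S(2), of N0] S(1) N0(1)
        unfolding \<A>_def \<N>_def K_def by simp
      then have "insert N0 S = S" by (rule max[rule_format]) auto
      then have "N0 \<in> S" by blast
      moreover have "v = finsum M (\<lambda>_. v) {N0}" using vc by simp
      ultimately show ?thesis unfolding K_def family_sum_def using N0(2)
        by (intro CollectI exI[of _ "{N0}"] exI[of _ "\<lambda>_. v"]) auto
    next
      case False
      then obtain a where a: "a \<in> carrier A" "a \<odot>\<^bsub>M\<^esub> v \<in> K" "a \<odot>\<^bsub>M\<^esub> v \<noteq> \<zero>\<^bsub>M\<^esub>"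
        by (auto simp: N0_def)
      then obtain b where "b \<in> carrier A" "b \<odot>\<^bsub>M\<^esub> (a \<odot>\<^bsub>M\<^esub> v) = v"
        using v by (auto simp: simple_vectors_def)
      then show ?thesis using K(5)[OF _ a(2)] by force
    qed
  qed
  have "x \<in> K" if "x \<in> socle A M" for x
    using that by induct (auto intro: K(2,4) simple_K)
  then have "carrier M \<subseteq> family_sum M S" using soc unfolding K_def by blast
  then have "is_direct_sum M S"
    using independent_family_is_direct_sum[OF Ssub S(2)] by simp
  then show ?thesis
    unfolding semisimple_module_def using S(1) left_module_axioms
    by (intro conjI exI[of _ S]) (auto simp: \<N>_def)
qed

end

section \<open>Semisimple rings\<close>

abbreviation simple_elements :: "('a, 'm) ring_scheme \<Rightarrow> 'a set" where
  "simple_elements A \<equiv> simple_vectors A (regular_module A)"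

abbreviation ring_socle :: "('a, 'm) ring_scheme \<Rightarrow> 'a set" where
  "ring_socle A \<equiv> socle A (regular_module A)"

lemma regular_module_simps [simp]:
  "carrier (regular_module A) = carrier A" "add (regular_module A) = add A"
  "zero (regular_module A) = zero A" "smult (regular_module A) = mult A"
  by (simp_all add: regular_module_def)

lemma simple_elements_iff:
  "v \<in> simple_elements A \<longleftrightarrow>
     v \<in> carrier A \<and> v \<noteq> \<zero>\<^bsub>A\<^esub> \<and> (\<exists>a\<in>carrier A. a \<otimes>\<^bsub>A\<^esub> v = v) \<and>
     (\<forall>a\<in>carrier A. a \<otimes>\<^bsub>A\<^esub> v \<noteq> \<zero>\<^bsub>A\<^esub> \<longrightarrow> (\<exists>b\<in>carrier A. b \<otimes>\<^bsub>A\<^esub> (a \<otimes>\<^bsub>A\<^esub> v) = v))"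
  by (simp add: simple_vectors_def)

context nonunital_ring
begin

lemma regular_left_module: "left_module A (regular_module A)"
proof -
  have "abelian_group (regular_module A)"
    by (rule abelian_groupI) (auto simp: a_ac intro: exI[of _ "\<ominus> _"] l_neg)
  then show ?thesis
    by (simp add: left_module_def left_module_axioms_def nonunital_ring_axioms m_closed m_assoc
        l_distr r_distr)
qed

sublocale regular: left_module A "regular_module A" by (rule regular_left_module)

lemma socle_carrier: "x \<in> ring_socle A \<Longrightarrow> x \<in> carrier A"
  using regular.socle_subset by auto

lemma l_null: "x \<in> carrier A \<Longrightarrow> \<zero> \<otimes> x = \<zero>"
  using regular.smult_zero_left by simp

lemma r_null: "x \<in> carrier A \<Longrightarrow> x \<otimes> \<zero> = \<zero>"
  using regular.smult_zero_right by simp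

lemma l_minus:
  assumes "x \<in> carrier A" "y \<in> carrier A" shows "(\<ominus> x) \<otimes> y = \<ominus> (x \<otimes> y)"
  using l_distr[of "\<ominus> x" x y] assms
  by (intro minus_equality[symmetric]) (simp_all add: l_neg l_null m_closed)

lemma r_minus:
  assumes "x \<in> carrier A" "y \<in> carrier A" shows "x \<otimes> (\<ominus> y) = \<ominus> (x \<otimes> y)"
  using r_distr[of "\<ominus> y" y x] assms
  by (intro minus_equality[symmetric]) (simp_all add: l_neg r_null m_closed)

lemma simple_element_mult_left:
  assumes v: "v \<in> simple_elements A" and a: "a \<in> carrier A" "a \<otimes> v \<noteq> \<zero>"
  shows "a \<otimes> v \<in> simple_elements A"
  unfolding simple_elements_iff
proof (intro conjI ballI impI)
  have vc: "v \<in> carrier A"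
    and ret: "\<And>a. \<lbrakk>a \<in> carrier A; a \<otimes> v \<noteq> \<zero>\<rbrakk> \<Longrightarrow> \<exists>b\<in>carrier A. b \<otimes> (a \<otimes> v) = v"
    using v by (auto simp: simple_elements_iff)
  show "a \<otimes> v \<in> carrier A" using a vc by (simp add: m_closed)
  obtain b where b: "b \<in> carrier A" "b \<otimes> (a \<otimes> v) = v" using ret a by blast
  then have "(a \<otimes> b) \<otimes> (a \<otimes> v) = a \<otimes> v" using a vc by (simp add: m_assoc m_closed)
  then show "\<exists>c\<in>carrier A. c \<otimes> (a \<otimes> v) = a \<otimes> v" using a b m_closed by blast
  fix c assume c: "c \<in> carrier A" "c \<otimes> (a \<otimes> v) \<noteq> \<zero>"
  then obtain d where d: "d \<in> carrier A" "d \<otimes> (c \<otimes> a \<otimes> v) = v"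
    using ret[of "c \<otimes> a"] a vc by (auto simp: m_closed m_assoc)
  then have "(a \<otimes> d) \<otimes> (c \<otimes> (a \<otimes> v)) = a \<otimes> v" using a c vc by (simp add: m_closed m_assoc)
  then show "\<exists>b\<in>carrier A. b \<otimes> (c \<otimes> (a \<otimes> v)) = a \<otimes> v" using a d m_closed by blast
qed fact

text \<open>
  Right multiplication by \<open>a\<close> is a module endomorphism of the regular module, so it maps
  simple submodules to simple submodules or to zero.
\<close>

lemma simple_element_mult_right:
  assumes v: "v \<in> simple_elements A" and a: "a \<in> carrier A" "v \<otimes> a \<noteq> \<zero>"
  shows "v \<otimes> a \<in> simple_elements A"
  unfolding simple_elements_iff
proof (intro conjI ballI impI)
  have vc: "v \<in> carrier A"
    and ret: "\<And>a. \<lbrakk>a \<in> carrier A; a \<otimes> v \<noteq> \<zero>\<rbrakk> \<Longrightarrow> \<exists>b\<in>carrier A. b \<otimes> (a \<otimes> v) = v"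
    using v by (auto simp: simple_elements_iff)
  show "v \<otimes> a \<in> carrier A" using a vc by (simp add: m_closed)
  obtain c where "c \<in> carrier A" "c \<otimes> v = v" using v by (auto simp: simple_elements_iff)
  then show "\<exists>c\<in>carrier A. c \<otimes> (v \<otimes> a) = v \<otimes> a" using a vc m_assoc by metis
  fix c assume c: "c \<in> carrier A" "c \<otimes> (v \<otimes> a) \<noteq> \<zero>"
  then have "c \<otimes> v \<noteq> \<zero>" using a vc l_null by (metis m_assoc)
  then obtain d where d: "d \<in> carrier A" "d \<otimes> (c \<otimes> v) = v" using ret c by blast
  then have "d \<otimes> (c \<otimes> (v \<otimes> a)) = v \<otimes> a"
    using m_assoc[of d "c \<otimes> v" a] m_assoc[of c v a] a c vc by (simp add: m_closed)
  then show "\<exists>b\<in>carrier A. b \<otimes> (c \<otimes> (v \<otimes> a)) = v \<otimes> a" using d by blast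
qed fact

lemma zero_or_simple_in_socle:
  "v = \<zero> \<or> v \<in> simple_elements A \<Longrightarrow> v \<in> ring_socle A"
  using regular.simple_vector_in_socle socle.zero[of "regular_module A"] by auto

lemma socle_closed_mult_left:
  assumes "x \<in> ring_socle A" "a \<in> carrier A" shows "a \<otimes> x \<in> ring_socle A"
  using assms(1)
proof induct
  case zero then show ?case using assms(2) socle.zero[of "regular_module A"] by (simp add: r_null)
next
  case (add v x)
  have "v \<in> carrier A" "x \<in> carrier A"
    using add socle_carrier by (auto simp: simple_elements_iff)
  then have "a \<otimes> (v \<oplus> x) = a \<otimes> v \<oplus> a \<otimes> x" using assms(2) by (simp add: r_distr)
  moreover have "a \<otimes> v \<in> ring_socle A"
    using zero_or_simple_in_socle simple_element_mult_left[OF add(1) assms(2)] by blast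
  ultimately show ?case using regular.socle_closed_add[of "a \<otimes> v" "a \<otimes> x"] add by simp
qed

lemma socle_closed_mult_right:
  assumes "x \<in> ring_socle A" "a \<in> carrier A" shows "x \<otimes> a \<in> ring_socle A"
  using assms(1)
proof induct
  case zero then show ?case using assms(2) socle.zero[of "regular_module A"] by (simp add: l_null)
next
  case (add v x)
  have "v \<in> carrier A" "x \<in> carrier A"
    using add socle_carrier by (auto simp: simple_elements_iff)
  then have "(v \<oplus> x) \<otimes> a = v \<otimes> a \<oplus> x \<otimes> a" using assms(2) by (simp add: l_distr)
  moreover have "v \<otimes> a \<in> ring_socle A"
    using zero_or_simple_in_socle simple_element_mult_right[OF add(1) assms(2)] by blast
  ultimately show ?case using regular.socle_closed_add[of "v \<otimes> a" "x \<otimes> a"] add by simp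
qed

lemma corner_carrier_iff:
  assumes "e \<in> idempotents A"
  shows "a \<in> carrier (corner_ring A e) \<longleftrightarrow> a \<in> carrier A \<and> e \<otimes> a = a \<and> a \<otimes> e = a"
proof -
  have e: "e \<in> carrier A" "e \<otimes> e = e" using assms by (auto simp: idempotents_def)
  have "e \<otimes> (e \<otimes> b \<otimes> e) = e \<otimes> b \<otimes> e" "(e \<otimes> b \<otimes> e) \<otimes> e = e \<otimes> b \<otimes> e"
    if "b \<in> carrier A" for b
    using e that by (metis m_assoc m_closed)+
  then show ?thesis using e by (force simp: corner_ring_def m_closed)
qed

lemma corner_simps [simp]:
  "mult (corner_ring A e) = mult A" "add (corner_ring A e) = add A"
  "zero (corner_ring A e) = zero A"
  by (simp_all add: corner_ring_def)

lemma corner_nonunital_ring: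
  assumes "e \<in> idempotents A" shows "nonunital_ring (corner_ring A e)"
proof -
  note c = corner_carrier_iff[OF assms]
  have e: "e \<in> carrier A" using assms by (simp add: idempotents_def)
  have "abelian_group (corner_ring A e)"
  proof (rule abelian_groupI)
    fix x assume x: "x \<in> carrier (corner_ring A e)"
    have "\<ominus> x \<in> carrier (corner_ring A e)"
      using x e by (simp add: c l_minus r_minus)
    then show "\<exists>y\<in>carrier (corner_ring A e). y \<oplus>\<^bsub>corner_ring A e\<^esub> x = \<zero>\<^bsub>corner_ring A e\<^esub>"
      using x by (intro bexI[of _ "\<ominus> x"]) (simp_all add: c l_neg)
  qed (use e in \<open>auto simp: c a_ac r_distr l_distr l_null r_null\<close>)
  moreover have "e \<otimes> (a \<otimes> b) = a \<otimes> b \<and> (a \<otimes> b) \<otimes> e = a \<otimes> b"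
    if "a \<in> carrier (corner_ring A e)" "b \<in> carrier (corner_ring A e)" for a b
    using that e m_assoc[of e a b] m_assoc[of a b e] by (simp add: c)
  ultimately show ?thesis
    unfolding nonunital_ring_def nonunital_ring_axioms_def
    by (auto simp: c m_closed m_assoc l_distr r_distr)
qed

lemma corner_has_local_units:
  assumes "e \<in> idempotents A" shows "has_local_units (corner_ring A e)"
  unfolding has_local_units_def
  using assms corner_carrier_iff[OF assms]
  by (intro exI[of _ "{e}"]) (auto simp: idempotents_def subset_iff)

end

lemma semisimple_ring_iff_socle:
  "semisimple_ring A \<longleftrightarrow> nonunital_ring A \<and> has_local_units A \<and> carrier A \<subseteq> ring_socle A"
proof -
  have "semisimple_module A (regular_module A) \<longleftrightarrow> carrier A \<subseteq> ring_socle A" if "nonunital_ring A"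
    using left_module.socle_imp_semisimple_module[OF nonunital_ring.regular_left_module[OF that]]
      semisimple_module_imp_socle[of A "regular_module A"] by auto
  then show ?thesis unfolding semisimple_ring_def by blast
qed

text \<open>
  If \<open>w \<in> eAe\<close> is simple in \<open>A\<close> and \<open>b\<close> recovers \<open>w\<close> from
  \<open>aw\<close> with \<open>a \<in> eAe\<close>, then so does \<open>ebe\<close>. Writing an element of the
  corner as a sum of simple elements \<open>v\<close> of \<open>A\<close>, one replaces each \<open>v\<close> by
  \<open>eve\<close>.
\<close>

lemma semisimple_imp_locally_semisimple:
  assumes "semisimple_ring A" shows "locally_semisimple_ring A"
proof -
  interpret nonunital_ring A using assms by (simp add: semisimple_ring_iff_socle)
  have "carrier (corner_ring A e) \<subseteq> ring_socle (corner_ring A e)" if e: "e \<in> idempotents A" for e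
  proof
    note c = corner_carrier_iff[OF e]
    have ec: "e \<in> carrier A" "e \<otimes>\<^bsub>A\<^esub> e = e" using e by (simp_all add: idempotents_def)
    interpret C: nonunital_ring "corner_ring A e" using e by (rule corner_nonunital_ring)
    have cut: "e \<otimes>\<^bsub>A\<^esub> b \<otimes>\<^bsub>A\<^esub> e \<in> carrier (corner_ring A e)" if "b \<in> carrier A" for b
      using that by (auto simp: corner_ring_def)
    have simple: "w \<in> simple_elements (corner_ring A e)"
      if w: "w \<in> simple_elements A" "w \<in> carrier (corner_ring A e)" for w
    proof -
      have wc: "w \<in> carrier A" "e \<otimes>\<^bsub>A\<^esub> w = w" "w \<otimes>\<^bsub>A\<^esub> e = w" using w(2) by (auto simp: c)
      have "\<exists>b\<in>carrier (corner_ring A e). b \<otimes>\<^bsub>A\<^esub> (a \<otimes>\<^bsub>A\<^esub> w) = w"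
        if a: "a \<in> carrier (corner_ring A e)" "a \<otimes>\<^bsub>A\<^esub> w \<noteq> \<zero>\<^bsub>A\<^esub>" for a
      proof -
        have ac: "a \<in> carrier A" "e \<otimes>\<^bsub>A\<^esub> a = a" using a(1) by (auto simp: c)
        obtain b where b: "b \<in> carrier A" "b \<otimes>\<^bsub>A\<^esub> (a \<otimes>\<^bsub>A\<^esub> w) = w"
          using w(1) a ac by (auto simp: simple_elements_iff)
        have "e \<otimes>\<^bsub>A\<^esub> (a \<otimes>\<^bsub>A\<^esub> w) = a \<otimes>\<^bsub>A\<^esub> w" using ac wc ec by (metis m_assoc)
        then have "(e \<otimes>\<^bsub>A\<^esub> b \<otimes>\<^bsub>A\<^esub> e) \<otimes>\<^bsub>A\<^esub> (a \<otimes>\<^bsub>A\<^esub> w) = w"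
          using b ac wc ec by (simp add: m_assoc m_closed)
        then show ?thesis using cut[OF b(1)] by blast
      qed
      moreover have "e \<in> carrier (corner_ring A e)" using ec by (simp add: c)
      ultimately show ?thesis using w wc by (auto simp: simple_elements_iff)
    qed
    have "e \<otimes>\<^bsub>A\<^esub> x \<otimes>\<^bsub>A\<^esub> e \<in> ring_socle (corner_ring A e)" if "x \<in> ring_socle A" for x
      using that
    proof induct
      case zero
      show ?case using ec socle.zero[of "regular_module (corner_ring A e)"]
        by (simp add: l_null r_null)
    next
      case (add v x)
      have vx: "v \<in> carrier A" "x \<in> carrier A"
        using add socle_carrier by (auto simp: simple_elements_iff)
      then have eq: "e \<otimes>\<^bsub>A\<^esub> (v \<oplus>\<^bsub>A\<^esub> x) \<otimes>\<^bsub>A\<^esub> e = (e \<otimes>\<^bsub>A\<^esub> v \<otimes>\<^bsub>A\<^esub> e) \<oplus>\<^bsub>A\<^esub> (e \<otimes>\<^bsub>A\<^esub> x \<otimes>\<^bsub>A\<^esub> e)"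
        using ec by (simp add: l_distr r_distr m_closed)
      have "e \<otimes>\<^bsub>A\<^esub> v \<otimes>\<^bsub>A\<^esub> e = \<zero>\<^bsub>A\<^esub> \<or> e \<otimes>\<^bsub>A\<^esub> v \<otimes>\<^bsub>A\<^esub> e \<in> simple_elements A"
        using simple_element_mult_left[OF add(1) ec(1)] simple_element_mult_right[OF _ ec(1)]
          l_null[OF ec(1)] by metis
      then have "e \<otimes>\<^bsub>A\<^esub> v \<otimes>\<^bsub>A\<^esub> e \<in> ring_socle (corner_ring A e)"
        using simple cut[OF vx(1)] C.zero_or_simple_in_socle by auto
      then show ?case
        using C.regular.socle_closed_add add(3) eq by simp
    qed
    then show "x \<in> ring_socle (corner_ring A e)" if "x \<in> carrier (corner_ring A e)" for x
      using that assms c unfolding semisimple_ring_iff_socle by (metis subsetD)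
  qed
  then show ?thesis
    using assms corner_nonunital_ring corner_has_local_units
    unfolding locally_semisimple_ring_def semisimple_ring_iff_socle by blast
qed

text \<open>
  The assumption moves a nonzero \<open>av\<close> back into the corner, where \<open>v\<close> can be
  recovered.
\<close>

lemma (in nonunital_ring) simple_in_corner_imp_simple:
  assumes e: "e \<in> idempotents A" and v: "v \<in> simple_elements (corner_ring A e)"
    and faithful: "\<And>a. \<lbrakk>a \<in> carrier A; a \<otimes> v \<noteq> \<zero>\<rbrakk> \<Longrightarrow> \<exists>c\<in>carrier A. e \<otimes> c \<otimes> (a \<otimes> v) \<noteq> \<zero>"
  shows "v \<in> simple_elements A"
proof -
  note c = corner_carrier_iff[OF e]
  have ec: "e \<in> carrier A" using e by (simp add: idempotents_def)
  have vc: "v \<in> carrier A" "e \<otimes> v = v" "v \<noteq> \<zero>" using v by (auto simp: simple_elements_iff c)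
  have "\<exists>b\<in>carrier A. b \<otimes> (a \<otimes> v) = v" if a: "a \<in> carrier A" "a \<otimes> v \<noteq> \<zero>" for a
  proof -
    obtain d where d: "d \<in> carrier A" "e \<otimes> d \<otimes> (a \<otimes> v) \<noteq> \<zero>" using faithful a by blast
    define a' where "a' = e \<otimes> (d \<otimes> a) \<otimes> e"
    have a'v: "a' \<otimes> v = e \<otimes> d \<otimes> (a \<otimes> v)"
      unfolding a'_def using ec d(1) a(1) vc by (simp add: m_assoc m_closed)
    have "a' \<in> carrier (corner_ring A e)"
      unfolding a'_def corner_ring_def using d(1) a(1) m_closed by auto
    then have "\<exists>b\<in>carrier (corner_ring A e). b \<otimes> (a' \<otimes> v) = v"
      using v d(2) a'v by (metis simple_elements_iff corner_simps(1,3))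
    then obtain b where b: "b \<in> carrier A" "b \<otimes> (a' \<otimes> v) = v"
      using c by blast
    then have "(b \<otimes> (e \<otimes> d)) \<otimes> (a \<otimes> v) = v"
      using ec d(1) a(1) vc by (simp add: a'v m_assoc m_closed)
    then show ?thesis using b(1) ec d(1) m_closed by blast
  qed
  then show ?thesis using vc ec by (auto simp: simple_elements_iff)
qed

section \<open>Transport along isomorphisms\<close>

text \<open>
  The isomorphism is the first map followed by the inverse of the second, which preserves the
  operations because \<open>D\<close> is closed under them.
\<close>

lemma ring_isomorphic_common_target:
  assumes "ring_isomorphic A B" "ring_isomorphic D B" "nonunital_ring D"
  shows "ring_isomorphic A D"
proof -
  interpret D: nonunital_ring D by fact
  obtain \<phi> where \<phi>: "bij_betw \<phi> (carrier A) (carrier B)"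
    "\<And>a b. \<lbrakk>a \<in> carrier A; b \<in> carrier A\<rbrakk> \<Longrightarrow> \<phi> (a \<oplus>\<^bsub>A\<^esub> b) = \<phi> a \<oplus>\<^bsub>B\<^esub> \<phi> b \<and> \<phi> (a \<otimes>\<^bsub>A\<^esub> b) = \<phi> a \<otimes>\<^bsub>B\<^esub> \<phi> b"
    using assms(1) by (auto simp: ring_isomorphic_def ring_isos_def)
  obtain \<psi> where \<psi>: "bij_betw \<psi> (carrier D) (carrier B)"
    "\<And>a b. \<lbrakk>a \<in> carrier D; b \<in> carrier D\<rbrakk> \<Longrightarrow> \<psi> (a \<oplus>\<^bsub>D\<^esub> b) = \<psi> a \<oplus>\<^bsub>B\<^esub> \<psi> b \<and> \<psi> (a \<otimes>\<^bsub>D\<^esub> b) = \<psi> a \<otimes>\<^bsub>B\<^esub> \<psi> b"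
    using assms(2) by (auto simp: ring_isomorphic_def ring_isos_def)
  define \<theta> where "\<theta> = inv_into (carrier D) \<psi>"
  have \<theta>: "bij_betw \<theta> (carrier B) (carrier D)"
    unfolding \<theta>_def using \<psi>(1) by (rule bij_betw_inv_into)
  have \<theta>\<psi>: "\<theta> (\<psi> d) = d" if "d \<in> carrier D" for d
    unfolding \<theta>_def using that \<psi>(1) by (simp add: bij_betw_inv_into_left)
  have \<psi>\<theta>: "\<psi> (\<theta> b) = b" "\<theta> b \<in> carrier D" if "b \<in> carrier B" for b
    using that \<psi>(1) \<theta> by (auto simp: \<theta>_def bij_betw_inv_into_right bij_betw_apply)
  have B: "\<theta> (b \<oplus>\<^bsub>B\<^esub> c) = \<theta> b \<oplus>\<^bsub>D\<^esub> \<theta> c" "\<theta> (b \<otimes>\<^bsub>B\<^esub> c) = \<theta> b \<otimes>\<^bsub>D\<^esub> \<theta> c"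
    if "b \<in> carrier B" "c \<in> carrier B" for b c
    using \<psi>(2)[of "\<theta> b" "\<theta> c"] \<theta>\<psi>[of "\<theta> b \<oplus>\<^bsub>D\<^esub> \<theta> c"] \<theta>\<psi>[of "\<theta> b \<otimes>\<^bsub>D\<^esub> \<theta> c"] \<psi>\<theta> that
    by (simp_all add: D.m_closed)
  have "\<theta> \<circ> \<phi> \<in> ring_isos A D"
    unfolding ring_isos_def
    using bij_betw_trans[OF \<phi>(1) \<theta>] \<phi>(2) B \<phi>(1) by (simp add: bij_betw_apply)
  then show ?thesis by (auto simp: ring_isomorphic_def)
qed

lemma ring_isomorphic_sym:
  assumes "ring_isomorphic A B" "nonunital_ring A" shows "ring_isomorphic B A"
proof -
  have "id \<in> ring_isos B B" by (simp add: ring_isos_def)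
  then have "ring_isomorphic B B" by (auto simp: ring_isomorphic_def)
  then show ?thesis using ring_isomorphic_common_target assms by blast
qed

lemma semisimple_ring_isomorphic:
  assumes ss: "semisimple_ring A" and iso: "ring_isomorphic A B" and B: "nonunital_ring B"
  shows "semisimple_ring B"
proof -
  interpret A: nonunital_ring A using ss by (simp add: semisimple_ring_iff_socle)
  interpret B: nonunital_ring B by fact
  obtain \<phi> where bij: "bij_betw \<phi> (carrier A) (carrier B)"
    and hom: "\<And>a b. \<lbrakk>a \<in> carrier A; b \<in> carrier A\<rbrakk> \<Longrightarrow> \<phi> (a \<oplus>\<^bsub>A\<^esub> b) = \<phi> a \<oplus>\<^bsub>B\<^esub> \<phi> b"
      "\<And>a b. \<lbrakk>a \<in> carrier A; b \<in> carrier A\<rbrakk> \<Longrightarrow> \<phi> (a \<otimes>\<^bsub>A\<^esub> b) = \<phi> a \<otimes>\<^bsub>B\<^esub> \<phi> b"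
    using iso by (auto simp: ring_isomorphic_def ring_isos_def)
  have closed: "\<phi> a \<in> carrier B" if "a \<in> carrier A" for a using bij that by (rule bij_betw_apply)
  have inj: "\<phi> a = \<phi> b \<longleftrightarrow> a = b" if "a \<in> carrier A" "b \<in> carrier A" for a b
    using bij that by (auto simp: bij_betw_def inj_on_def)
  have surj: "\<exists>a\<in>carrier A. b = \<phi> a" if "b \<in> carrier B" for b
    using bij that by (auto simp: bij_betw_def)
  have map_zero: "\<phi> \<zero>\<^bsub>A\<^esub> = \<zero>\<^bsub>B\<^esub>"
    using hom(1)[of "\<zero>\<^bsub>A\<^esub>" "\<zero>\<^bsub>A\<^esub>"] closed[of "\<zero>\<^bsub>A\<^esub>"] by (simp add: B.add.l_cancel_one)
  have simple: "\<phi> v \<in> simple_elements B" if v: "v \<in> simple_elements A" for v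
    unfolding simple_elements_iff
  proof (intro conjI ballI impI)
    have vc: "v \<in> carrier A" "v \<noteq> \<zero>\<^bsub>A\<^esub>" using v by (auto simp: simple_elements_iff)
    show "\<phi> v \<in> carrier B" using vc closed by simp
    show "\<phi> v \<noteq> \<zero>\<^bsub>B\<^esub>" using vc inj[of v "\<zero>\<^bsub>A\<^esub>"] map_zero by simp
    obtain a where "a \<in> carrier A" "a \<otimes>\<^bsub>A\<^esub> v = v" using v by (auto simp: simple_elements_iff)
    then show "\<exists>b\<in>carrier B. b \<otimes>\<^bsub>B\<^esub> \<phi> v = \<phi> v" using closed hom(2) vc by metis
    fix b assume "b \<in> carrier B" and ne: "b \<otimes>\<^bsub>B\<^esub> \<phi> v \<noteq> \<zero>\<^bsub>B\<^esub>"
    then obtain a where a: "a \<in> carrier A" "b = \<phi> a" using surj by blast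
    then have "a \<otimes>\<^bsub>A\<^esub> v \<noteq> \<zero>\<^bsub>A\<^esub>" using ne vc hom(2) map_zero by metis
    then obtain d where d: "d \<in> carrier A" "d \<otimes>\<^bsub>A\<^esub> (a \<otimes>\<^bsub>A\<^esub> v) = v"
      using v a by (auto simp: simple_elements_iff)
    then have "\<phi> d \<otimes>\<^bsub>B\<^esub> (b \<otimes>\<^bsub>B\<^esub> \<phi> v) = \<phi> v"
      using hom(2)[of d "a \<otimes>\<^bsub>A\<^esub> v"] hom(2)[of a v] a vc by (simp add: A.m_closed)
    then show "\<exists>d\<in>carrier B. d \<otimes>\<^bsub>B\<^esub> (b \<otimes>\<^bsub>B\<^esub> \<phi> v) = \<phi> v" using closed d by blast
  qed
  have soc: "\<phi> x \<in> ring_socle B" if "x \<in> ring_socle A" for x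
    using that
  proof induct
    case zero then show ?case using socle.zero[of "regular_module B"] by (simp add: map_zero)
  next
    case (add v x)
    then have "v \<in> carrier A" "x \<in> carrier A"
      using A.socle_carrier by (auto simp: simple_elements_iff)
    then show ?case using socle.add[OF simple[OF add(1)] add(3)] hom(1) by simp
  qed
  have "has_local_units B"
  proof -
    have "has_local_units A" using ss by (simp add: semisimple_ring_iff_socle)
    then obtain E where E: "E \<subseteq> idempotents A"
      "\<forall>F. finite F \<and> F \<subseteq> carrier A \<longrightarrow> (\<exists>e\<in>E. \<forall>a\<in>F. e \<otimes>\<^bsub>A\<^esub> a = a \<and> a \<otimes>\<^bsub>A\<^esub> e = a)"
      unfolding has_local_units_def by (elim exE conjE)
    have "\<phi> ` E \<subseteq> idempotents B"
    proof (rule image_subsetI)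
      fix e assume "e \<in> E"
      then have "e \<in> carrier A" "e \<otimes>\<^bsub>A\<^esub> e = e" using E(1) by (auto simp: idempotents_def)
      then show "\<phi> e \<in> idempotents B" using closed hom(2)[of e e] by (simp add: idempotents_def)
    qed
    moreover have "\<exists>e\<in>\<phi> ` E. \<forall>b\<in>F. e \<otimes>\<^bsub>B\<^esub> b = b \<and> b \<otimes>\<^bsub>B\<^esub> e = b"
      if F: "finite F" "F \<subseteq> carrier B" for F
    proof -
      obtain F' where F': "finite F'" "F' \<subseteq> carrier A" "F = \<phi> ` F'"
        using F bij by (metis bij_betw_imp_surj_on finite_subset_image)
      then obtain e where e: "e \<in> E" "\<forall>a\<in>F'. e \<otimes>\<^bsub>A\<^esub> a = a \<and> a \<otimes>\<^bsub>A\<^esub> e = a" using E(2) by blast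
      have "e \<in> carrier A" using e(1) E(1) by (auto simp: idempotents_def)
      then have "\<forall>a\<in>F'. \<phi> e \<otimes>\<^bsub>B\<^esub> \<phi> a = \<phi> a \<and> \<phi> a \<otimes>\<^bsub>B\<^esub> \<phi> e = \<phi> a"
        using e(2) F'(2) by (auto simp: hom(2)[symmetric] subset_iff)
      then show ?thesis using e F' by auto
    qed
    ultimately show ?thesis
      unfolding has_local_units_def by (intro exI[of _ "\<phi> ` E"]) simp
  qed
  moreover have "carrier B \<subseteq> ring_socle B"
    using surj soc ss unfolding semisimple_ring_iff_socle by (metis subsetD subsetI)
  ultimately show ?thesis using B by (simp add: semisimple_ring_iff_socle)
qed

section \<open>Groupoids and convolution\<close>

context groupoid
begin

lemma ginv_gcomp_self: "gcomp G (ginv G g) g = dsrc G g"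
  by (simp add: dsrc_def)

lemma gcomp_ginv_self: "gcomp G g (ginv G g) = rng G g"
  by (simp add: rng_def)

lemma ginv_ginv:
  assumes g: "g \<in> arrows G" shows "ginv G (ginv G g) = g"
proof -
  let ?h = "ginv G g" and ?k = "ginv G (ginv G g)"
  note a = g ginv_closed[OF g] ginv_closed[OF ginv_closed[OF g]]
  have "g = gcomp G (rng G g) g" using g by (simp add: rng_gcomp_unit)
  also have "rng G g = gcomp G ?k ?h"
    using dsrc_ginv[OF g] by (simp add: ginv_gcomp_self)
  also have "gcomp G (gcomp G ?k ?h) g = gcomp G ?k (gcomp G ?h g)"
    using a by (intro gcomp_assoc) (simp_all add: dsrc_ginv rng_ginv)
  also have "gcomp G ?h g = dsrc G ?k"
    using a by (simp add: ginv_gcomp_self dsrc_ginv rng_ginv)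
  also have "gcomp G ?k (dsrc G ?k) = ?k" using a by (simp add: gcomp_dsrc)
  finally show ?thesis by simp
qed

lemma gcomp_ginv_cancel:
  assumes "g \<in> arrows G" "h \<in> arrows G" "dsrc G g = rng G h"
  shows "gcomp G (gcomp G g h) (ginv G h) = g"
  using assms gcomp_assoc[of g h "ginv G h"] gcomp_dsrc[of g]
  by (simp add: ginv_closed rng_ginv gcomp_ginv_self)

lemma gcomp_ginv_cancel':
  assumes "g \<in> arrows G" "h \<in> arrows G" "dsrc G g = dsrc G h"
  shows "gcomp G (gcomp G g (ginv G h)) h = g"
  using gcomp_ginv_cancel[of g "ginv G h"] assms by (simp add: ginv_closed rng_ginv ginv_ginv)

lemma ginv_gcomp_cancel:
  assumes "g \<in> arrows G" "h \<in> arrows G" "dsrc G g = rng G h"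
  shows "gcomp G (ginv G g) (gcomp G g h) = h"
  using assms gcomp_assoc[of "ginv G g" g h] rng_gcomp_unit[of h]
  by (simp add: ginv_closed dsrc_ginv ginv_gcomp_self)

lemma ginv_gcomp_cancel':
  assumes "g \<in> arrows G" "h \<in> arrows G" "rng G g = rng G h"
  shows "gcomp G g (gcomp G (ginv G g) h) = h"
  using ginv_gcomp_cancel[of "ginv G g" h] assms by (simp add: ginv_closed dsrc_ginv ginv_ginv)

lemma ginv_gcomp:
  assumes g: "g \<in> arrows G" and h: "h \<in> arrows G" and gh: "dsrc G g = rng G h"
  shows "ginv G (gcomp G g h) = gcomp G (ginv G h) (ginv G g)"
proof -
  let ?k = "gcomp G g h"
  have k: "?k \<in> arrows G" "dsrc G ?k = dsrc G h" "rng G ?k = rng G g"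
    using assms by (simp_all add: gcomp_closed dsrc_gcomp rng_gcomp)
  note c = ginv_closed dsrc_ginv rng_ginv dsrc_gcomp rng_gcomp gcomp_closed
  have "ginv G ?k = gcomp G (gcomp G (ginv G ?k) g) (ginv G g)"
    using g h gh k by (intro gcomp_ginv_cancel[symmetric]) (simp_all add: c)
  also have "gcomp G (ginv G ?k) g = gcomp G (gcomp G (gcomp G (ginv G ?k) g) h) (ginv G h)"
    using g h gh k by (intro gcomp_ginv_cancel[symmetric]) (simp_all add: c)
  also have "gcomp G (gcomp G (ginv G ?k) g) h = gcomp G (ginv G ?k) ?k"
    using g h gh k by (intro gcomp_assoc) (simp_all add: c)
  also have "\<dots> = dsrc G h" using k by (simp add: ginv_gcomp_self)
  also have "gcomp G (dsrc G h) (ginv G h) = ginv G h"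
    using h rng_gcomp_unit[of "ginv G h"] by (simp add: c)
  finally show ?thesis .
qed

lemma unit_arrow:
  assumes "y \<in> units G"
  shows "y \<in> arrows G" "dsrc G y = y" "rng G y = y" "ginv G y = y"
proof -
  show y: "y \<in> arrows G" "dsrc G y = y" "rng G y = y"
    using assms by (auto simp: units_def dsrc_closed dsrc_dsrc rng_dsrc)
  then show "ginv G y = y"
    using gcomp_dsrc[of "ginv G y"] by (simp add: ginv_closed dsrc_ginv ginv_gcomp_self)
qed

lemma dsrc_unit: "g \<in> arrows G \<Longrightarrow> dsrc G g \<in> units G"
  by (simp add: units_def)

lemma rng_unit: "g \<in> arrows G \<Longrightarrow> rng G g \<in> units G"
  by (metis dsrc_rng dsrc_unit rng_closed)

lemmas arrow_simps = ginv_closed dsrc_ginv rng_ginv dsrc_dsrc rng_dsrc dsrc_rng rng_rng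
  dsrc_closed rng_closed gcomp_closed dsrc_gcomp rng_gcomp gcomp_dsrc rng_gcomp_unit ginv_ginv

end

definition convolution ::
  "('g, 'm) top_groupoid_scheme \<Rightarrow> ('g \<Rightarrow> 'r::comm_ring_1) \<Rightarrow> ('g \<Rightarrow> 'r) \<Rightarrow> 'g \<Rightarrow> 'r" where
  "convolution G f1 f2 g =
     (if g \<in> arrows G
      then \<Sum>h\<in>{h \<in> arrows G. dsrc G h = dsrc G g \<and> f2 h \<noteq> 0}. f1 (gcomp G g (ginv G h)) * f2 h
      else 0)"

text \<open>
  On these functions the convolution sums are finite and convolution is associative and
  distributive. Characteristic functions of bisections are of this kind even if the bisection is
  infinite, so the groupoid algebra, the finitely supported functions and the group rings of the
  isotropy groups all inherit the ring axioms from here.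
\<close>

definition source_finite :: "('g, 'm) top_groupoid_scheme \<Rightarrow> ('g \<Rightarrow> 'r::comm_ring_1) set" where
  "source_finite G =
     {f. (\<forall>g. g \<notin> arrows G \<longrightarrow> f g = 0) \<and>
         (\<forall>y. finite {h \<in> arrows G. dsrc G h = y \<and> f h \<noteq> 0})}"

lemma source_finiteD:
  assumes "f \<in> source_finite G"
  shows "g \<notin> arrows G \<Longrightarrow> f g = 0" "finite {h \<in> arrows G. dsrc G h = y \<and> f h \<noteq> 0}"
  using assms by (auto simp: source_finite_def)

lemma source_finite_add:
  assumes "f1 \<in> source_finite G" "f2 \<in> source_finite G"
  shows "(\<lambda>g. f1 g + f2 g) \<in> source_finite G"
proof -
  have "finite {h \<in> arrows G. dsrc G h = y \<and> f1 h + f2 h \<noteq> 0}" for y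
    by (rule finite_subset[of _ "{h \<in> arrows G. dsrc G h = y \<and> f1 h \<noteq> 0} \<union>
          {h \<in> arrows G. dsrc G h = y \<and> f2 h \<noteq> 0}"]) (use assms in \<open>auto simp: source_finite_def\<close>)
  then show ?thesis using assms by (simp add: source_finite_def)
qed

context groupoid
begin

text \<open>
  The index set in the definition depends on the support of \<open>f2\<close>; for manipulations it can
  be replaced by any larger finite set of arrows with the same source.
\<close>

lemma convolution_eq_sum:
  assumes "g \<in> arrows G" "finite H" "H \<subseteq> {h \<in> arrows G. dsrc G h = dsrc G g}"
    and "{h \<in> arrows G. dsrc G h = dsrc G g \<and> f2 h \<noteq> 0} \<subseteq> H"
  shows "convolution G f1 f2 g = (\<Sum>h\<in>H. f1 (gcomp G g (ginv G h)) * f2 h)"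
  unfolding convolution_def using assms
  by (auto intro!: sum.mono_neutral_left)

lemma convolution_nonzeroE:
  assumes "convolution G f1 f2 g \<noteq> 0"
  obtains h where "g \<in> arrows G" "h \<in> arrows G" "dsrc G h = dsrc G g" "f2 h \<noteq> 0"
    "f1 (gcomp G g (ginv G h)) \<noteq> 0"
proof -
  have g: "g \<in> arrows G"
    and "(\<Sum>h\<in>{h \<in> arrows G. dsrc G h = dsrc G g \<and> f2 h \<noteq> 0}. f1 (gcomp G g (ginv G h)) * f2 h) \<noteq> 0"
    using assms by (auto simp: convolution_def split: if_splits)
  then obtain h where "h \<in> {h \<in> arrows G. dsrc G h = dsrc G g \<and> f2 h \<noteq> 0}"
    "f1 (gcomp G g (ginv G h)) * f2 h \<noteq> 0"
    using sum.not_neutral_contains_not_neutral by blast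
  then show ?thesis using that[OF g, of h] by (metis (mono_tags, lifting) mem_Collect_eq mult_zero_left)
qed

lemma convolution_outside: "g \<notin> arrows G \<Longrightarrow> convolution G f1 f2 g = 0"
  by (simp add: convolution_def)

text \<open>
  Both sides equal the sum over \<open>k\<close> in the support of \<open>f3\<close> and
  \<open>l = h k\<close> with \<open>h\<close> in the support of \<open>f2\<close>; the finite set
  \<open>L\<close> of these products serves as a common index set for all \<open>k\<close>, so that
  the sums can be interchanged.
\<close>

lemma convolution_assoc:
  assumes f1: "f1 \<in> source_finite G" and f2: "f2 \<in> source_finite G" and f3: "f3 \<in> source_finite G"
  shows "convolution G (convolution G f1 f2) f3 = convolution G f1 (convolution G f2 f3)"
proof
  fix g
  show "convolution G (convolution G f1 f2) f3 g = convolution G f1 (convolution G f2 f3) g"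
  proof (cases "g \<in> arrows G")
    case False then show ?thesis by (simp add: convolution_outside)
  next
    case g: True
    define K where "K = {k \<in> arrows G. dsrc G k = dsrc G g \<and> f3 k \<noteq> 0}"
    define H where "H k = {h \<in> arrows G. dsrc G h = rng G k \<and> f2 h \<noteq> 0}" for k
    define L where "L = (\<Union>k\<in>K. (\<lambda>h. gcomp G h k) ` H k)"
    have K: "k \<in> arrows G" "dsrc G k = dsrc G g" if "k \<in> K" for k using that by (auto simp: K_def)
    have fin: "finite K" "finite (H k)" "finite L" for k
      using source_finiteD(2)[OF f2] source_finiteD(2)[OF f3] by (auto simp: K_def H_def L_def)
    have L: "l \<in> arrows G" "dsrc G l = dsrc G g" if "l \<in> L" for l
      using that by (auto simp: L_def H_def K arrow_simps)
    have "convolution G (convolution G f1 f2) f3 g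
        = (\<Sum>k\<in>K. convolution G f1 f2 (gcomp G g (ginv G k)) * f3 k)"
      by (rule convolution_eq_sum) (use g fin in \<open>auto simp: K_def\<close>)
    also have "\<dots> = (\<Sum>k\<in>K. \<Sum>l\<in>L. f1 (gcomp G g (ginv G l)) * f2 (gcomp G l (ginv G k)) * f3 k)"
    proof (rule sum.cong[OF refl])
      fix k assume k: "k \<in> K"
      have "convolution G f1 f2 (gcomp G g (ginv G k))
          = (\<Sum>h\<in>H k. f1 (gcomp G (gcomp G g (ginv G k)) (ginv G h)) * f2 h)"
        by (rule convolution_eq_sum) (use g fin K[OF k] in \<open>auto simp: H_def arrow_simps\<close>)
      also have "\<dots> = (\<Sum>h\<in>H k. f1 (gcomp G g (ginv G (gcomp G h k))) * f2 (gcomp G (gcomp G h k) (ginv G k)))"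
      proof (rule sum.cong[OF refl])
        fix h assume "h \<in> H k"
        then have h: "h \<in> arrows G" "dsrc G h = rng G k" by (auto simp: H_def)
        have "gcomp G (gcomp G g (ginv G k)) (ginv G h) = gcomp G g (ginv G (gcomp G h k))"
          using g h K[OF k] by (simp add: ginv_gcomp gcomp_assoc arrow_simps)
        then show "f1 (gcomp G (gcomp G g (ginv G k)) (ginv G h)) * f2 h
            = f1 (gcomp G g (ginv G (gcomp G h k))) * f2 (gcomp G (gcomp G h k) (ginv G k))"
          by (simp only: gcomp_ginv_cancel[OF h(1) K(1)[OF k] h(2)])
      qed
      also have "\<dots> = (\<Sum>l\<in>(\<lambda>h. gcomp G h k) ` H k. f1 (gcomp G g (ginv G l)) * f2 (gcomp G l (ginv G k)))"
      proof (rule sum.reindex[symmetric, unfolded comp_def])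
        show "inj_on (\<lambda>h. gcomp G h k) (H k)"
          by (rule inj_on_inverseI[where g = "\<lambda>l. gcomp G l (ginv G k)"])
             (use K[OF k] in \<open>simp add: H_def gcomp_ginv_cancel\<close>)
      qed
      also have "\<dots> = (\<Sum>l\<in>L. f1 (gcomp G g (ginv G l)) * f2 (gcomp G l (ginv G k)))"
      proof (rule sum.mono_neutral_left)
        show "(\<lambda>h. gcomp G h k) ` H k \<subseteq> L" using k by (auto simp: L_def)
        show "\<forall>l\<in>L - (\<lambda>h. gcomp G h k) ` H k. f1 (gcomp G g (ginv G l)) * f2 (gcomp G l (ginv G k)) = 0"
        proof
          fix l assume l: "l \<in> L - (\<lambda>h. gcomp G h k) ` H k"
          then have "l = gcomp G (gcomp G l (ginv G k)) k"
            using L[of l] K[OF k] by (simp add: gcomp_ginv_cancel')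
          then have "gcomp G l (ginv G k) \<notin> H k" using l by blast
          then have "f2 (gcomp G l (ginv G k)) = 0"
            using l L[of l] K[OF k] by (simp add: H_def arrow_simps)
          then show "f1 (gcomp G g (ginv G l)) * f2 (gcomp G l (ginv G k)) = 0" by simp
        qed
      qed fact
      finally show "convolution G f1 f2 (gcomp G g (ginv G k)) * f3 k
          = (\<Sum>l\<in>L. f1 (gcomp G g (ginv G l)) * f2 (gcomp G l (ginv G k)) * f3 k)"
        by (simp add: sum_distrib_right)
    qed
    also have "\<dots> = (\<Sum>l\<in>L. f1 (gcomp G g (ginv G l)) * (\<Sum>k\<in>K. f2 (gcomp G l (ginv G k)) * f3 k))"
      by (subst sum.swap) (simp add: sum_distrib_left mult.assoc)
    also have "\<dots> = (\<Sum>l\<in>L. f1 (gcomp G g (ginv G l)) * convolution G f2 f3 l)"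
    proof (rule sum.cong[OF refl])
      fix l assume l: "l \<in> L"
      have "convolution G f2 f3 l = (\<Sum>k\<in>K. f2 (gcomp G l (ginv G k)) * f3 k)"
        by (rule convolution_eq_sum) (use L[OF l] fin in \<open>auto simp: K_def\<close>)
      then show "f1 (gcomp G g (ginv G l)) * (\<Sum>k\<in>K. f2 (gcomp G l (ginv G k)) * f3 k)
          = f1 (gcomp G g (ginv G l)) * convolution G f2 f3 l" by simp
    qed
    also have "\<dots> = convolution G f1 (convolution G f2 f3) g"
    proof (rule convolution_eq_sum[symmetric])
      show "{l \<in> arrows G. dsrc G l = dsrc G g \<and> convolution G f2 f3 l \<noteq> 0} \<subseteq> L"
      proof
        fix l assume "l \<in> {l \<in> arrows G. dsrc G l = dsrc G g \<and> convolution G f2 f3 l \<noteq> 0}"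
        then have l: "l \<in> arrows G" "dsrc G l = dsrc G g" "convolution G f2 f3 l \<noteq> 0" by auto
        obtain k where k: "k \<in> arrows G" "dsrc G k = dsrc G l" "f3 k \<noteq> 0"
          "f2 (gcomp G l (ginv G k)) \<noteq> 0" using convolution_nonzeroE[OF l(3)] by blast
        have "l = gcomp G (gcomp G l (ginv G k)) k"
          using gcomp_ginv_cancel'[of l k] l k by simp
        then show "l \<in> L" unfolding L_def using l k
          by (intro UN_I[of k] image_eqI[of _ _ "gcomp G l (ginv G k)"])
             (simp_all add: arrow_simps H_def K_def)
      qed
    qed (use g L fin in auto)
    finally show ?thesis .
  qed
qed

lemma convolution_add_left:
  "convolution G (\<lambda>g. f1 g + f2 g) f = (\<lambda>g. convolution G f1 f g + convolution G f2 f g)"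
  by (rule ext) (simp add: convolution_def distrib_right sum.distrib)

lemma convolution_add_right:
  assumes "f1 \<in> source_finite G" "f2 \<in> source_finite G"
  shows "convolution G f (\<lambda>g. f1 g + f2 g) = (\<lambda>g. convolution G f f1 g + convolution G f f2 g)"
proof
  fix g
  show "convolution G f (\<lambda>g. f1 g + f2 g) g = convolution G f f1 g + convolution G f f2 g"
  proof (cases "g \<in> arrows G")
    case g: True
    define H where "H = {h \<in> arrows G. dsrc G h = dsrc G g \<and> f1 h \<noteq> 0} \<union>
      {h \<in> arrows G. dsrc G h = dsrc G g \<and> f2 h \<noteq> 0}"
    have "finite H" using assms by (simp add: H_def source_finite_def)
    then have "convolution G f f' g = (\<Sum>h\<in>H. f (gcomp G g (ginv G h)) * f' h)"
      if "f' \<in> {f1, f2, \<lambda>g. f1 g + f2 g}" for f'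
      using g that by (intro convolution_eq_sum) (auto simp: H_def)
    then show ?thesis by (simp add: distrib_left sum.distrib)
  qed (simp add: convolution_outside)
qed

lemma convolution_subring:
  fixes A :: "('g \<Rightarrow> 'r::comm_ring_1, 'n) ring_scheme"
  assumes sub: "carrier A \<subseteq> source_finite G"
    and zero: "zero A = (\<lambda>g. 0)" "(\<lambda>g. 0) \<in> carrier A"
    and add: "add A = (\<lambda>f1 f2 g. f1 g + f2 g)"
    and closed_add: "\<And>f1 f2. \<lbrakk>f1 \<in> carrier A; f2 \<in> carrier A\<rbrakk> \<Longrightarrow> (\<lambda>g. f1 g + f2 g) \<in> carrier A"
    and closed_minus: "\<And>f. f \<in> carrier A \<Longrightarrow> (\<lambda>g. - f g) \<in> carrier A"
    and mult: "\<And>f1 f2. \<lbrakk>f1 \<in> carrier A; f2 \<in> carrier A\<rbrakk> \<Longrightarrow> mult A f1 f2 = convolution G f1 f2"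
    and closed_mult: "\<And>f1 f2. \<lbrakk>f1 \<in> carrier A; f2 \<in> carrier A\<rbrakk> \<Longrightarrow> convolution G f1 f2 \<in> carrier A"
  shows "nonunital_ring A"
proof -
  have "abelian_group A"
  proof (rule abelian_groupI)
    fix f assume f: "f \<in> carrier A"
    show "\<exists>f'\<in>carrier A. f' \<oplus>\<^bsub>A\<^esub> f = \<zero>\<^bsub>A\<^esub>"
      by (rule bexI[OF _ closed_minus[OF f]]) (simp add: add zero)
  qed (simp_all add: add zero closed_add add_ac)
  moreover have "f \<in> source_finite G" if "f \<in> carrier A" for f using that sub by blast
  ultimately show ?thesis
    unfolding nonunital_ring_def nonunital_ring_axioms_def
    by (simp add: mult add closed_mult closed_add convolution_assoc convolution_add_left
        convolution_add_right)
qed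

text \<open>
  In the convolution sum at \<open>g\<close>, the arrow \<open>g h\<^sup>-\<^sup>1\<close> is a unit only
  for \<open>h = g\<close>.
\<close>

lemma convolution_indicator_left:
  assumes V: "V \<subseteq> units G" and f: "f \<in> source_finite G"
  shows "convolution G (indicator V) f = (\<lambda>g. if rng G g \<in> V then f g else 0)"
proof
  fix g
  show "convolution G (indicator V) f g = (if rng G g \<in> V then f g else 0)"
  proof (cases "g \<in> arrows G")
    case g: True
    define H where "H = insert g {h \<in> arrows G. dsrc G h = dsrc G g \<and> f h \<noteq> 0}"
    have fin: "finite H" using source_finiteD(2)[OF f] by (simp add: H_def)
    have "convolution G (indicator V) f g = (\<Sum>h\<in>H. indicator V (gcomp G g (ginv G h)) * f h)"
      by (rule convolution_eq_sum) (use g fin in \<open>auto simp: H_def\<close>)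
    also have "\<dots> = (\<Sum>h\<in>H. if h = g then (if rng G g \<in> V then f g else 0) else 0)"
    proof (rule sum.cong[OF refl])
      fix h assume "h \<in> H"
      then have h: "h \<in> arrows G" "dsrc G h = dsrc G g" using g by (auto simp: H_def)
      have "h = g" if "gcomp G g (ginv G h) \<in> V"
      proof -
        have u: "gcomp G g (ginv G h) \<in> units G" using that V by blast
        have "gcomp G g (ginv G h) = rng G h"
          using unit_arrow(2)[OF u] g h by (simp add: arrow_simps)
        then show ?thesis using gcomp_ginv_cancel'[of g h] rng_gcomp_unit[of h] g h by simp
      qed
      then show "indicator V (gcomp G g (ginv G h)) * f h
          = (if h = g then (if rng G g \<in> V then f g else 0) else 0)"
        by (auto simp: indicator_def gcomp_ginv_self)
    qed
    also have "\<dots> = (if rng G g \<in> V then f g else 0)" using fin by (simp add: H_def)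
    finally show ?thesis .
  qed (simp add: convolution_outside source_finiteD(1)[OF f])
qed

lemma convolution_indicator_right:
  assumes V: "V \<subseteq> units G" and f: "f \<in> source_finite G"
  shows "convolution G f (indicator V) = (\<lambda>g. if dsrc G g \<in> V then f g else 0)"
proof
  fix g
  show "convolution G f (indicator V) g = (if dsrc G g \<in> V then f g else 0)"
  proof (cases "g \<in> arrows G")
    case g: True
    have "convolution G f (indicator V) g = (\<Sum>h\<in>{dsrc G g}. f (gcomp G g (ginv G h)) * indicator V h)"
      by (rule convolution_eq_sum)
         (use g V in \<open>auto simp: arrow_simps indicator_def unit_arrow subset_iff split: if_splits\<close>)
    then show ?thesis using g by (simp add: unit_arrow(4)[OF dsrc_unit] arrow_simps)
  qed (simp add: convolution_outside source_finiteD(1)[OF f])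
qed

lemma convolution_point_left:
  assumes g: "g \<in> arrows G" and f: "f \<in> source_finite G"
  shows "convolution G (indicator {g}) f
    = (\<lambda>k. if k \<in> arrows G \<and> rng G k = rng G g then f (gcomp G (ginv G g) k) else 0)"
proof
  fix k
  show "convolution G (indicator {g}) f k
      = (if k \<in> arrows G \<and> rng G k = rng G g then f (gcomp G (ginv G g) k) else 0)"
  proof (cases "k \<in> arrows G")
    case k: True
    define H where "H = {h \<in> arrows G. dsrc G h = dsrc G k \<and> f h \<noteq> 0}"
    have fin: "finite H" using source_finiteD(2)[OF f] by (simp add: H_def)
    have "convolution G (indicator {g}) f k = (\<Sum>h\<in>H. indicator {g} (gcomp G k (ginv G h)) * f h)"
      by (rule convolution_eq_sum) (use k fin in \<open>auto simp: H_def\<close>)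
    also have "\<dots> = (\<Sum>h\<in>H. if h = gcomp G (ginv G g) k then (if rng G k = rng G g then f h else 0) else 0)"
    proof (rule sum.cong[OF refl])
      fix h assume "h \<in> H"
      then have h: "h \<in> arrows G" "dsrc G h = dsrc G k" by (auto simp: H_def)
      have "gcomp G k (ginv G h) = g \<longleftrightarrow> h = gcomp G (ginv G g) k \<and> rng G k = rng G g"
      proof
        assume eq: "gcomp G k (ginv G h) = g"
        then have "k = gcomp G g h" using gcomp_ginv_cancel'[of k h] k h by simp
        moreover have "dsrc G g = rng G h" "rng G g = rng G k"
          using eq k h by (auto simp: arrow_simps)
        ultimately show "h = gcomp G (ginv G g) k \<and> rng G k = rng G g"
          using ginv_gcomp_cancel[of g h] g h by simp
      next
        assume "h = gcomp G (ginv G g) k \<and> rng G k = rng G g"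
        then show "gcomp G k (ginv G h) = g"
          using g k ginv_gcomp_cancel'[of k "g"]
          by (simp add: ginv_gcomp arrow_simps)
      qed
      then show "indicator {g} (gcomp G k (ginv G h)) * f h
          = (if h = gcomp G (ginv G g) k then (if rng G k = rng G g then f h else 0) else 0)"
        by (simp add: indicator_def)
    qed
    also have "\<dots> = (if rng G k = rng G g then f (gcomp G (ginv G g) k) else 0)"
      using fin k g by (auto simp: H_def arrow_simps)
    finally show ?thesis using k by simp
  qed (simp add: convolution_outside)
qed

end

section \<open>The convolution algebra of finitely supported functions\<close>

lemma groupoid_algebra_simps [simp]:
  "mult (groupoid_algebra R G) = convolution G"
  "add (groupoid_algebra R G) = (\<lambda>f1 f2 g. f1 g + f2 g)"
  "zero (groupoid_algebra R G) = (\<lambda>g. 0)"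
  "smult (groupoid_algebra R G) = (\<lambda>r f g. r * f g)"
  by (simp_all add: groupoid_algebra_def convolution_def fun_eq_iff)

text \<open>
  For any topology on \<open>G\<close>, this is the algebra of the groupoid \<open>G\<close> with the
  discrete topology.
\<close>

definition finite_support_algebra ::
  "'r::comm_ring_1 itself \<Rightarrow> ('g, 'm) top_groupoid_scheme \<Rightarrow> ('r, 'g \<Rightarrow> 'r) module" where
  "finite_support_algebra R G =
     (groupoid_algebra R G)\<lparr>carrier := {f. finite {g. f g \<noteq> 0} \<and> {g. f g \<noteq> 0} \<subseteq> arrows G}\<rparr>"

lemma finite_support_algebra_simps [simp]:
  "mult (finite_support_algebra R G) = convolution G"
  "add (finite_support_algebra R G) = (\<lambda>f1 f2 g. f1 g + f2 g)"
  "zero (finite_support_algebra R G) = (\<lambda>g. 0)"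
  "smult (finite_support_algebra R G) = (\<lambda>r f g. r * f g)"
  by (simp_all add: finite_support_algebra_def)

lemma finite_support_carrier:
  "f \<in> carrier (finite_support_algebra R G) \<longleftrightarrow> finite {g. f g \<noteq> 0} \<and> {g. f g \<noteq> 0} \<subseteq> arrows G"
  by (simp add: finite_support_algebra_def)

lemma finite_support_source_finite:
  "f \<in> carrier (finite_support_algebra R G) \<Longrightarrow> f \<in> source_finite G"
  by (auto simp: finite_support_carrier source_finite_def intro: finite_subset[rotated])

lemma indicator_finite_support:
  assumes "finite V" "V \<subseteq> arrows G"
  shows "indicator V \<in> carrier (finite_support_algebra (R :: 'r::comm_ring_1 itself) G)"
proof -
  have "{g. indicator V g \<noteq> (0 :: 'r)} = V" by (auto simp: indicator_def)
  then show ?thesis using assms by (simp add: finite_support_carrier)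
qed

lemma finite_support_add:
  fixes f1 f2 :: "'g \<Rightarrow> 'r::comm_ring_1"
  assumes "finite {g. f1 g \<noteq> 0}" "finite {g. f2 g \<noteq> 0}"
  shows "finite {g. f1 g + f2 g \<noteq> 0}"
  by (rule finite_subset[of _ "{g. f1 g \<noteq> 0} \<union> {g. f2 g \<noteq> 0}"]) (use assms in auto)

context groupoid
begin

lemma finite_support_convolution:
  assumes "f1 \<in> carrier (finite_support_algebra R G)" "f2 \<in> carrier (finite_support_algebra R G)"
  shows "convolution G f1 f2 \<in> carrier (finite_support_algebra R G)"
proof -
  have "{g. convolution G f1 f2 g \<noteq> 0} \<subseteq>
      (\<lambda>(k, h). gcomp G k h) ` ({g. f1 g \<noteq> 0} \<times> {g. f2 g \<noteq> 0})"
  proof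
    fix g assume "g \<in> {g. convolution G f1 f2 g \<noteq> 0}"
    then have ne: "convolution G f1 f2 g \<noteq> 0" by simp
    obtain h where h: "g \<in> arrows G" "h \<in> arrows G" "dsrc G h = dsrc G g" "f2 h \<noteq> 0"
      "f1 (gcomp G g (ginv G h)) \<noteq> 0" using convolution_nonzeroE[OF ne] by blast
    then show "g \<in> (\<lambda>(k, h). gcomp G k h) ` ({g. f1 g \<noteq> 0} \<times> {g. f2 g \<noteq> 0})"
      using gcomp_ginv_cancel'[of g h] by (intro image_eqI[of _ _ "(gcomp G g (ginv G h), h)"]) simp_all
  qed
  then have "finite {g. convolution G f1 f2 g \<noteq> 0}"
    using assms by (auto simp: finite_support_carrier intro: finite_subset)
  moreover have "{g. convolution G f1 f2 g \<noteq> 0} \<subseteq> arrows G"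
    by (auto simp: convolution_def split: if_splits)
  ultimately show ?thesis by (simp add: finite_support_carrier)
qed

lemma finite_support_nonunital_ring: "nonunital_ring (finite_support_algebra R G)"
proof (rule convolution_subring)
  show "carrier (finite_support_algebra R G) \<subseteq> source_finite G"
    using finite_support_source_finite by blast
  fix f1 f2
  assume f: "f1 \<in> carrier (finite_support_algebra R G)" "f2 \<in> carrier (finite_support_algebra R G)"
  then show "convolution G f1 f2 \<in> carrier (finite_support_algebra R G)"
    by (rule finite_support_convolution)
  have "finite {g. f1 g + f2 g \<noteq> 0}"
    using f by (intro finite_support_add) (simp_all add: finite_support_carrier)
  moreover have "g \<in> arrows G" if "f1 g + f2 g \<noteq> 0" for g
  proof -
    have "f1 g \<noteq> 0 \<or> f2 g \<noteq> 0" using that by auto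
    then show ?thesis using f by (auto simp: finite_support_carrier)
  qed
  ultimately show "(\<lambda>g. f1 g + f2 g) \<in> carrier (finite_support_algebra R G)"
    by (auto simp: finite_support_carrier)
qed (simp_all add: finite_support_carrier)

lemma finite_support_has_local_units:
  fixes R :: "'r::comm_ring_1 itself"
  shows "has_local_units (finite_support_algebra R G)"
proof -
  let ?D = "finite_support_algebra R G"
  define E :: "('g \<Rightarrow> 'r) set" where "E = indicator ` {V. finite V \<and> V \<subseteq> units G}"
  have ind: "indicator V \<in> carrier ?D" if "finite V" "V \<subseteq> units G" for V
    using that unit_arrow(1) by (intro indicator_finite_support) auto
  have "E \<subseteq> idempotents ?D"
  proof
    fix e assume "e \<in> E"
    then obtain V where V: "finite V" "V \<subseteq> units G" "e = indicator V" by (auto simp: E_def)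
    have "e \<in> carrier ?D" using ind V by simp
    moreover have "convolution G (indicator V) (indicator V) = (indicator V :: 'g \<Rightarrow> 'r)"
      using convolution_indicator_left[OF V(2) finite_support_source_finite[OF ind[OF V(1,2)]]] V
      by (auto simp: fun_eq_iff indicator_def unit_arrow(3) subset_iff)
    then have "convolution G e e = e" by (simp add: V(3))
    ultimately show "e \<in> idempotents ?D" by (simp add: idempotents_def)
  qed
  moreover have "\<exists>e\<in>E. \<forall>f\<in>F. e \<otimes>\<^bsub>?D\<^esub> f = f \<and> f \<otimes>\<^bsub>?D\<^esub> e = f"
    if F: "finite F \<and> F \<subseteq> carrier ?D" for F
  proof -
    define S where "S = (\<Union>f\<in>F. {g. f g \<noteq> 0})"
    have S: "finite S" "S \<subseteq> arrows G" using F by (auto simp: S_def finite_support_carrier subset_iff)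
    define V where "V = dsrc G ` S \<union> rng G ` S"
    have V: "finite V" "V \<subseteq> units G"
      using S by (auto simp: V_def subset_iff dsrc_unit rng_unit)
    have "convolution G (indicator V) f = f \<and> convolution G f (indicator V) = f" if f: "f \<in> F" for f
    proof -
      have "f \<in> source_finite G" using F f by (intro finite_support_source_finite) auto
      moreover have "f g = 0 \<or> dsrc G g \<in> V \<and> rng G g \<in> V" for g
        using f by (auto simp: V_def S_def)
      ultimately show ?thesis
        using convolution_indicator_left[OF V(2), of f] convolution_indicator_right[OF V(2), of f]
        by (simp add: fun_eq_iff) metis
    qed
    then show ?thesis using V by (auto simp: E_def)
  qed
  ultimately show ?thesis unfolding has_local_units_def by (intro exI[of _ E]) simp
qed

section \<open>Group rings of the isotropy groups as corners\<close>

lemma isotropy_group_simps [simp]: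
  "carrier (isotropy_group G y) = {g \<in> arrows G. dsrc G g = y \<and> rng G g = y}"
  "mult (isotropy_group G y) = gcomp G" "one (isotropy_group G y) = y"
  by (simp_all add: isotropy_group_def)

lemma isotropy_group_is_group:
  assumes "y \<in> units G" shows "Group.group (isotropy_group G y)"
proof (rule groupI)
  fix g assume g: "g \<in> carrier (isotropy_group G y)"
  then show "\<exists>h\<in>carrier (isotropy_group G y). h \<otimes>\<^bsub>isotropy_group G y\<^esub> g = \<one>\<^bsub>isotropy_group G y\<^esub>"
    by (intro bexI[of _ "ginv G g"]) (auto simp: ginv_gcomp_self arrow_simps)
  show "\<one>\<^bsub>isotropy_group G y\<^esub> \<otimes>\<^bsub>isotropy_group G y\<^esub> g = g"
    using g rng_gcomp_unit[of g] by auto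
qed (use assms in \<open>auto simp: arrow_simps unit_arrow gcomp_assoc\<close>)

lemma isotropy_group_inv:
  assumes "y \<in> units G" "g \<in> carrier (isotropy_group G y)"
  shows "inv\<^bsub>isotropy_group G y\<^esub> g = ginv G g"
  using assms
  by (intro group.inv_equality[OF isotropy_group_is_group]) (auto simp: ginv_gcomp_self arrow_simps)

lemma group_algebra_simps [simp]:
  "add (group_algebra R H) = (\<lambda>f1 f2 g. f1 g + f2 g)"
  "zero (group_algebra R H) = (\<lambda>g. 0)"
  "smult (group_algebra R H) = (\<lambda>r f g. r * f g)"
  "carrier (group_algebra R H) = {f. finite {h. f h \<noteq> 0} \<and> {h. f h \<noteq> 0} \<subseteq> carrier H}"
  by (simp_all add: group_algebra_def)

lemma unit_idempotent:
  fixes R :: "'r::comm_ring_1 itself"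
  assumes "y \<in> units G"
  shows "indicator {y} \<in> idempotents (finite_support_algebra R G)"
proof -
  have c: "indicator {y} \<in> carrier (finite_support_algebra R G)"
    using assms unit_arrow(1) by (intro indicator_finite_support) auto
  have "convolution G (indicator {y}) (indicator {y}) = (indicator {y} :: 'g \<Rightarrow> 'r)"
    using convolution_indicator_left[OF _ finite_support_source_finite[OF c], of "{y}"]
      assms unit_arrow(3) by (auto simp: fun_eq_iff indicator_def)
  then show ?thesis using c by (simp add: idempotents_def)
qed

lemma group_algebra_carrier_corner:
  assumes y: "y \<in> units G"
  shows "carrier (group_algebra R (isotropy_group G y))
    = carrier (corner_ring (finite_support_algebra R G) (indicator {y}))"
proof -
  interpret D: nonunital_ring "finite_support_algebra R G" by (rule finite_support_nonunital_ring)
  have "f \<in> carrier (group_algebra R (isotropy_group G y)) \<longleftrightarrow>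
      f \<in> carrier (finite_support_algebra R G) \<and> convolution G (indicator {y}) f = f \<and>
      convolution G f (indicator {y}) = f" for f
  proof (cases "f \<in> carrier (finite_support_algebra R G)")
    case True
    then have "f \<in> source_finite G" by (rule finite_support_source_finite)
    with y have "convolution G (indicator {y}) f = f \<and> convolution G f (indicator {y}) = f \<longleftrightarrow>
        (\<forall>g. f g \<noteq> 0 \<longrightarrow> rng G g = y \<and> dsrc G g = y)"
      by (subst convolution_indicator_left convolution_indicator_right; simp)+ (auto simp: fun_eq_iff)
    then show ?thesis using True by (auto simp: finite_support_carrier)
  next
    case False then show ?thesis by (auto simp: finite_support_carrier)
  qed
  then show ?thesis
    using D.corner_carrier_iff[OF unit_idempotent[OF y]] by (auto simp del: group_algebra_simps)
qed

text \<open>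
  The product of the group algebra is set to zero outside the isotropy group; the convolution of
  two functions supported on this group vanishes there as well.
\<close>

lemma group_algebra_mult:
  assumes y: "y \<in> units G" and f1: "f1 \<in> carrier (group_algebra R (isotropy_group G y))"
    and f2: "f2 \<in> carrier (group_algebra R (isotropy_group G y))"
  shows "mult (group_algebra R (isotropy_group G y)) f1 f2 = convolution G f1 f2"
proof
  fix g
  let ?H = "isotropy_group G y"
  have supp: "dsrc G h = y \<and> rng G h = y \<and> h \<in> arrows G" if "f1 h \<noteq> 0 \<or> f2 h \<noteq> 0" for h
    using f1 f2 that by auto
  show "mult (group_algebra R ?H) f1 f2 g = convolution G f1 f2 g"
  proof (cases "g \<in> carrier ?H")
    case True
    have "{h \<in> carrier ?H. f2 h \<noteq> 0} = {h \<in> arrows G. dsrc G h = dsrc G g \<and> f2 h \<noteq> 0}"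
      using True supp by auto
    moreover have "inv\<^bsub>?H\<^esub> h = ginv G h" if "h \<in> carrier ?H" for h
      using isotropy_group_inv[OF y that] .
    ultimately show ?thesis
      using True supp unfolding group_algebra_def convolution_def
      by (auto intro!: sum.cong)
  next
    case False
    have "convolution G f1 f2 g = 0"
    proof (rule ccontr)
      assume ne: "convolution G f1 f2 g \<noteq> 0"
      obtain h where "g \<in> arrows G" "h \<in> arrows G" "dsrc G h = dsrc G g" "f2 h \<noteq> 0"
        "f1 (gcomp G g (ginv G h)) \<noteq> 0" using convolution_nonzeroE[OF ne] by blast
      then show False
        using False supp[of h] supp[of "gcomp G g (ginv G h)"] by (auto simp: arrow_simps)
    qed
    then show ?thesis using False by (auto simp: group_algebra_def)
  qed
qed

lemma group_algebra_iso_corner: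
  assumes "y \<in> units G"
  shows "ring_isomorphic (group_algebra R (isotropy_group G y))
    (corner_ring (finite_support_algebra R G) (indicator {y}))"
proof -
  interpret D: nonunital_ring "finite_support_algebra R G" by (rule finite_support_nonunital_ring)
  have "id \<in> ring_isos (group_algebra R (isotropy_group G y))
    (corner_ring (finite_support_algebra R G) (indicator {y}))"
    unfolding ring_isos_def
    using group_algebra_carrier_corner[OF assms, of R] group_algebra_mult[OF assms, of _ R]
    by (simp add: D.corner_simps del: group_algebra_simps(4))
  then show ?thesis by (auto simp: ring_isomorphic_def)
qed

lemma group_algebra_nonunital_ring:
  assumes y: "y \<in> units G"
  shows "nonunital_ring (group_algebra R (isotropy_group G y))"
proof -
  let ?A = "group_algebra R (isotropy_group G y)"
  interpret C: nonunital_ring "corner_ring (finite_support_algebra R G) (indicator {y})"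
    using finite_support_nonunital_ring unit_idempotent[OF y]
    by (rule nonunital_ring.corner_nonunital_ring)
  note carrier = group_algebra_carrier_corner[OF y, of R]
  show ?thesis
  proof (rule convolution_subring)
    show "carrier ?A \<subseteq> source_finite G"
      using finite_support_source_finite[of _ R G] by (fastforce simp: finite_support_carrier)
  next
    fix f1 f2 assume f: "f1 \<in> carrier ?A" "f2 \<in> carrier ?A"
    then show "mult ?A f1 f2 = convolution G f1 f2" by (rule group_algebra_mult[OF y])
    show "convolution G f1 f2 \<in> carrier ?A"
      using C.m_closed[of f1 f2] f unfolding carrier by (simp add: corner_ring_def)
    show "(\<lambda>g. f1 g + f2 g) \<in> carrier ?A"
      using C.add.m_closed[of f1 f2] f unfolding carrier by (simp add: corner_ring_def)
  qed auto
qed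

lemma semisimple_group_algebra_iff_corner:
  assumes y: "y \<in> units G"
  shows "semisimple_ring (group_algebra R (isotropy_group G y)) \<longleftrightarrow>
    semisimple_ring (corner_ring (finite_support_algebra R G) (indicator {y}))"
  using group_algebra_iso_corner[OF y, of R] group_algebra_nonunital_ring[OF y, of R]
    nonunital_ring.corner_nonunital_ring[OF finite_support_nonunital_ring unit_idempotent[OF y], of R]
    semisimple_ring_isomorphic ring_isomorphic_sym
  by metis

section \<open>Semisimplicity for discrete groupoids\<close>

text \<open>
  The point mass of \<open>x\<close> is the unit of the corner, hence a sum of simple elements
  \<open>v\<close> of the corner. These are simple in the whole algebra: if \<open>a * v\<close> is nonzero at
  \<open>g\<close>, then \<open>g\<close> has source \<open>x\<close>, and translation by the inverse of
  \<open>g\<close> makes it nonzero at \<open>x\<close>.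
\<close>

lemma unit_in_socle:
  fixes R :: "'r::comm_ring_1 itself"
  assumes x: "x \<in> units G" and ss: "semisimple_ring (group_algebra R (isotropy_group G x))"
  shows "indicator {x} \<in> ring_socle (finite_support_algebra R G)"
proof -
  let ?D = "finite_support_algebra R G" and ?e = "indicator {x} :: 'g \<Rightarrow> 'r"
  let ?C = "corner_ring ?D ?e"
  interpret D: nonunital_ring ?D by (rule finite_support_nonunital_ring)
  have e: "?e \<in> idempotents ?D" using x by (rule unit_idempotent)
  have eC: "?e \<in> carrier ?C" using e D.corner_carrier_iff[OF e] by (simp add: idempotents_def)
  have simple: "v \<in> simple_elements ?D" if v: "v \<in> simple_elements ?C" for v
  proof (rule D.simple_in_corner_imp_simple[OF e v])
    fix a assume a: "a \<in> carrier ?D" and ne: "a \<otimes>\<^bsub>?D\<^esub> v \<noteq> \<zero>\<^bsub>?D\<^esub>"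
    have v': "v \<in> carrier (group_algebra R (isotropy_group G x))"
      using v group_algebra_carrier_corner[OF x, of R]
      by (simp add: simple_elements_iff del: group_algebra_simps(4))
    then have vD: "v \<in> carrier ?D" by (auto simp: finite_support_carrier)
    have av: "convolution G a v \<in> carrier ?D" using finite_support_convolution[OF a vD] .
    obtain g where g: "convolution G a v g \<noteq> 0" using ne by (auto simp: fun_eq_iff)
    obtain h where h: "g \<in> arrows G" "dsrc G h = dsrc G g" "v h \<noteq> 0"
      using convolution_nonzeroE[OF g] by blast
    have gx: "dsrc G g = x" using v' h by auto
    let ?c = "indicator {ginv G g} :: 'g \<Rightarrow> 'r"
    have c: "?c \<in> carrier ?D" using h by (intro indicator_finite_support) (auto simp: arrow_simps)
    have "convolution G (convolution G ?e ?c) (convolution G a v) x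
        = convolution G ?e (convolution G ?c (convolution G a v)) x"
      using e c av
      by (subst convolution_assoc) (auto simp: idempotents_def finite_support_source_finite)
    also have "\<dots> = convolution G ?c (convolution G a v) x"
      using convolution_indicator_left[of "{x}" "convolution G ?c (convolution G a v)"] x
        finite_support_source_finite[OF finite_support_convolution[OF c av]] unit_arrow[OF x] by simp
    also have "\<dots> = convolution G a v g"
      using convolution_point_left[OF ginv_closed[OF h(1)] finite_support_source_finite[OF av]]
        h gx unit_arrow[OF x] by (simp add: arrow_simps) (metis gcomp_dsrc)
    finally have "convolution G (convolution G ?e ?c) (convolution G a v) \<noteq> (\<lambda>g. 0)"
      using g by (auto simp: fun_eq_iff intro!: exI[of _ x])
    then show "\<exists>c\<in>carrier ?D. ?e \<otimes>\<^bsub>?D\<^esub> c \<otimes>\<^bsub>?D\<^esub> (a \<otimes>\<^bsub>?D\<^esub> v) \<noteq> \<zero>\<^bsub>?D\<^esub>"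
      using c by auto
  qed
  have soc: "f \<in> ring_socle ?D" if "f \<in> ring_socle ?C" for f
    using that
  proof induct
    case zero
    then show ?case using socle.zero[of "regular_module ?D" ?D] by (simp add: corner_ring_def)
  next
    case (add v f)
    then show ?case using socle.add[OF simple[OF add(1)] add(3)] by (simp add: corner_ring_def)
  qed
  have "semisimple_ring ?C" using ss semisimple_group_algebra_iff_corner[OF x, of R] by blast
  then show ?thesis using eC soc by (auto simp: semisimple_ring_iff_socle)
qed

text \<open>
  The point mass of a unit \<open>y\<close> in the orbit of \<open>x\<close> is a two-sided multiple of the
  one of \<open>x\<close>, by an arrow between them. So the socle contains the point masses of all units,
  and their sums are local units.
\<close>

theorem finite_support_semisimple:
  fixes R :: "'r::comm_ring_1 itself"
  assumes reps: "\<And>y. y \<in> units G \<Longrightarrow>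
    \<exists>x\<in>units G. y \<in> orbit G x \<and> semisimple_ring (group_algebra R (isotropy_group G x))"
  shows "semisimple_ring (finite_support_algebra R G)"
proof -
  let ?D = "finite_support_algebra R G"
  interpret D: nonunital_ring ?D by (rule finite_support_nonunital_ring)
  have unit: "indicator {y} \<in> ring_socle ?D" if y: "y \<in> units G" for y
  proof -
    obtain x where x: "x \<in> units G" "y \<in> orbit G x"
      "semisimple_ring (group_algebra R (isotropy_group G x))" using reps[OF y] by blast
    then obtain g where g: "g \<in> arrows G" "dsrc G g = x" "rng G g = y" by (auto simp: orbit_def)
    let ?p = "indicator {g} :: 'g \<Rightarrow> 'r" and ?q = "indicator {ginv G g} :: 'g \<Rightarrow> 'r"
    have p: "?p \<in> carrier ?D" and q: "?q \<in> carrier ?D"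
      using g by (auto intro!: indicator_finite_support simp: arrow_simps)
    have "convolution G (indicator {x}) ?q = ?q"
      using convolution_indicator_left[of "{x}" ?q] finite_support_source_finite[OF q] x g
      by (auto simp: fun_eq_iff indicator_def arrow_simps)
    moreover have "convolution G ?p ?q = indicator {y}"
    proof -
      have "k \<in> arrows G \<and> rng G k = rng G g \<and> gcomp G (ginv G g) k = ginv G g \<longleftrightarrow> k = y" for k
      proof
        assume k: "k \<in> arrows G \<and> rng G k = rng G g \<and> gcomp G (ginv G g) k = ginv G g"
        then have "k = gcomp G g (gcomp G (ginv G g) k)"
          using ginv_gcomp_cancel'[of g k] g by simp
        then show "k = y" using k g by (simp add: gcomp_ginv_self)
      next
        assume "k = y"
        then show "k \<in> arrows G \<and> rng G k = rng G g \<and> gcomp G (ginv G g) k = ginv G g"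
          using unit_arrow[OF y] g gcomp_dsrc[of "ginv G g"] by (simp add: arrow_simps)
      qed
      then show ?thesis
        using convolution_point_left[OF g(1) finite_support_source_finite[OF q]]
        by (auto simp: fun_eq_iff indicator_def)
    qed
    ultimately have "?p \<otimes>\<^bsub>?D\<^esub> (indicator {x} \<otimes>\<^bsub>?D\<^esub> ?q) = indicator {y}" by simp
    moreover have "?p \<otimes>\<^bsub>?D\<^esub> (indicator {x} \<otimes>\<^bsub>?D\<^esub> ?q) \<in> ring_socle ?D"
      using unit_in_socle[OF x(1,3)] p q
      by (intro D.socle_closed_mult_left D.socle_closed_mult_right)
    ultimately show ?thesis by simp
  qed
  have units: "indicator V \<in> ring_socle ?D" if "finite V" "V \<subseteq> units G" for V
    using that
  proof induct
    case empty
    then show ?case using socle.zero[of "regular_module ?D" ?D] by (simp add: fun_eq_iff indicator_def)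
  next
    case (insert y V)
    then have "indicator {y} \<oplus>\<^bsub>?D\<^esub> indicator V \<in> ring_socle ?D"
      using D.regular.socle_closed_add[of "indicator {y}" "indicator V"] unit by simp
    moreover have "indicator {y} \<oplus>\<^bsub>?D\<^esub> indicator V = (indicator (insert y V) :: 'g \<Rightarrow> 'r)"
      using insert(2) by (auto simp: fun_eq_iff indicator_def)
    ultimately show ?case by simp
  qed
  have "f \<in> ring_socle ?D" if f: "f \<in> carrier ?D" for f
  proof -
    define V where "V = dsrc G ` {g. f g \<noteq> 0}"
    have V: "finite V" "V \<subseteq> units G"
      using f by (auto simp: V_def finite_support_carrier subset_iff dsrc_unit)
    have "f = f \<otimes>\<^bsub>?D\<^esub> indicator V"
      using convolution_indicator_right[OF V(2) finite_support_source_finite[OF f]]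
      by (auto simp: V_def fun_eq_iff)
    then show ?thesis using D.socle_closed_mult_left[OF units[OF V] f] by simp
  qed
  then show ?thesis
    using finite_support_has_local_units D.nonunital_ring_axioms by (auto simp: semisimple_ring_iff_socle)
qed

end

section \<open>Local homeomorphisms\<close>

lemma local_homeomorphismE:
  assumes "local_homeomorphism X Y f" "x \<in> topspace X"
  obtains U where "openin X U" "x \<in> U" "openin Y (f ` U)" "inj_on f U"
    "\<And>W. openin Y W \<Longrightarrow> openin X {y \<in> U. f y \<in> W}"
    "\<And>W. \<lbrakk>openin X W; W \<subseteq> U\<rbrakk> \<Longrightarrow> openin Y (f ` W)"
proof -
  obtain U where U: "openin X U" "x \<in> U" "openin Y (f ` U)"
    and hom: "homeomorphic_map (subtopology X U) (subtopology Y (f ` U)) f"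
    using assms unfolding local_homeomorphism_def by blast
  have top: "topspace (subtopology X U) = U" using openin_subset[OF U(1)] by auto
  show ?thesis
  proof (rule that[OF U])
    show "inj_on f U" using homeomorphic_imp_injective_map[OF hom] unfolding top .
    fix W assume W: "openin Y W"
    have "openin (subtopology Y (f ` U)) (f ` U \<inter> W)" using W by (rule openin_subtopology_Int2)
    then have "openin (subtopology X U) {y \<in> topspace (subtopology X U). f y \<in> f ` U \<inter> W}"
      by (rule openin_continuous_map_preimage[OF homeomorphic_imp_continuous_map[OF hom]])
    also have "{y \<in> topspace (subtopology X U). f y \<in> f ` U \<inter> W} = {y \<in> U. f y \<in> W}"
      unfolding top by auto
    finally show "openin X {y \<in> U. f y \<in> W}" using U(1) by (simp add: openin_open_subtopology)
  next
    fix W assume W: "openin X W" "W \<subseteq> U"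
    then have "openin (subtopology X U) W" using U(1) by (simp add: openin_open_subtopology)
    then have "openin (subtopology Y (f ` U)) (f ` W)"
      using homeomorphic_imp_open_map[OF hom] by (simp add: open_map_def)
    then show "openin Y (f ` W)" using U(3) by (simp add: openin_open_subtopology)
  qed
qed

lemma local_homeomorphism_continuous:
  assumes "local_homeomorphism X Y f" shows "continuous_map X Y f"
  unfolding continuous_map_def
proof (intro conjI allI impI)
  show "f \<in> topspace X \<rightarrow> topspace Y"
  proof
    fix x assume "x \<in> topspace X"
    then obtain U where "x \<in> U" "openin Y (f ` U)" using local_homeomorphismE[OF assms] by metis
    then show "f x \<in> topspace Y" using openin_subset by blast
  qed
  fix W assume W: "openin Y W"
  show "openin X {x \<in> topspace X. f x \<in> W}"
  proof (subst openin_subopen, rule ballI)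
    fix x assume x: "x \<in> {x \<in> topspace X. f x \<in> W}"
    then have "x \<in> topspace X" by simp
    then obtain U where U: "openin X U" "x \<in> U" "openin X {y \<in> U. f y \<in> W}"
      using local_homeomorphismE[OF assms, of x] W by metis
    then show "\<exists>T. openin X T \<and> x \<in> T \<and> T \<subseteq> {x \<in> topspace X. f x \<in> W}"
      using x openin_subset[OF U(1)] by (intro exI[of _ "{y \<in> U. f y \<in> W}"]) auto
  qed
qed

lemma local_homeomorphism_open_map:
  assumes "local_homeomorphism X Y f" and V: "openin X V" shows "openin Y (f ` V)"
proof (subst openin_subopen, rule ballI)
  fix y assume "y \<in> f ` V"
  then obtain x where x: "x \<in> V" "y = f x" by auto
  then have "x \<in> topspace X" using openin_subset[OF V] by auto
  then obtain U where U: "openin X U" "x \<in> U"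
    "\<And>W. \<lbrakk>openin X W; W \<subseteq> U\<rbrakk> \<Longrightarrow> openin Y (f ` W)"
    using local_homeomorphismE[OF assms(1), of x] by metis
  have "openin Y (f ` (U \<inter> V))" using U V by (intro U(3)) auto
  then show "\<exists>T. openin Y T \<and> y \<in> T \<and> T \<subseteq> f ` V"
    using x U(2) by (intro exI[of _ "f ` (U \<inter> V)"]) auto
qed

section \<open>Ample groupoids and their algebras\<close>

locale ample =
  fixes G :: "('g, 'm) top_groupoid_scheme"
  assumes ample: "ample_groupoid G"
begin

lemma topological: "topological_groupoid G"
  using ample by (simp add: ample_groupoid_def etale_groupoid_def)

sublocale groupoid G
  using topological by (simp add: topological_groupoid_def)

lemma topspace_arrows [simp]: "topspace (gtop G) = arrows G"
  using topological by (simp add: topological_groupoid_def)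

lemma dsrc_local_homeomorphism: "local_homeomorphism (gtop G) (unit_space G) (dsrc G)"
  and rng_local_homeomorphism: "local_homeomorphism (gtop G) (unit_space G) (rng G)"
  using ample by (simp_all add: ample_groupoid_def etale_groupoid_def)

lemma dsrc_continuous: "continuous_map (gtop G) (unit_space G) (dsrc G)"
  by (rule local_homeomorphism_continuous[OF dsrc_local_homeomorphism])

lemma rng_continuous: "continuous_map (gtop G) (unit_space G) (rng G)"
  by (rule local_homeomorphism_continuous[OF rng_local_homeomorphism])

lemma Hausdorff_units: "Hausdorff_space (unit_space G)"
  using ample by (simp add: ample_groupoid_def)

lemma open_arrows: "openin (gtop G) U \<Longrightarrow> U \<subseteq> arrows G"
  using openin_subset[of "gtop G" U] by simp

text \<open>
  Near a unit there is an open set \<open>U\<close> on which the source map is injective. An arrow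
  \<open>g \<in> U\<close> with \<open>d(g) \<in> U\<close> has the same source as \<open>d(g)\<close>, so
  \<open>g = d(g)\<close>.
\<close>

lemma units_open: "openin (gtop G) (units G)"
proof (subst openin_subopen, rule ballI)
  fix x assume x: "x \<in> units G"
  then have "x \<in> topspace (gtop G)" by (simp add: unit_arrow)
  then obtain U where U: "openin (gtop G) U" "x \<in> U" "inj_on (dsrc G) U"
    "\<And>W. openin (unit_space G) W \<Longrightarrow> openin (gtop G) {y \<in> U. dsrc G y \<in> W}"
    using local_homeomorphismE[OF dsrc_local_homeomorphism, of x] by metis
  define V where "V = {y \<in> U. dsrc G y \<in> units G \<inter> U}"
  have "openin (gtop G) V"
    unfolding V_def using U(1) by (intro U(4) openin_subtopology_Int2)
  moreover have "x \<in> V" using x U(2) by (simp add: V_def unit_arrow)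
  moreover have "V \<subseteq> units G"
  proof
    fix g assume g: "g \<in> V"
    then have "g \<in> arrows G" using open_arrows[OF U(1)] by (auto simp: V_def)
    then have "dsrc G g = g"
      using inj_onD[OF U(3), of "dsrc G g" g] g by (auto simp: V_def dsrc_dsrc)
    then show "g \<in> units G" using g by (simp add: V_def)
  qed
  ultimately show "\<exists>T. openin (gtop G) T \<and> x \<in> T \<and> T \<subseteq> units G" by blast
qed

lemma compact_open_bisection_nbhd:
  assumes "openin (gtop G) W" "g \<in> W"
  obtains U where "compact_open_bisection G U" "g \<in> U" "U \<subseteq> W"
proof -
  have "(arbitrary union_of (compact_open_bisection G)) W"
    using assms(1) ample by (simp add: ample_groupoid_def)
  then show ?thesis using assms(2) that by (auto simp: union_of_def)
qed

lemma compact_open_bisectionD: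
  assumes "compact_open_bisection G U"
  shows "openin (gtop G) U" "compactin (gtop G) U" "inj_on (dsrc G) U" "inj_on (rng G) U"
    "U \<subseteq> arrows G"
  using assms open_arrows by (auto simp: compact_open_bisection_def open_bisection_def)

definition set_product :: "'g set \<Rightarrow> 'g set \<Rightarrow> 'g set" where
  "set_product U V = {gcomp G u v | u v. u \<in> U \<and> v \<in> V \<and> dsrc G u = rng G v}"

text \<open>
  With \<open>s\<close> the continuous section of the source map with values in \<open>V\<close>, an arrow
  \<open>g\<close> is in the product iff \<open>g s(d(g))\<^sup>-\<^sup>1\<close> is defined and lies in
  \<open>U\<close>, which is an open condition.
\<close>

lemma set_product_open:
  assumes U: "openin (gtop G) U" and V: "openin (gtop G) V" and inj: "inj_on (dsrc G) V"
  shows "openin (gtop G) (set_product U V)"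
proof -
  define W where "W = {g \<in> topspace (gtop G). dsrc G g \<in> dsrc G ` V}"
  define s where "s = inv_into V (dsrc G)"
  have Va: "V \<subseteq> arrows G" and Ua: "U \<subseteq> arrows G" using U V open_arrows by auto
  have W: "openin (gtop G) W"
    unfolding W_def
    by (rule openin_continuous_map_preimage[OF dsrc_continuous
          local_homeomorphism_open_map[OF dsrc_local_homeomorphism V]])
  have s: "s (dsrc G g) \<in> V" "dsrc G (s (dsrc G g)) = dsrc G g" if "g \<in> W" for g
    using that by (simp_all add: W_def s_def inv_into_into f_inv_into_f)
  have s_eq: "s (dsrc G v) = v" if "v \<in> V" for v using that inj by (simp add: s_def)
  have top: "topspace (subtopology (gtop G) W) = W" by (auto simp: W_def)
  have cs: "continuous_map (subtopology (gtop G) W) (gtop G) (\<lambda>g. s (dsrc G g))"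
    unfolding continuous_map_def
  proof (intro conjI allI impI)
    show "(\<lambda>g. s (dsrc G g)) \<in> topspace (subtopology (gtop G) W) \<rightarrow> topspace (gtop G)"
      using s(1) Va unfolding top by auto
    fix N assume N: "openin (gtop G) N"
    have "{g \<in> W. s (dsrc G g) \<in> N} = W \<inter> {g \<in> topspace (gtop G). dsrc G g \<in> dsrc G ` (V \<inter> N)}"
    proof (rule equalityI; rule subsetI)
      fix g assume g: "g \<in> {g \<in> W. s (dsrc G g) \<in> N}"
      then have "s (dsrc G g) \<in> V \<inter> N" "dsrc G (s (dsrc G g)) = dsrc G g" using s[of g] by auto
      then show "g \<in> W \<inter> {g \<in> topspace (gtop G). dsrc G g \<in> dsrc G ` (V \<inter> N)}"
        using g by (auto simp: W_def intro: rev_image_eqI)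
    next
      fix g assume "g \<in> W \<inter> {g \<in> topspace (gtop G). dsrc G g \<in> dsrc G ` (V \<inter> N)}"
      then show "g \<in> {g \<in> W. s (dsrc G g) \<in> N}" using s_eq by auto
    qed
    moreover have "openin (gtop G) {g \<in> topspace (gtop G). dsrc G g \<in> dsrc G ` (V \<inter> N)}"
      using V N by (intro openin_continuous_map_preimage[OF dsrc_continuous]
            local_homeomorphism_open_map[OF dsrc_local_homeomorphism] openin_Int)
    ultimately show "openin (subtopology (gtop G) W)
        {g \<in> topspace (subtopology (gtop G) W). s (dsrc G g) \<in> N}"
      unfolding top by (simp add: openin_subtopology_Int2)
  qed
  have "continuous_map (gtop G) (gtop G) (ginv G)"
    using topological by (simp add: topological_groupoid_def)
  with cs have ci: "continuous_map (subtopology (gtop G) W) (gtop G) (\<lambda>g. ginv G (s (dsrc G g)))"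
    using continuous_map_compose[of _ _ "\<lambda>g. s (dsrc G g)" _ "ginv G"] by (simp add: comp_def)
  let ?C = "{(g, h). g \<in> arrows G \<and> h \<in> arrows G \<and> dsrc G g = rng G h}"
  have "continuous_map (subtopology (gtop G) W) (subtopology (prod_topology (gtop G) (gtop G)) ?C)
      (\<lambda>g. (g, ginv G (s (dsrc G g))))"
    unfolding continuous_map_in_subtopology
  proof
    show "continuous_map (subtopology (gtop G) W) (prod_topology (gtop G) (gtop G))
        (\<lambda>g. (g, ginv G (s (dsrc G g))))"
      using ci by (simp add: continuous_map_pairedI continuous_map_from_subtopology)
    show "(\<lambda>g. (g, ginv G (s (dsrc G g)))) \<in> topspace (subtopology (gtop G) W) \<rightarrow> ?C"
    proof
      fix g assume g: "g \<in> topspace (subtopology (gtop G) W)"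
      then have "s (dsrc G g) \<in> arrows G" using s(1)[of g] Va unfolding top by blast
      then show "(g, ginv G (s (dsrc G g))) \<in> ?C"
        using g s(2)[of g] unfolding top by (auto simp: W_def arrow_simps)
    qed
  qed
  moreover have "continuous_map (subtopology (prod_topology (gtop G) (gtop G)) ?C) (gtop G)
      (\<lambda>(g, h). gcomp G g h)"
    using topological by (simp add: topological_groupoid_def)
  ultimately have "continuous_map (subtopology (gtop G) W) (gtop G)
      (\<lambda>g. gcomp G g (ginv G (s (dsrc G g))))"
    using continuous_map_compose[of _ _ "\<lambda>g. (g, ginv G (s (dsrc G g)))" _ "\<lambda>(g, h). gcomp G g h"]
    by (simp add: comp_def)
  from openin_continuous_map_preimage[OF this U]
  have "openin (subtopology (gtop G) W) {g \<in> W. gcomp G g (ginv G (s (dsrc G g))) \<in> U}"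
    by (simp only: top)
  then have "openin (gtop G) {g \<in> W. gcomp G g (ginv G (s (dsrc G g))) \<in> U}"
    using W by (simp add: openin_open_subtopology)
  also have "{g \<in> W. gcomp G g (ginv G (s (dsrc G g))) \<in> U} = set_product U V"
  proof (rule equalityI; rule subsetI)
    fix g assume g: "g \<in> {g \<in> W. gcomp G g (ginv G (s (dsrc G g))) \<in> U}"
    then have ga: "g \<in> arrows G" "s (dsrc G g) \<in> V" "s (dsrc G g) \<in> arrows G"
      "dsrc G g = dsrc G (s (dsrc G g))"
      using s[of g] Va by (auto simp: W_def)
    have "g = gcomp G (gcomp G g (ginv G (s (dsrc G g)))) (s (dsrc G g))"
      by (rule gcomp_ginv_cancel'[symmetric]) (fact ga)+
    moreover have "dsrc G (gcomp G g (ginv G (s (dsrc G g)))) = rng G (s (dsrc G g))"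
      using ga(1,3,4) by (simp add: arrow_simps)
    ultimately show "g \<in> set_product U V"
      unfolding set_product_def using g ga(2)
      by (intro CollectI exI[of _ "gcomp G g (ginv G (s (dsrc G g)))"] exI[of _ "s (dsrc G g)"]) simp
  next
    fix g assume "g \<in> set_product U V"
    then obtain u v where uv: "u \<in> U" "v \<in> V" "dsrc G u = rng G v" "g = gcomp G u v"
      by (auto simp: set_product_def)
    then have a: "u \<in> arrows G" "v \<in> arrows G" using Ua Va by auto
    then have "dsrc G g = dsrc G v" "g \<in> arrows G" using uv by (simp_all add: arrow_simps)
    then show "g \<in> {g \<in> W. gcomp G g (ginv G (s (dsrc G g))) \<in> U}"
      using uv a s_eq[OF uv(2)] by (simp add: W_def gcomp_ginv_cancel)
  qed
  finally show ?thesis .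
qed

text \<open>
  The composable pairs are closed in \<open>G \<times> G\<close>, as the unit space is Hausdorff.
\<close>

lemma set_product_compact:
  assumes U: "compactin (gtop G) U" and V: "compactin (gtop G) V"
  shows "compactin (gtop G) (set_product U V)"
proof -
  let ?P = "prod_topology (gtop G) (gtop G)"
  let ?C = "{(g, h). g \<in> arrows G \<and> h \<in> arrows G \<and> dsrc G g = rng G h}"
  have "closedin ?P {p \<in> topspace ?P. (dsrc G \<circ> fst) p = (rng G \<circ> snd) p}"
    by (rule closedin_continuous_maps_eq[OF Hausdorff_units
          continuous_map_compose[OF continuous_map_fst dsrc_continuous]
          continuous_map_compose[OF continuous_map_snd rng_continuous]])
  moreover have "{p \<in> topspace ?P. (dsrc G \<circ> fst) p = (rng G \<circ> snd) p} = ?C" by auto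
  ultimately have "closedin ?P ?C" by simp
  then have "compactin ?P ((U \<times> V) \<inter> ?C)"
    using U V by (intro compact_Int_closedin) (simp_all add: compactin_Times)
  then have "compactin (subtopology ?P ?C) ((U \<times> V) \<inter> ?C)" by (simp add: compactin_subtopology)
  moreover have "continuous_map (subtopology ?P ?C) (gtop G) (\<lambda>(g, h). gcomp G g h)"
    using topological by (simp add: topological_groupoid_def)
  ultimately have "compactin (gtop G) ((\<lambda>(g, h). gcomp G g h) ` ((U \<times> V) \<inter> ?C))"
    by (rule image_compactin)
  also have "(\<lambda>(g, h). gcomp G g h) ` ((U \<times> V) \<inter> ?C) = set_product U V"
    using compactin_subset_topspace[OF U] compactin_subset_topspace[OF V]
    by (fastforce simp: set_product_def)
  finally show ?thesis .
qed

lemma set_product_bisection: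
  assumes U: "compact_open_bisection G U" and V: "compact_open_bisection G V"
  shows "compact_open_bisection G (set_product U V)"
proof -
  note U = compact_open_bisectionD[OF U] and V = compact_open_bisectionD[OF V]
  have "u = u' \<and> v = v'"
    if "u \<in> U" "v \<in> V" "dsrc G u = rng G v" "u' \<in> U" "v' \<in> V" "dsrc G u' = rng G v'"
      "dsrc G (gcomp G u v) = dsrc G (gcomp G u' v') \<or> rng G (gcomp G u v) = rng G (gcomp G u' v')"
    for u v u' v'
  proof -
    have a: "u \<in> arrows G" "v \<in> arrows G" "u' \<in> arrows G" "v' \<in> arrows G"
      using that U(5) V(5) by auto
    have "dsrc G v = dsrc G v' \<or> rng G u = rng G u'"
      using that(3,6,7) a by (simp add: arrow_simps)
    then show ?thesis
    proof
      assume "dsrc G v = dsrc G v'"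
      then have "v = v'" using inj_onD[OF V(3)] that by blast
      then show ?thesis using inj_onD[OF U(3)] that by metis
    next
      assume "rng G u = rng G u'"
      then have "u = u'" using inj_onD[OF U(4)] that by blast
      then show ?thesis using inj_onD[OF V(4)] that by metis
    qed
  qed
  then have "inj_on (dsrc G) (set_product U V)" "inj_on (rng G) (set_product U V)"
    unfolding inj_on_def set_product_def by fast+
  then show ?thesis
    using set_product_open[OF U(1) V(1,3)] set_product_compact[OF U(2) V(2)]
    by (simp add: compact_open_bisection_def open_bisection_def)
qed

lemma indicator_source_finite:
  assumes "U \<subseteq> arrows G" "inj_on (dsrc G) U"
  shows "(indicator U :: 'g \<Rightarrow> 'r::comm_ring_1) \<in> source_finite G"
proof -
  have "finite {h \<in> arrows G. dsrc G h = y \<and> indicator U h \<noteq> (0 :: 'r)}" for y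
  proof (rule inj_on_finite[of "dsrc G" _ "{y}"])
    show "inj_on (dsrc G) {h \<in> arrows G. dsrc G h = y \<and> indicator U h \<noteq> (0 :: 'r)}"
      by (rule inj_on_subset[OF assms(2)]) (auto simp: indicator_def split: if_splits)
  qed auto
  then show ?thesis using assms(1) by (auto simp: source_finite_def indicator_def)
qed

lemma convolution_indicator_bisections:
  assumes U: "compact_open_bisection G U" and V: "compact_open_bisection G V"
  shows "convolution G (indicator U) (indicator V) = (indicator (set_product U V) :: 'g \<Rightarrow> 'r::comm_ring_1)"
proof
  fix g
  note U = compact_open_bisectionD[OF U] and V = compact_open_bisectionD[OF V]
  show "convolution G (indicator U) (indicator V) g = (indicator (set_product U V) g :: 'r)"
  proof (cases "g \<in> set_product U V")
    case True
    then obtain u v where uv: "u \<in> U" "v \<in> V" "dsrc G u = rng G v" "g = gcomp G u v"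
      by (auto simp: set_product_def)
    then have a: "u \<in> arrows G" "v \<in> arrows G" using U(5) V(5) by auto
    then have g: "dsrc G g = dsrc G v" "g \<in> arrows G" using uv by (simp_all add: arrow_simps)
    have "convolution G (indicator U) (indicator V) g
        = (\<Sum>h\<in>{v}. indicator U (gcomp G g (ginv G h)) * (indicator V h :: 'r))"
      by (rule convolution_eq_sum)
         (use g a uv inj_onD[OF V(3)] in \<open>auto simp: indicator_def split: if_splits\<close>)
    also have "gcomp G g (ginv G v) = u" using uv a by (simp add: gcomp_ginv_cancel)
    then have "(\<Sum>h\<in>{v}. indicator U (gcomp G g (ginv G h)) * (indicator V h :: 'r)) = 1"
      using uv by simp
    finally show ?thesis using True by simp
  next
    case False
    have "convolution G (indicator U) (indicator V) g = (0 :: 'r)"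
    proof (rule ccontr)
      assume ne: "convolution G (indicator U) (indicator V) g \<noteq> (0 :: 'r)"
      obtain h where h: "g \<in> arrows G" "h \<in> arrows G" "dsrc G h = dsrc G g"
        "indicator V h \<noteq> (0 :: 'r)" "indicator U (gcomp G g (ginv G h)) \<noteq> (0 :: 'r)"
        using convolution_nonzeroE[OF ne] by blast
      then have "h \<in> V" "gcomp G g (ginv G h) \<in> U" by (auto simp: indicator_def split: if_splits)
      moreover have "gcomp G (gcomp G g (ginv G h)) h = g"
        using gcomp_ginv_cancel'[of g h] h by simp
      moreover have "dsrc G (gcomp G g (ginv G h)) = rng G h" using h by (simp add: arrow_simps)
      ultimately show False using False by (auto simp: set_product_def)
    qed
    then show ?thesis using False by simp
  qed
qed

end

context ample
begin

lemma groupoid_algebra_carrierE: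
  fixes R :: "'r::comm_ring_1 itself"
  assumes "f \<in> carrier (groupoid_algebra R G)"
  obtains \<U> c where "finite \<U>" "\<And>U. U \<in> \<U> \<Longrightarrow> compact_open_bisection G U"
    "f = (\<lambda>g. \<Sum>U\<in>\<U>. c U * indicator U g)"
  using assms by (auto simp: groupoid_algebra_def)

lemma groupoid_algebra_carrierI:
  fixes R :: "'r::comm_ring_1 itself"
  assumes "finite \<U>" "\<And>U. U \<in> \<U> \<Longrightarrow> compact_open_bisection G U"
  shows "(\<lambda>g. \<Sum>U\<in>\<U>. c U * indicator U g) \<in> carrier (groupoid_algebra R G)"
  using assms by (auto simp: groupoid_algebra_def)

lemma scaled_indicator_in_algebra:
  fixes R :: "'r::comm_ring_1 itself"
  assumes "compact_open_bisection G U"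
  shows "(\<lambda>g. r * indicator U g) \<in> carrier (groupoid_algebra R G)"
  using groupoid_algebra_carrierI[of "{U}" "\<lambda>_. r" R] assms by simp

lemma indicator_in_algebra:
  fixes R :: "'r::comm_ring_1 itself"
  assumes "compact_open_bisection G U"
  shows "indicator U \<in> carrier (groupoid_algebra R G)"
proof -
  have "(\<lambda>g. 1 * indicator U g :: 'r) = indicator U" by (simp add: fun_eq_iff)
  then show ?thesis using scaled_indicator_in_algebra[OF assms, of 1 R] by simp
qed

lemma groupoid_algebra_add_closed:
  fixes R :: "'r::comm_ring_1 itself"
  assumes f1: "f1 \<in> carrier (groupoid_algebra R G)" and f2: "f2 \<in> carrier (groupoid_algebra R G)"
  shows "(\<lambda>g. f1 g + f2 g) \<in> carrier (groupoid_algebra R G)"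
proof -
  obtain \<U> c where U: "finite \<U>" "\<And>U. U \<in> \<U> \<Longrightarrow> compact_open_bisection G U"
    "f1 = (\<lambda>g. \<Sum>U\<in>\<U>. c U * indicator U g)" using f1 by (rule groupoid_algebra_carrierE) blast
  obtain \<V> d where V: "finite \<V>" "\<And>U. U \<in> \<V> \<Longrightarrow> compact_open_bisection G U"
    "f2 = (\<lambda>g. \<Sum>U\<in>\<V>. d U * indicator U g)" using f2 by (rule groupoid_algebra_carrierE) blast
  define c' d' where "c' U = (if U \<in> \<U> then c U else 0)" and "d' U = (if U \<in> \<V> then d U else 0)" for U
  have "f1 g = (\<Sum>U\<in>\<U> \<union> \<V>. c' U * indicator U g)" for g
    unfolding U(3) using U(1) V(1) by (intro sum.mono_neutral_cong_left) (auto simp: c'_def)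
  moreover have "f2 g = (\<Sum>U\<in>\<U> \<union> \<V>. d' U * indicator U g)" for g
    unfolding V(3) using U(1) V(1) by (intro sum.mono_neutral_cong_left) (auto simp: d'_def)
  ultimately have "(\<lambda>g. f1 g + f2 g) = (\<lambda>g. \<Sum>U\<in>\<U> \<union> \<V>. (c' U + d' U) * indicator U g)"
    by (simp add: fun_eq_iff distrib_right sum.distrib)
  then show ?thesis
    using groupoid_algebra_carrierI[of "\<U> \<union> \<V>" "\<lambda>U. c' U + d' U" R] U(1,2) V(1,2) by auto
qed

lemma groupoid_algebra_zero_closed:
  fixes R :: "'r::comm_ring_1 itself"
  shows "(\<lambda>g. 0) \<in> carrier (groupoid_algebra R G)"
  using groupoid_algebra_carrierI[of "{}" _ R] by simp

lemma groupoid_algebra_induct [consumes 1, case_names zero scaled add]: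
  fixes R :: "'r::comm_ring_1 itself"
  assumes f: "f \<in> carrier (groupoid_algebra R G)"
    and zero: "P (\<lambda>g. 0)"
    and scaled: "\<And>U r. compact_open_bisection G U \<Longrightarrow> P (\<lambda>g. r * indicator U g)"
    and add: "\<And>f1 f2. \<lbrakk>f1 \<in> carrier (groupoid_algebra R G); P f1;
      f2 \<in> carrier (groupoid_algebra R G); P f2\<rbrakk> \<Longrightarrow> P (\<lambda>g. f1 g + f2 g)"
  shows "P f"
proof -
  obtain \<U> c where U: "finite \<U>" "\<And>U. U \<in> \<U> \<Longrightarrow> compact_open_bisection G U"
    "f = (\<lambda>g. \<Sum>U\<in>\<U>. c U * indicator U g)" using f by (rule groupoid_algebra_carrierE) blast
  have "P (\<lambda>g. \<Sum>U\<in>\<U>. c U * indicator U g)" using U(1,2)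
  proof induct
    case empty then show ?case using zero by simp
  next
    case (insert U \<U>)
    then have "P (\<lambda>g. c U * indicator U g + (\<Sum>U\<in>\<U>. c U * indicator U g))"
      using add[OF scaled_indicator_in_algebra scaled groupoid_algebra_carrierI] by simp
    then show ?case using insert by simp
  qed
  then show ?thesis by (simp add: U(3))
qed

lemma groupoid_algebra_support_cover:
  fixes R :: "'r::comm_ring_1 itself"
  assumes "f \<in> carrier (groupoid_algebra R G)"
  obtains \<U> where "finite \<U>" "\<And>U. U \<in> \<U> \<Longrightarrow> compact_open_bisection G U" "{g. f g \<noteq> 0} \<subseteq> \<Union>\<U>"
proof -
  obtain \<U> c where U: "finite \<U>" "\<And>U. U \<in> \<U> \<Longrightarrow> compact_open_bisection G U"
    "f = (\<lambda>g. \<Sum>U\<in>\<U>. c U * indicator U g)" using assms by (rule groupoid_algebra_carrierE) blast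
  have "f g = 0" if "g \<notin> \<Union>\<U>" for g
    unfolding U(3) using that by (intro sum.neutral) (auto simp: indicator_def)
  then have "{g. f g \<noteq> 0} \<subseteq> \<Union>\<U>" by auto
  then show ?thesis using that U(1,2) by simp
qed

lemma scaled_source_finite:
  assumes "f \<in> source_finite G" shows "(\<lambda>g. r * f g) \<in> source_finite G"
proof -
  have "finite {h \<in> arrows G. dsrc G h = y \<and> r * f h \<noteq> 0}" for y
    by (rule finite_subset[OF _ source_finiteD(2)[OF assms, of y]]) auto
  then show ?thesis using assms by (simp add: source_finite_def)
qed

lemma groupoid_algebra_source_finite:
  fixes R :: "'r::comm_ring_1 itself"
  assumes "f \<in> carrier (groupoid_algebra R G)" shows "f \<in> source_finite G"
  using assms
proof (induct rule: groupoid_algebra_induct)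
  case zero then show ?case by (simp add: source_finite_def)
next
  case (scaled U r)
  note U = compact_open_bisectionD[OF this]
  show ?case by (rule scaled_source_finite[OF indicator_source_finite[OF U(5,3)]])
next
  case (add f1 f2) then show ?case by (simp add: source_finite_add)
qed

lemma convolution_scale:
  assumes f2: "f2 \<in> source_finite G"
  shows "convolution G (\<lambda>g. r * f1 g) (\<lambda>g. s * f2 g) = (\<lambda>g. (r * s) * convolution G f1 f2 g)"
proof
  fix g
  show "convolution G (\<lambda>g. r * f1 g) (\<lambda>g. s * f2 g) g = (r * s) * convolution G f1 f2 g"
  proof (cases "g \<in> arrows G")
    case g: True
    define H where "H = {h \<in> arrows G. dsrc G h = dsrc G g \<and> f2 h \<noteq> 0}"
    have fin: "finite H" using source_finiteD(2)[OF f2] by (simp add: H_def)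
    have "convolution G (\<lambda>g. r * f1 g) (\<lambda>g. s * f2 g) g
        = (\<Sum>h\<in>H. (r * f1 (gcomp G g (ginv G h))) * (s * f2 h))"
      by (rule convolution_eq_sum) (use g fin in \<open>auto simp: H_def\<close>)
    moreover have "convolution G f1 f2 g = (\<Sum>h\<in>H. f1 (gcomp G g (ginv G h)) * f2 h)"
      by (rule convolution_eq_sum) (use g fin in \<open>auto simp: H_def\<close>)
    ultimately show ?thesis by (simp add: sum_distrib_left mult_ac)
  qed (simp add: convolution_outside)
qed

lemma groupoid_algebra_convolution_closed:
  fixes R :: "'r::comm_ring_1 itself"
  assumes f1: "f1 \<in> carrier (groupoid_algebra R G)" and f2: "f2 \<in> carrier (groupoid_algebra R G)"
  shows "convolution G f1 f2 \<in> carrier (groupoid_algebra R G)"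
  using f1
proof (induct rule: groupoid_algebra_induct)
  case zero
  have "convolution G (\<lambda>g. 0) f2 = (\<lambda>g. 0)" by (simp add: convolution_def fun_eq_iff)
  then show ?case using groupoid_algebra_zero_closed[of R] by simp
next
  case (add f f')
  then show ?case unfolding convolution_add_left by (intro groupoid_algebra_add_closed)
next
  case (scaled U r)
  note U = this
  show ?case using f2
  proof (induct rule: groupoid_algebra_induct)
    case zero
    have "convolution G (\<lambda>g. r * indicator U g) (\<lambda>g. 0) = (\<lambda>g. 0)"
      by (simp add: convolution_def fun_eq_iff)
    then show ?case using groupoid_algebra_zero_closed[of R] by simp
  next
    case (add f f')
    then show ?case
      by (subst convolution_add_right)
         (auto intro: groupoid_algebra_source_finite groupoid_algebra_add_closed)
  next
    case (scaled V s)
    note V = compact_open_bisectionD[OF this]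
    have "convolution G (\<lambda>g. r * indicator U g) (\<lambda>g. s * indicator V g)
        = (\<lambda>g. (r * s) * indicator (set_product U V) g)"
      using convolution_scale[OF indicator_source_finite[OF V(5,3)], of r "indicator U" s]
      by (simp add: convolution_indicator_bisections[OF U scaled])
    then show ?case
      using scaled_indicator_in_algebra[OF set_product_bisection[OF U scaled], of "r * s" R] by simp
  qed
qed

lemma groupoid_algebra_minus_closed:
  fixes R :: "'r::comm_ring_1 itself"
  assumes "f \<in> carrier (groupoid_algebra R G)"
  shows "(\<lambda>g. - f g) \<in> carrier (groupoid_algebra R G)"
  using assms
proof (induct rule: groupoid_algebra_induct)
  case zero then show ?case using groupoid_algebra_zero_closed by simp
next
  case (scaled U r)
  then show ?case using scaled_indicator_in_algebra[OF scaled, of "- r" R] by simp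
next
  case (add f1 f2)
  then show ?case using groupoid_algebra_add_closed[OF add(2,4)] by simp
qed

lemma groupoid_algebra_nonunital_ring: "nonunital_ring (groupoid_algebra R G)"
proof (rule convolution_subring)
  show "carrier (groupoid_algebra R G) \<subseteq> source_finite G"
    using groupoid_algebra_source_finite by blast
qed (simp_all add: groupoid_algebra_zero_closed groupoid_algebra_add_closed
    groupoid_algebra_minus_closed groupoid_algebra_convolution_closed)

text \<open>
  In a discrete space the compact sets are the finite ones, and single arrows are bisections.
\<close>

lemma groupoid_algebra_discrete:
  fixes R :: "'r::comm_ring_1 itself"
  assumes "discrete_groupoid G"
  shows "groupoid_algebra R G = finite_support_algebra R G"
proof -
  have top: "gtop G = discrete_topology (arrows G)" using assms by (simp add: discrete_groupoid_def)
  have point: "compact_open_bisection G {g}" if "g \<in> arrows G" for g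
    using that by (simp add: compact_open_bisection_def open_bisection_def top compactin_discrete_topology)
  have "f \<in> carrier (finite_support_algebra R G)" if f: "f \<in> carrier (groupoid_algebra R G)" for f
  proof -
    obtain \<U> where U: "finite \<U>" "\<And>U. U \<in> \<U> \<Longrightarrow> compact_open_bisection G U"
      and supp: "{g. f g \<noteq> 0} \<subseteq> \<Union>\<U>" using f by (rule groupoid_algebra_support_cover) blast
    have "finite U" "U \<subseteq> arrows G" if "U \<in> \<U>" for U
      using compact_open_bisectionD(2)[OF U(2)[OF that]] by (simp_all add: top compactin_discrete_topology)
    then have "finite (\<Union>\<U>)" "\<Union>\<U> \<subseteq> arrows G" using U(1) by auto
    then show ?thesis using supp by (auto simp: finite_support_carrier intro: finite_subset)
  qed
  moreover have "f \<in> carrier (groupoid_algebra R G)" if f: "f \<in> carrier (finite_support_algebra R G)" for f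
  proof -
    define S where "S = {g. f g \<noteq> 0}"
    have S: "finite S" "S \<subseteq> arrows G" using f by (auto simp: S_def finite_support_carrier)
    have "f = (\<lambda>g. \<Sum>U\<in>(\<lambda>g. {g}) ` S. f (the_elem U) * indicator U g)"
    proof
      fix g
      have "(\<Sum>U\<in>(\<lambda>g. {g}) ` S. f (the_elem U) * indicator U g) = (\<Sum>h\<in>S. f h * indicator {h} g)"
        by (subst sum.reindex) (auto simp: inj_on_def)
      also have "\<dots> = (\<Sum>h\<in>S. if g = h then f g else 0)"
        by (rule sum.cong) (auto simp: indicator_def)
      also have "\<dots> = f g" using S(1) by (simp add: S_def)
      finally show "f g = (\<Sum>U\<in>(\<lambda>g. {g}) ` S. f (the_elem U) * indicator U g)" by simp
    qed
    then show ?thesis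
      using groupoid_algebra_carrierI[of "(\<lambda>g. {g}) ` S" "\<lambda>U. f (the_elem U)" R] S point by auto
  qed
  ultimately have "carrier (groupoid_algebra R G) = carrier (finite_support_algebra R G)" by blast
  then show ?thesis unfolding finite_support_algebra_def by (simp add: groupoid_algebra_def)
qed

section \<open>Local semisimplicity forces discreteness\<close>

text \<open>
  Either \<open>v\<close> vanishes on the arrows with range near \<open>x\<close>, or its support is finite.
  If it does not vanish there, \<open>v\<close> is a left multiple of its restriction to arrows with range in
  \<open>V\<close>, for each small \<open>V\<close> around \<open>x\<close>, and convolution from the left
  does not create new sources. Hence each source in the support is the source of one of the finitely
  many arrows with range \<open>x\<close> in the bisections that cover the support.
\<close>

lemma simple_element_locally_finite:
  fixes R :: "'r::comm_ring_1 itself"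
  assumes U: "compact_open_bisection G U" "U \<subseteq> units G" "x \<in> U"
    and e: "(indicator U :: 'g \<Rightarrow> 'r) \<in> idempotents (groupoid_algebra R G)"
    and v: "v \<in> simple_elements (corner_ring (groupoid_algebra R G) (indicator U))"
  shows "\<exists>V. compact_open_bisection G V \<and> x \<in> V \<and> finite {g. rng G g \<in> V \<and> v g \<noteq> 0}"
proof (cases "\<exists>V. compact_open_bisection G V \<and> x \<in> V \<and> V \<subseteq> U \<and> (\<forall>g. rng G g \<in> V \<longrightarrow> v g = 0)")
  case True
  then obtain V where V: "compact_open_bisection G V" "x \<in> V" "\<forall>g. rng G g \<in> V \<longrightarrow> v g = 0" by blast
  then have "{g. rng G g \<in> V \<and> v g \<noteq> 0} = {}" by blast
  then show ?thesis using V by (metis finite.emptyI)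
next
  case False
  let ?A = "groupoid_algebra R G"
  let ?C = "corner_ring ?A (indicator U)"
  interpret A: nonunital_ring ?A by (rule groupoid_algebra_nonunital_ring)
  note c = A.corner_carrier_iff[OF e]
  have vC: "v \<in> carrier ?C" using v by (simp add: simple_elements_iff)
  then have vA: "v \<in> carrier ?A" and ve: "convolution G (indicator U) v = v" by (simp_all add: c)
  have vsf: "v \<in> source_finite G" using vA by (rule groupoid_algebra_source_finite)
  have Ua: "U \<subseteq> arrows G" using U by (simp add: compact_open_bisectionD)
  obtain \<U> where \<U>: "finite \<U>" "\<And>W. W \<in> \<U> \<Longrightarrow> compact_open_bisection G W"
    "{g. v g \<noteq> 0} \<subseteq> \<Union>\<U>" using vA by (rule groupoid_algebra_support_cover) blast
  note W = compact_open_bisectionD[OF \<U>(2)]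
  have supp: "g \<in> \<Union>\<U>" if "v g \<noteq> 0" for g using \<U>(3) that by auto
  have fibre: "finite {h \<in> \<Union>\<U>. dsrc G h = y}" "finite {h \<in> \<Union>\<U>. rng G h = y}" for y
  proof -
    have "finite {h \<in> W. dsrc G h = y}" "finite {h \<in> W. rng G h = y}" if "W \<in> \<U>" for W
    proof -
      have "inj_on (dsrc G) {h \<in> W. dsrc G h = y}" "inj_on (rng G) {h \<in> W. rng G h = y}"
        using W(3,4)[OF that] by (auto elim: inj_on_subset)
      then show "finite {h \<in> W. dsrc G h = y}" "finite {h \<in> W. rng G h = y}"
        using inj_on_finite[of "dsrc G" _ "{y}"] inj_on_finite[of "rng G" _ "{y}"] by auto
    qed
    moreover have "{h \<in> \<Union>\<U>. dsrc G h = y} = (\<Union>W\<in>\<U>. {h \<in> W. dsrc G h = y})"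
      "{h \<in> \<Union>\<U>. rng G h = y} = (\<Union>W\<in>\<U>. {h \<in> W. rng G h = y})" by auto
    ultimately show "finite {h \<in> \<Union>\<U>. dsrc G h = y}" "finite {h \<in> \<Union>\<U>. rng G h = y}"
      using \<U>(1) by simp_all
  qed
  have common_source: "\<exists>h\<in>\<Union>\<U>. rng G h = x \<and> dsrc G h = dsrc G g" if g: "v g \<noteq> 0" for g
  proof (rule ccontr)
    assume none: "\<not> ?thesis"
    (* If no covering arrow with the source of g ends at x, then V can avoid all their ranges. *)
    define F where "F = rng G ` {h \<in> \<Union>\<U>. dsrc G h = dsrc G g}"
    have "finite F" "x \<notin> F" using fibre none by (auto simp: F_def)
    have Funits: "F \<subseteq> units G" using W(5) by (auto simp: F_def intro!: rng_unit)
    have "closedin (unit_space G) F"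
      using Hausdorff_units \<open>finite F\<close> Funits units_open openin_subset
      by (intro closedin_Hausdorff_finite) (auto simp: unit_arrow)
    moreover have "openin (unit_space G) U"
      using compact_open_bisectionD(1)[OF U(1)] U(2) units_open by (simp add: openin_open_subtopology)
    ultimately have "openin (unit_space G) (U - F)" by (rule openin_diff[rotated])
    then have "openin (gtop G) (U - F)" using units_open by (simp add: openin_open_subtopology)
    moreover have "x \<in> U - F" using U(3) \<open>x \<notin> F\<close> by simp
    ultimately obtain V where V: "compact_open_bisection G V" "x \<in> V" "V \<subseteq> U - F"
      by (rule compact_open_bisection_nbhd)
    have Vu: "V \<subseteq> units G" using V U(2) by blast
    have VA: "indicator V \<in> carrier ?A" using V(1) by (rule indicator_in_algebra)
    have "rng G y \<in> U \<and> dsrc G y \<in> U" if "y \<in> V" for y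
      using unit_arrow(2,3)[OF subsetD[OF Vu that]] subsetD[OF V(3) that] by simp
    then have VC: "indicator V \<in> carrier ?C"
      unfolding c using VA
        convolution_indicator_left[OF U(2) groupoid_algebra_source_finite[OF VA]]
        convolution_indicator_right[OF U(2) groupoid_algebra_source_finite[OF VA]]
      by (auto simp: fun_eq_iff indicator_def)
    have Vv: "convolution G (indicator V) v = (\<lambda>g. if rng G g \<in> V then v g else 0)"
      using Vu vsf by (rule convolution_indicator_left)
    have "\<not> (\<forall>g. rng G g \<in> V \<longrightarrow> v g = 0)" using False V by blast
    then have "indicator V \<otimes>\<^bsub>?C\<^esub> v \<noteq> \<zero>\<^bsub>?C\<^esub>" by (auto simp: Vv fun_eq_iff)
    then have "\<exists>b\<in>carrier ?C. b \<otimes>\<^bsub>?C\<^esub> (indicator V \<otimes>\<^bsub>?C\<^esub> v) = v"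
      using v VC unfolding simple_elements_iff by blast
    then obtain b where "convolution G b (convolution G (indicator V) v) = v" by auto
    then have "convolution G b (convolution G (indicator V) v) g \<noteq> 0" using g by simp
    then obtain h where h: "h \<in> arrows G" "dsrc G h = dsrc G g" "convolution G (indicator V) v h \<noteq> 0"
      by (rule convolution_nonzeroE)
    then have "rng G h \<in> V" "h \<in> \<Union>\<U>" using supp by (auto simp: Vv split: if_splits)
    then show False using V(3) h(2) by (auto simp: F_def)
  qed
  have "{g. v g \<noteq> 0} \<subseteq> (\<Union>h\<in>{h \<in> \<Union>\<U>. rng G h = x}. {g \<in> \<Union>\<U>. dsrc G g = dsrc G h})"
  proof
    fix g assume "g \<in> {g. v g \<noteq> 0}"
    then have "v g \<noteq> 0" by simp
    then obtain h where "h \<in> \<Union>\<U>" "rng G h = x" "dsrc G h = dsrc G g" "g \<in> \<Union>\<U>"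
      using common_source[of g] supp[of g] by blast
    then show "g \<in> (\<Union>h\<in>{h \<in> \<Union>\<U>. rng G h = x}. {g \<in> \<Union>\<U>. dsrc G g = dsrc G h})"
      by (intro UN_I[of h]) simp_all
  qed
  moreover have "finite (\<Union>h\<in>{h \<in> \<Union>\<U>. rng G h = x}. {g \<in> \<Union>\<U>. dsrc G g = dsrc G h})"
    by (intro finite_UN_I fibre)
  ultimately have "finite {g. v g \<noteq> 0}" by (rule finite_subset)
  then have "finite {g. rng G g \<in> U \<and> v g \<noteq> 0}" by (rule rev_finite_subset) auto
  then show ?thesis using U by blast
qed

text \<open>
  The characteristic function of \<open>U\<close> is a sum of simple elements of its corner, so it has
  finite support on the arrows with range in some neighbourhood \<open>V\<close> of \<open>x\<close>. This
  support contains \<open>U \<inter> V\<close>, and a finite open set in a Hausdorff space is discrete.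
\<close>

lemma locally_semisimple_imp_unit_isolated:
  fixes R :: "'r::comm_ring_1 itself"
  assumes ss: "locally_semisimple_ring (groupoid_algebra R G)" and x: "x \<in> units G"
  shows "openin (gtop G) {x}"
proof -
  let ?A = "groupoid_algebra R G"
  obtain U where U: "compact_open_bisection G U" "x \<in> U" "U \<subseteq> units G"
    using compact_open_bisection_nbhd[OF units_open x] by blast
  let ?e = "indicator U :: 'g \<Rightarrow> 'r"
  let ?C = "corner_ring ?A ?e"
  interpret A: nonunital_ring ?A by (rule groupoid_algebra_nonunital_ring)
  have eA: "?e \<in> carrier ?A" using U(1) by (rule indicator_in_algebra)
  have "convolution G ?e ?e = ?e"
    using convolution_indicator_left[OF U(3) groupoid_algebra_source_finite[OF eA]] unit_arrow U(3)
    by (auto simp: fun_eq_iff indicator_def)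
  then have e: "?e \<in> idempotents ?A" using eA by (simp add: idempotents_def)
  have "?e \<in> carrier ?C" using e A.corner_carrier_iff[OF e] by (simp add: idempotents_def)
  moreover have "semisimple_ring ?C" using ss e by (simp add: locally_semisimple_ring_def)
  ultimately have "?e \<in> ring_socle ?C" by (auto simp: semisimple_ring_iff_socle)
  moreover have "\<exists>V. compact_open_bisection G V \<and> x \<in> V \<and> finite {g. rng G g \<in> V \<and> f g \<noteq> 0}"
    if "f \<in> ring_socle ?C" for f
    using that
  proof induct
    case zero
    show ?case using U by (intro exI[of _ U]) simp
  next
    case (add v f)
    obtain V where V: "compact_open_bisection G V" "x \<in> V" "finite {g. rng G g \<in> V \<and> v g \<noteq> 0}"
      using simple_element_locally_finite[OF U(1,3,2) e add(1)] by blast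
    obtain V' where V': "compact_open_bisection G V'" "x \<in> V'" "finite {g. rng G g \<in> V' \<and> f g \<noteq> 0}"
      using add(3) by blast
    have "openin (gtop G) (V \<inter> V')" "x \<in> V \<inter> V'"
      using V V' compact_open_bisectionD(1) by auto
    then obtain W where W: "compact_open_bisection G W" "x \<in> W" "W \<subseteq> V \<inter> V'"
      by (rule compact_open_bisection_nbhd)
    have "{g. rng G g \<in> W \<and> v g + f g \<noteq> 0} \<subseteq>
        {g. rng G g \<in> V \<and> v g \<noteq> 0} \<union> {g. rng G g \<in> V' \<and> f g \<noteq> 0}" using W(3) by auto
    then have "finite {g. rng G g \<in> W \<and> v g + f g \<noteq> 0}"
      using V(3) V'(3) by (meson finite_UnI finite_subset)
    then show ?case using W by (intro exI[of _ W]) simp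
  qed
  ultimately obtain V where V: "compact_open_bisection G V" "x \<in> V"
    "finite {g. rng G g \<in> V \<and> ?e g \<noteq> 0}" by blast
  define N where "N = U \<inter> V"
  have "N \<subseteq> {g. rng G g \<in> V \<and> ?e g \<noteq> 0}"
    using U(3) unit_arrow(3) by (auto simp: N_def indicator_def subset_iff)
  then have fin: "finite N" using V(3) by (rule finite_subset)
  have Nu: "N \<subseteq> units G" using U(3) by (auto simp: N_def)
  have "openin (gtop G) N"
    unfolding N_def using U V compact_open_bisectionD(1) by (intro openin_Int) auto
  then have "openin (unit_space G) N" using Nu units_open by (simp add: openin_open_subtopology)
  moreover have "closedin (unit_space G) (N - {x})"
    using Hausdorff_units fin Nu by (intro closedin_Hausdorff_finite) (auto simp: unit_arrow)
  ultimately have "openin (unit_space G) (N - (N - {x}))" by (rule openin_diff)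
  moreover have "N - (N - {x}) = {x}" using U V by (auto simp: N_def)
  ultimately show ?thesis using units_open by (simp add: openin_open_subtopology)
qed

text \<open>
  Isolated units suffice, since an arrow is determined by its source within a bisection.
\<close>

theorem locally_semisimple_imp_discrete:
  fixes R :: "'r::comm_ring_1 itself"
  assumes "locally_semisimple_ring (groupoid_algebra R G)"
  shows "discrete_groupoid G"
proof -
  have "openin (gtop G) {g}" if g: "g \<in> arrows G" for g
  proof -
    obtain U where U: "compact_open_bisection G U" "g \<in> U"
      using compact_open_bisection_nbhd[of "arrows G" g] g openin_topspace[of "gtop G"] by auto
    have "openin (gtop G) {dsrc G g}"
      by (rule locally_semisimple_imp_unit_isolated[OF assms dsrc_unit[OF g]])
    then have "openin (unit_space G) {dsrc G g}"
      using units_open dsrc_unit[OF g] by (simp add: openin_open_subtopology)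
    then have "openin (gtop G) {h \<in> topspace (gtop G). dsrc G h \<in> {dsrc G g}}"
      by (rule openin_continuous_map_preimage[OF dsrc_continuous])
    then have "openin (gtop G) (U \<inter> {h \<in> topspace (gtop G). dsrc G h \<in> {dsrc G g}})"
      using compact_open_bisectionD(1)[OF U(1)] by (rule openin_Int[rotated])
    moreover have "U \<inter> {h \<in> topspace (gtop G). dsrc G h \<in> {dsrc G g}} = {g}"
      using U g inj_onD[OF compact_open_bisectionD(3)[OF U(1)]] by auto
    ultimately show ?thesis by simp
  qed
  then have "discrete_topology (arrows G) = gtop G" by (simp add: discrete_topology_unique)
  then show ?thesis by (simp add: discrete_groupoid_def)
qed

end

section \<open>Decomposition into matrix algebras\<close>

lemma direct_sum_algebra_simps [simp]:
  "mult (direct_sum_algebra J A) = (\<lambda>f g. \<lambda>j\<in>J. f j \<otimes>\<^bsub>A j\<^esub> g j)"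
  "add (direct_sum_algebra J A) = (\<lambda>f g. \<lambda>j\<in>J. f j \<oplus>\<^bsub>A j\<^esub> g j)"
  "smult (direct_sum_algebra J A) = (\<lambda>r f. \<lambda>j\<in>J. r \<odot>\<^bsub>A j\<^esub> f j)"
  "carrier (direct_sum_algebra J A)
    = {f \<in> (\<Pi>\<^sub>E j\<in>J. carrier (A j)). finite {j \<in> J. f j \<noteq> \<zero>\<^bsub>A j\<^esub>}}"
  by (simp_all add: direct_sum_algebra_def)

lemma matrix_algebra_simps [simp]:
  "mult (matrix_algebra X S)
    = (\<lambda>M N i k. \<Oplus>\<^bsub>S\<^esub>j\<in>{j \<in> X. M i j \<noteq> \<zero>\<^bsub>S\<^esub>}. M i j \<otimes>\<^bsub>S\<^esub> N j k)"
  "zero (matrix_algebra X S) = (\<lambda>i j. \<zero>\<^bsub>S\<^esub>)"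
  "add (matrix_algebra X S) = (\<lambda>M N i j. M i j \<oplus>\<^bsub>S\<^esub> N i j)"
  "smult (matrix_algebra X S) = (\<lambda>r M i j. r \<odot>\<^bsub>S\<^esub> M i j)"
  by (simp_all add: matrix_algebra_def)

lemma matrix_carrier:
  "M \<in> carrier (matrix_algebra X S) \<longleftrightarrow>
     (\<forall>i j. M i j \<in> carrier S) \<and> (\<forall>i j. i \<notin> X \<or> j \<notin> X \<longrightarrow> M i j = \<zero>\<^bsub>S\<^esub>) \<and>
     finite {(i, j). M i j \<noteq> \<zero>\<^bsub>S\<^esub>}"
  by (simp add: matrix_algebra_def)

lemma finsum_pointwise:
  fixes A :: "('k \<Rightarrow> 'r::comm_ring_1, 'm) ring_scheme"
  assumes "abelian_group A" and ops: "add A = (\<lambda>f1 f2 g. f1 g + f2 g)" "zero A = (\<lambda>g. 0)"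
    and "finite W" "F \<in> W \<rightarrow> carrier A"
  shows "finsum A F W k = (\<Sum>w\<in>W. F w k)"
proof -
  interpret abelian_group A by fact
  show ?thesis
    using assms(4,5)
  proof induct
    case empty then show ?case by (simp add: ops)
  next
    case (insert w W)
    then have "finsum A F (insert w W) = F w \<oplus>\<^bsub>A\<^esub> finsum A F W"
      by (intro finsum_insert) auto
    then show ?case using insert by (simp add: ops)
  qed
qed

locale groupoid_representatives = groupoid G for G :: "('g, 'm) top_groupoid_scheme" +
  fixes J :: "'j set" and x :: "'j \<Rightarrow> 'g"
  assumes representatives: "orbit_representatives G J x"
begin

lemma representative_unit: "\<alpha> \<in> J \<Longrightarrow> x \<alpha> \<in> units G"
  using representatives by (simp add: orbit_representatives_def)

definition orbit_index :: "'g \<Rightarrow> 'j" where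
  "orbit_index y = (THE \<alpha>. \<alpha> \<in> J \<and> y \<in> orbit G (x \<alpha>))"

definition section_arrow :: "'g \<Rightarrow> 'g" where
  "section_arrow y = (SOME t. t \<in> arrows G \<and> dsrc G t = x (orbit_index y) \<and> rng G t = y)"

lemma orbit_index:
  assumes "y \<in> units G" shows "orbit_index y \<in> J" "y \<in> orbit G (x (orbit_index y))"
proof -
  have "\<exists>!\<alpha>. \<alpha> \<in> J \<and> y \<in> orbit G (x \<alpha>)"
    using representatives assms by (simp add: orbit_representatives_def)
  from theI'[OF this] show "orbit_index y \<in> J" "y \<in> orbit G (x (orbit_index y))"
    by (simp_all add: orbit_index_def)
qed

lemma orbit_index_eq:
  assumes "\<alpha> \<in> J" "y \<in> orbit G (x \<alpha>)" shows "orbit_index y = \<alpha>"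
proof -
  have y: "y \<in> units G" using assms(2) by (simp add: orbit_def)
  have "\<exists>!\<alpha>. \<alpha> \<in> J \<and> y \<in> orbit G (x \<alpha>)"
    using representatives y by (simp add: orbit_representatives_def)
  then show ?thesis using assms orbit_index[OF y] by blast
qed

lemma section_arrow:
  assumes "y \<in> units G"
  shows "section_arrow y \<in> arrows G" "dsrc G (section_arrow y) = x (orbit_index y)"
    "rng G (section_arrow y) = y"
proof -
  have "\<exists>t. t \<in> arrows G \<and> dsrc G t = x (orbit_index y) \<and> rng G t = y"
    using orbit_index(2)[OF assms] by (auto simp: orbit_def)
  from someI_ex[OF this] show "section_arrow y \<in> arrows G"
    "dsrc G (section_arrow y) = x (orbit_index y)" "rng G (section_arrow y) = y"
    by (simp_all add: section_arrow_def)
qed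

lemma orbit_index_arrow:
  assumes "g \<in> arrows G" shows "orbit_index (dsrc G g) = orbit_index (rng G g)"
proof -
  note s = section_arrow[OF dsrc_unit[OF assms]]
  have "gcomp G g (section_arrow (dsrc G g)) \<in> arrows G"
    "dsrc G (gcomp G g (section_arrow (dsrc G g))) = x (orbit_index (dsrc G g))"
    "rng G (gcomp G g (section_arrow (dsrc G g))) = rng G g"
    using assms s by (simp_all add: arrow_simps)
  then have "rng G g \<in> orbit G (x (orbit_index (dsrc G g)))"
    using assms rng_unit by (auto simp: orbit_def)
  then show ?thesis using orbit_index_eq orbit_index(1)[OF dsrc_unit[OF assms]] by metis
qed

text \<open>
  An arrow corresponds to its range \<open>y\<close>, its source \<open>z\<close> and an element
  \<open>k\<close> of the isotropy group at the representative of their orbit.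
\<close>

definition arrow_of :: "'g \<Rightarrow> 'g \<Rightarrow> 'g \<Rightarrow> 'g" where
  "arrow_of y z k = gcomp G (section_arrow y) (gcomp G k (ginv G (section_arrow z)))"

definition isotropy_part :: "'g \<Rightarrow> 'g" where
  "isotropy_part g = gcomp G (ginv G (section_arrow (rng G g))) (gcomp G g (section_arrow (dsrc G g)))"

abbreviation isotropy :: "'j \<Rightarrow> 'g set" where
  "isotropy \<alpha> \<equiv> carrier (isotropy_group G (x \<alpha>))"

lemma arrow_of:
  assumes "\<alpha> \<in> J" "y \<in> orbit G (x \<alpha>)" "z \<in> orbit G (x \<alpha>)" "k \<in> isotropy \<alpha>"
  shows "arrow_of y z k \<in> arrows G" "dsrc G (arrow_of y z k) = z" "rng G (arrow_of y z k) = y"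
    "isotropy_part (arrow_of y z k) = k"
proof -
  let ?t = "section_arrow y" and ?s = "section_arrow z"
  have u: "y \<in> units G" "z \<in> units G" using assms by (simp_all add: orbit_def)
  have idx: "orbit_index y = \<alpha>" "orbit_index z = \<alpha>" using assms orbit_index_eq by auto
  note t = section_arrow[OF u(1), unfolded idx] and s = section_arrow[OF u(2), unfolded idx]
  have k: "k \<in> arrows G" "dsrc G k = x \<alpha>" "rng G k = x \<alpha>" using assms by auto
  show a: "arrow_of y z k \<in> arrows G" "dsrc G (arrow_of y z k) = z" "rng G (arrow_of y z k) = y"
    using t s k by (simp_all add: arrow_of_def arrow_simps)
  have "gcomp G (arrow_of y z k) ?s = gcomp G ?t (gcomp G (gcomp G k (ginv G ?s)) ?s)"
    using t s k by (simp add: arrow_of_def gcomp_assoc arrow_simps)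
  also have "gcomp G (gcomp G k (ginv G ?s)) ?s = k"
    using s k by (intro gcomp_ginv_cancel') simp_all
  finally have "isotropy_part (arrow_of y z k) = gcomp G (ginv G ?t) (gcomp G ?t k)"
    using a by (simp add: isotropy_part_def)
  then show "isotropy_part (arrow_of y z k) = k" using t k by (simp add: ginv_gcomp_cancel)
qed

lemma isotropy_part:
  assumes g: "g \<in> arrows G"
  shows "isotropy_part g \<in> isotropy (orbit_index (rng G g))"
    "arrow_of (rng G g) (dsrc G g) (isotropy_part g) = g"
    "rng G g \<in> orbit G (x (orbit_index (rng G g)))" "dsrc G g \<in> orbit G (x (orbit_index (rng G g)))"
proof -
  let ?t = "section_arrow (rng G g)" and ?s = "section_arrow (dsrc G g)"
  note t = section_arrow[OF rng_unit[OF g]]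
  note s = section_arrow[OF dsrc_unit[OF g], unfolded orbit_index_arrow[OF g]]
  show "isotropy_part g \<in> isotropy (orbit_index (rng G g))"
    using g t s by (simp add: isotropy_part_def arrow_simps)
  have "gcomp G (isotropy_part g) (ginv G ?s)
      = gcomp G (ginv G ?t) (gcomp G (gcomp G g ?s) (ginv G ?s))"
    using g t s by (simp add: isotropy_part_def gcomp_assoc arrow_simps)
  also have "gcomp G (gcomp G g ?s) (ginv G ?s) = g"
    using g s by (intro gcomp_ginv_cancel) simp_all
  finally show "arrow_of (rng G g) (dsrc G g) (isotropy_part g) = g"
    using g t by (simp add: arrow_of_def ginv_gcomp_cancel')
  show "rng G g \<in> orbit G (x (orbit_index (rng G g)))" "dsrc G g \<in> orbit G (x (orbit_index (rng G g)))"
    using orbit_index(2)[OF rng_unit[OF g]] orbit_index(2)[OF dsrc_unit[OF g]]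
      orbit_index_arrow[OF g] by simp_all
qed

text \<open>
  This turns the factor \<open>f1(g h\<^sup>-\<^sup>1)\<close> of the convolution into an entry of a
  matrix product.
\<close>

lemma arrow_of_quotient:
  assumes \<alpha>: "\<alpha> \<in> J" and y: "y \<in> orbit G (x \<alpha>)" and z: "z \<in> orbit G (x \<alpha>)"
    and w: "w \<in> orbit G (x \<alpha>)" and k: "k \<in> isotropy \<alpha>" and l: "l \<in> isotropy \<alpha>"
  shows "gcomp G (arrow_of y z k) (ginv G (arrow_of w z l)) = arrow_of y w (gcomp G k (ginv G l))"
proof -
  let ?t = "section_arrow y" and ?s = "section_arrow z" and ?u = "section_arrow w"
  have un: "y \<in> units G" "z \<in> units G" "w \<in> units G" using y z w by (simp_all add: orbit_def)
  have idx: "orbit_index y = \<alpha>" "orbit_index z = \<alpha>" "orbit_index w = \<alpha>"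
    using \<alpha> y z w orbit_index_eq by auto
  note t = section_arrow[OF un(1), unfolded idx] and s = section_arrow[OF un(2), unfolded idx]
    and u = section_arrow[OF un(3), unfolded idx]
  have kl: "k \<in> arrows G" "dsrc G k = x \<alpha>" "rng G k = x \<alpha>"
    "l \<in> arrows G" "dsrc G l = x \<alpha>" "rng G l = x \<alpha>" using k l by auto
  have "ginv G (arrow_of w z l) = gcomp G ?s (gcomp G (ginv G l) (ginv G ?u))"
    using s u kl by (simp add: arrow_of_def ginv_gcomp gcomp_assoc arrow_simps)
  then have "gcomp G (arrow_of y z k) (ginv G (arrow_of w z l))
      = gcomp G ?t (gcomp G k (gcomp G (ginv G ?s) (gcomp G ?s (gcomp G (ginv G l) (ginv G ?u)))))"
    using t s u kl by (simp add: arrow_of_def gcomp_assoc arrow_simps)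
  also have "gcomp G (ginv G ?s) (gcomp G ?s (gcomp G (ginv G l) (ginv G ?u)))
      = gcomp G (ginv G l) (ginv G ?u)"
    using s u kl by (intro ginv_gcomp_cancel) (simp_all add: arrow_simps)
  also have "gcomp G ?t (gcomp G k (gcomp G (ginv G l) (ginv G ?u))) = arrow_of y w (gcomp G k (ginv G l))"
    using t u kl by (simp add: arrow_of_def gcomp_assoc arrow_simps)
  finally show ?thesis .
qed

definition matrix_map :: "('g \<Rightarrow> 'r::comm_ring_1) \<Rightarrow> 'j \<Rightarrow> 'g \<Rightarrow> 'g \<Rightarrow> 'g \<Rightarrow> 'r" where
  "matrix_map f = (\<lambda>\<alpha>\<in>J. \<lambda>y z k.
     if y \<in> orbit G (x \<alpha>) \<and> z \<in> orbit G (x \<alpha>) \<and> k \<in> isotropy \<alpha> then f (arrow_of y z k) else 0)"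

definition matrix_map_inverse :: "('j \<Rightarrow> 'g \<Rightarrow> 'g \<Rightarrow> 'g \<Rightarrow> 'r::comm_ring_1) \<Rightarrow> 'g \<Rightarrow> 'r" where
  "matrix_map_inverse F g = (if g \<in> arrows G
     then F (orbit_index (rng G g)) (rng G g) (dsrc G g) (isotropy_part g) else 0)"

abbreviation matrix_sum :: "'r::comm_ring_1 itself \<Rightarrow> ('r, 'j \<Rightarrow> 'g \<Rightarrow> 'g \<Rightarrow> 'g \<Rightarrow> 'r) module" where
  "matrix_sum R \<equiv> direct_sum_algebra J
     (\<lambda>\<alpha>. matrix_algebra (orbit G (x \<alpha>)) (group_algebra R (isotropy_group G (x \<alpha>))))"

lemma matrix_map_nonzeroE:
  assumes "matrix_map f \<alpha> y z k \<noteq> 0" "\<alpha> \<in> J"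
  obtains g where "f g \<noteq> 0" "g \<in> arrows G" "\<alpha> = orbit_index (rng G g)" "y = rng G g" "z = dsrc G g"
    "k = isotropy_part g"
proof -
  have *: "y \<in> orbit G (x \<alpha>)" "z \<in> orbit G (x \<alpha>)" "k \<in> isotropy \<alpha>" "f (arrow_of y z k) \<noteq> 0"
    using assms by (auto simp: matrix_map_def split: if_splits)
  note a = arrow_of[OF assms(2) *(1,2,3)]
  show ?thesis
    by (rule that[OF *(4) a(1)]) (simp_all only: a orbit_index_eq[OF assms(2) *(1)])
qed

lemma matrix_map_carrier:
  fixes R :: "'r::comm_ring_1 itself"
  assumes f: "f \<in> carrier (finite_support_algebra R G)"
  shows "matrix_map f \<in> carrier (matrix_sum R)"
proof -
  let ?S = "{g. f g \<noteq> 0}"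
  have fin: "finite ?S" using f by (simp add: finite_support_carrier)
  have entry: "finite {k. matrix_map f \<alpha> y z k \<noteq> 0}" if "\<alpha> \<in> J" for \<alpha> y z
    by (rule finite_subset[OF _ finite_imageI[OF fin, of isotropy_part]])
       (use that in \<open>auto elim: matrix_map_nonzeroE\<close>)
  have supp: "k \<in> isotropy \<alpha>" if "\<alpha> \<in> J" "matrix_map f \<alpha> y z k \<noteq> 0" for \<alpha> y z k
    using that by (auto simp: matrix_map_def split: if_splits)
  have positions: "finite {(y, z). matrix_map f \<alpha> y z \<noteq> (\<lambda>k. 0)}" if "\<alpha> \<in> J" for \<alpha>
    by (rule finite_subset[OF _ finite_imageI[OF fin, of "\<lambda>g. (rng G g, dsrc G g)"]])
       (use that in \<open>auto simp: fun_eq_iff elim!: matrix_map_nonzeroE\<close>)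
  have blocks: "finite {\<alpha> \<in> J. matrix_map f \<alpha> \<noteq> (\<lambda>y z k. 0)}"
    by (rule finite_subset[OF _ finite_imageI[OF fin, of "\<lambda>g. orbit_index (rng G g)"]])
       (auto simp: fun_eq_iff elim!: matrix_map_nonzeroE)
  have "matrix_map f \<alpha> \<in> carrier (matrix_algebra (orbit G (x \<alpha>)) (group_algebra R (isotropy_group G (x \<alpha>))))"
    if \<alpha>: "\<alpha> \<in> J" for \<alpha>
    unfolding matrix_carrier
  proof (intro conjI allI impI)
    fix y z
    show "matrix_map f \<alpha> y z \<in> carrier (group_algebra R (isotropy_group G (x \<alpha>)))"
      using entry[OF \<alpha>] supp[OF \<alpha>] by (auto simp del: isotropy_group_simps)
    show "matrix_map f \<alpha> y z = \<zero>\<^bsub>group_algebra R (isotropy_group G (x \<alpha>))\<^esub>"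
      if "y \<notin> orbit G (x \<alpha>) \<or> z \<notin> orbit G (x \<alpha>)"
      using that \<alpha> by (auto simp: matrix_map_def fun_eq_iff)
  next
    show "finite {(y, z). matrix_map f \<alpha> y z \<noteq> \<zero>\<^bsub>group_algebra R (isotropy_group G (x \<alpha>))\<^esub>}"
      using positions[OF \<alpha>] by simp
  qed
  then show ?thesis using blocks by (auto simp: matrix_map_def)
qed

lemma matrix_sum_entryD:
  fixes R :: "'r::comm_ring_1 itself"
  assumes F: "F \<in> carrier (matrix_sum R)" and \<alpha>: "\<alpha> \<in> J"
  shows "F \<alpha> y z k \<noteq> 0 \<Longrightarrow> y \<in> orbit G (x \<alpha>) \<and> z \<in> orbit G (x \<alpha>) \<and> k \<in> isotropy \<alpha>"
    "finite {k. F \<alpha> y z k \<noteq> 0}" "finite {(y, z). F \<alpha> y z \<noteq> (\<lambda>k. 0)}"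
proof -
  have M: "F \<alpha> \<in> carrier (matrix_algebra (orbit G (x \<alpha>)) (group_algebra R (isotropy_group G (x \<alpha>))))"
    using F \<alpha> by auto
  then have "F \<alpha> y z \<in> carrier (group_algebra R (isotropy_group G (x \<alpha>)))"
    unfolding matrix_carrier by blast
  then have e: "finite {k. F \<alpha> y z k \<noteq> 0}" "{k. F \<alpha> y z k \<noteq> 0} \<subseteq> isotropy \<alpha>" by simp_all
  show "finite {k. F \<alpha> y z k \<noteq> 0}" by (rule e(1))
  have out: "y \<notin> orbit G (x \<alpha>) \<or> z \<notin> orbit G (x \<alpha>) \<longrightarrow> F \<alpha> y z = (\<lambda>k. 0)"
    and fin: "finite {(y, z). F \<alpha> y z \<noteq> (\<lambda>k. 0)}"
    using M unfolding matrix_carrier by simp_all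
  show "finite {(y, z). F \<alpha> y z \<noteq> (\<lambda>k. 0)}" by (rule fin)
  assume "F \<alpha> y z k \<noteq> 0"
  then show "y \<in> orbit G (x \<alpha>) \<and> z \<in> orbit G (x \<alpha>) \<and> k \<in> isotropy \<alpha>" using e(2) out by force
qed

lemma matrix_map_inverse_carrier:
  fixes R :: "'r::comm_ring_1 itself"
  assumes F: "F \<in> carrier (matrix_sum R)"
  shows "matrix_map_inverse F \<in> carrier (finite_support_algebra R G)"
proof -
  define J' where "J' = {\<alpha> \<in> J. F \<alpha> \<noteq> (\<lambda>y z k. 0)}"
  have fin: "finite J'" using F by (simp add: J'_def)
  define S where "S = (\<Union>\<alpha>\<in>J'. \<Union>(y, z)\<in>{(y, z). F \<alpha> y z \<noteq> (\<lambda>k. 0)}.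
    arrow_of y z ` {k. F \<alpha> y z k \<noteq> 0})"
  have "finite S"
    unfolding S_def using fin matrix_sum_entryD(2,3)[OF F] by (fastforce simp: J'_def)
  moreover have "{g. matrix_map_inverse F g \<noteq> 0} \<subseteq> S"
  proof
    fix g assume "g \<in> {g. matrix_map_inverse F g \<noteq> 0}"
    then have g: "g \<in> arrows G"
      and ne: "F (orbit_index (rng G g)) (rng G g) (dsrc G g) (isotropy_part g) \<noteq> 0"
      by (auto simp: matrix_map_inverse_def split: if_splits)
    have "orbit_index (rng G g) \<in> J'"
      using ne orbit_index(1)[OF rng_unit[OF g]] unfolding J'_def by fastforce
    moreover have "(rng G g, dsrc G g) \<in> {(y, z). F (orbit_index (rng G g)) y z \<noteq> (\<lambda>k. 0)}"
      using ne by fastforce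
    moreover have "g \<in> arrow_of (rng G g) (dsrc G g) `
        {k. F (orbit_index (rng G g)) (rng G g) (dsrc G g) k \<noteq> 0}"
      using ne isotropy_part(2)[OF g] by (intro image_eqI[of _ _ "isotropy_part g"]) simp_all
    ultimately show "g \<in> S" unfolding S_def by blast
  qed
  ultimately show ?thesis
    by (auto simp: finite_support_carrier matrix_map_inverse_def intro: finite_subset split: if_splits)
qed

lemma matrix_map_bij:
  fixes R :: "'r::comm_ring_1 itself"
  shows "bij_betw matrix_map (carrier (finite_support_algebra R G)) (carrier (matrix_sum R))"
proof (rule bij_betw_byWitness[where f' = matrix_map_inverse])
  show "\<forall>f\<in>carrier (finite_support_algebra R G). matrix_map_inverse (matrix_map f) = f"
  proof (intro ballI ext)
    fix f :: "'g \<Rightarrow> 'r" and g assume f: "f \<in> carrier (finite_support_algebra R G)"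
    show "matrix_map_inverse (matrix_map f) g = f g"
    proof (cases "g \<in> arrows G")
      case True
      then show ?thesis
        using isotropy_part[OF True] orbit_index(1)[OF rng_unit[OF True]]
        by (simp add: matrix_map_inverse_def matrix_map_def)
    next
      case False then show ?thesis using f by (auto simp: matrix_map_inverse_def finite_support_carrier)
    qed
  qed
  show "\<forall>F\<in>carrier (matrix_sum R). matrix_map (matrix_map_inverse F) = F"
  proof (intro ballI ext)
    fix F :: "'j \<Rightarrow> 'g \<Rightarrow> 'g \<Rightarrow> 'g \<Rightarrow> 'r" and \<alpha> y z k
    assume F: "F \<in> carrier (matrix_sum R)"
    show "matrix_map (matrix_map_inverse F) \<alpha> y z k = F \<alpha> y z k"
    proof (cases "\<alpha> \<in> J")
      case \<alpha>: True
      show ?thesis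
      proof (cases "y \<in> orbit G (x \<alpha>) \<and> z \<in> orbit G (x \<alpha>) \<and> k \<in> isotropy \<alpha>")
        case True
        then show ?thesis
          using arrow_of[OF \<alpha>, of y z k] orbit_index_eq[OF \<alpha>, of y] \<alpha>
          by (simp add: matrix_map_inverse_def matrix_map_def del: isotropy_group_simps)
      next
        case False
        then show ?thesis using matrix_sum_entryD(1)[OF F \<alpha>, of y z k] \<alpha>
          by (auto simp: matrix_map_def simp del: isotropy_group_simps)
      qed
    next
      case False
      then have "F \<alpha> = undefined" using F by (auto simp: PiE_iff extensional_def)
      then show ?thesis using False by (simp add: matrix_map_def)
    qed
  qed
qed (use matrix_map_carrier matrix_map_inverse_carrier in blast)+

lemma group_algebra_mult_apply:
  assumes y: "y \<in> units G" and k: "k \<in> carrier (isotropy_group G y)"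
  shows "(f1 \<otimes>\<^bsub>group_algebra R (isotropy_group G y)\<^esub> f2) k
    = (\<Sum>l\<in>{l \<in> carrier (isotropy_group G y). f2 l \<noteq> 0}. f1 (gcomp G k (ginv G l)) * f2 l)"
  using k isotropy_group_inv[OF y] by (auto simp: group_algebra_def intro!: sum.cong)

text \<open>
  The intermediate index \<open>w\<close> of the matrix product is the range of the arrow
  \<open>h\<close> in the convolution, and the isotropy part of \<open>h\<close> is the summation index
  in the group ring.
\<close>

lemma matrix_map_mult_entry:
  fixes R :: "'r::comm_ring_1 itself"
  assumes f1: "f1 \<in> carrier (finite_support_algebra R G)" and f2: "f2 \<in> carrier (finite_support_algebra R G)"
    and \<alpha>: "\<alpha> \<in> J" and y: "y \<in> orbit G (x \<alpha>)" and z: "z \<in> orbit G (x \<alpha>)"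
    and w: "w \<in> orbit G (x \<alpha>)" and k: "k \<in> isotropy \<alpha>"
  shows "(matrix_map f1 \<alpha> y w \<otimes>\<^bsub>group_algebra R (isotropy_group G (x \<alpha>))\<^esub> matrix_map f2 \<alpha> w z) k
    = (\<Sum>h\<in>{h \<in> {h \<in> arrows G. dsrc G h = z \<and> f2 h \<noteq> 0}. rng G h = w}.
        f1 (gcomp G (arrow_of y z k) (ginv G h)) * f2 h)"
proof -
  have xu: "x \<alpha> \<in> units G" using \<alpha> by (rule representative_unit)
  have closed: "gcomp G k (ginv G l) \<in> isotropy \<alpha>" if "l \<in> isotropy \<alpha>" for l
    using k that by (auto simp: arrow_simps)
  have "(matrix_map f1 \<alpha> y w \<otimes>\<^bsub>group_algebra R (isotropy_group G (x \<alpha>))\<^esub> matrix_map f2 \<alpha> w z) k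
      = (\<Sum>l\<in>{l \<in> isotropy \<alpha>. matrix_map f2 \<alpha> w z l \<noteq> 0}.
          matrix_map f1 \<alpha> y w (gcomp G k (ginv G l)) * matrix_map f2 \<alpha> w z l)"
    using xu k by (rule group_algebra_mult_apply)
  also have "\<dots> = (\<Sum>l\<in>{l \<in> isotropy \<alpha>. f2 (arrow_of w z l) \<noteq> 0}.
      f1 (gcomp G (arrow_of y z k) (ginv G (arrow_of w z l))) * f2 (arrow_of w z l))"
    using \<alpha> y z w closed arrow_of_quotient[OF \<alpha> y z w k]
    by (intro sum.cong) (auto simp: matrix_map_def simp del: isotropy_group_simps)
  also have "\<dots> = (\<Sum>h\<in>{h \<in> {h \<in> arrows G. dsrc G h = z \<and> f2 h \<noteq> 0}. rng G h = w}.
        f1 (gcomp G (arrow_of y z k) (ginv G h)) * f2 h)"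
  proof (rule sum.reindex_bij_witness[where i = isotropy_part and j = "arrow_of w z"])
    fix h assume "h \<in> {h \<in> {h \<in> arrows G. dsrc G h = z \<and> f2 h \<noteq> 0}. rng G h = w}"
    then have h: "h \<in> arrows G" "dsrc G h = z" "f2 h \<noteq> 0" "rng G h = w" by auto
    show "arrow_of w z (isotropy_part h) = h" using isotropy_part(2)[OF h(1)] h by simp
    then show "isotropy_part h \<in> {l \<in> isotropy \<alpha>. f2 (arrow_of w z l) \<noteq> 0}"
      using isotropy_part(1)[OF h(1)] h orbit_index_eq[OF \<alpha> w] by (simp del: isotropy_group_simps)
  qed (use arrow_of[OF \<alpha> w z] in \<open>auto simp del: isotropy_group_simps\<close>)
  finally show ?thesis .
qed

text \<open>
  The convolution sum is split according to the range of \<open>h\<close>. The matrix product sums over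
  the set \<open>W\<close> of indices with a nonzero entry of the first factor, the convolution over
  the ranges of arrows in the support of \<open>f2\<close>; both are compared with the sum over the
  union.
\<close>

lemma matrix_map_mult:
  fixes R :: "'r::comm_ring_1 itself"
  assumes f1: "f1 \<in> carrier (finite_support_algebra R G)" and f2: "f2 \<in> carrier (finite_support_algebra R G)"
  shows "matrix_map (convolution G f1 f2) = matrix_map f1 \<otimes>\<^bsub>matrix_sum R\<^esub> matrix_map f2"
proof (intro ext)
  fix \<alpha> y z k
  show "matrix_map (convolution G f1 f2) \<alpha> y z k = (matrix_map f1 \<otimes>\<^bsub>matrix_sum R\<^esub> matrix_map f2) \<alpha> y z k"
  proof (cases "\<alpha> \<in> J")
    case False then show ?thesis by (simp add: matrix_map_def)
  next
    case \<alpha>: True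
    let ?S = "group_algebra R (isotropy_group G (x \<alpha>))"
    interpret S: nonunital_ring ?S using representative_unit[OF \<alpha>] by (rule group_algebra_nonunital_ring)
    let ?M = "matrix_map f1 \<alpha>" and ?N = "matrix_map f2 \<alpha>"
    define W where "W = {w \<in> orbit G (x \<alpha>). ?M y w \<noteq> (\<lambda>k. 0)}"
    have MN: "?M \<in> carrier (matrix_algebra (orbit G (x \<alpha>)) ?S)"
      "?N \<in> carrier (matrix_algebra (orbit G (x \<alpha>)) ?S)"
      using matrix_map_carrier[OF f1] matrix_map_carrier[OF f2] \<alpha> by auto
    have entries: "?M i j \<in> carrier ?S" "?N i j \<in> carrier ?S" for i j
      using MN unfolding matrix_carrier by blast+
    have "finite {(i, j). ?M i j \<noteq> (\<lambda>k. 0)}"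
      using MN(1) unfolding matrix_carrier by simp
    then have "finite (snd ` {(i, j). ?M i j \<noteq> (\<lambda>k. 0)})" by (rule finite_imageI)
    then have finW: "finite W" by (rule finite_subset[rotated]) (force simp: W_def)
    have "(matrix_map f1 \<otimes>\<^bsub>matrix_sum R\<^esub> matrix_map f2) \<alpha> y z k
        = (\<Oplus>\<^bsub>?S\<^esub>w\<in>W. ?M y w \<otimes>\<^bsub>?S\<^esub> ?N w z) k"
      using \<alpha> by (simp add: W_def)
    also have "\<dots> = (\<Sum>w\<in>W. (?M y w \<otimes>\<^bsub>?S\<^esub> ?N w z) k)"
      using finW entries S.abelian_group_axioms
      by (intro finsum_pointwise) (auto intro: S.m_closed simp del: group_algebra_simps(4))
    also have "\<dots> = matrix_map (convolution G f1 f2) \<alpha> y z k"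
    proof (cases "y \<in> orbit G (x \<alpha>) \<and> z \<in> orbit G (x \<alpha>) \<and> k \<in> isotropy \<alpha>")
      case False
      have "(?M y w \<otimes>\<^bsub>?S\<^esub> ?N w z) k = 0" for w
      proof (cases "k \<in> isotropy \<alpha>")
        case True
        then have "?M y w = (\<lambda>k. 0) \<or> ?N w z = (\<lambda>k. 0)"
          using False \<alpha> by (auto simp: matrix_map_def simp del: isotropy_group_simps)
        then show ?thesis
          unfolding group_algebra_mult_apply[OF representative_unit[OF \<alpha>] True] by auto
      next
        case False then show ?thesis by (simp add: group_algebra_def del: isotropy_group_simps)
      qed
      then have "(\<Sum>w\<in>W. (?M y w \<otimes>\<^bsub>?S\<^esub> ?N w z) k) = 0" by simp
      moreover have "matrix_map (convolution G f1 f2) \<alpha> y z k = 0"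
        unfolding matrix_map_def using False \<alpha> by (auto simp del: isotropy_group_simps)
      ultimately show ?thesis by simp
    next
      case True
      then have y: "y \<in> orbit G (x \<alpha>)" and z: "z \<in> orbit G (x \<alpha>)" and k: "k \<in> isotropy \<alpha>" by auto
      define H where "H = {h \<in> arrows G. dsrc G h = z \<and> f2 h \<noteq> 0}"
      have finH: "finite H"
        unfolding H_def using source_finiteD(2)[OF finite_support_source_finite[OF f2]] .
      define W' where "W' = W \<union> rng G ` H"
      have W': "w \<in> orbit G (x \<alpha>)" if "w \<in> W'" for w
      proof (cases "w \<in> W")
        case True then show ?thesis by (simp add: W_def)
      next
        case False
        then obtain h where "h \<in> arrows G" "dsrc G h = z" "w = rng G h"
          using \<open>w \<in> W'\<close> by (auto simp: W'_def H_def)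
        then show ?thesis
          using isotropy_part(3)[of h] orbit_index_arrow[of h] orbit_index_eq[OF \<alpha> z] by simp
      qed
      note g = arrow_of[OF \<alpha> y z k]
      have "(\<Sum>w\<in>W. (?M y w \<otimes>\<^bsub>?S\<^esub> ?N w z) k) = (\<Sum>w\<in>W'. (?M y w \<otimes>\<^bsub>?S\<^esub> ?N w z) k)"
      proof (rule sum.mono_neutral_left)
        show "\<forall>w\<in>W' - W. (?M y w \<otimes>\<^bsub>?S\<^esub> ?N w z) k = 0"
        proof
          fix w assume "w \<in> W' - W"
          then have "?M y w = (\<lambda>k. 0)" using W' by (auto simp: W_def)
          then show "(?M y w \<otimes>\<^bsub>?S\<^esub> ?N w z) k = 0"
            by (simp only: group_algebra_mult_apply[OF representative_unit[OF \<alpha>] k]) simp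
        qed
      qed (use finW finH in \<open>auto simp: W'_def\<close>)
      also have "\<dots> = (\<Sum>w\<in>W'. \<Sum>h\<in>{h \<in> H. rng G h = w}. f1 (gcomp G (arrow_of y z k) (ginv G h)) * f2 h)"
        unfolding H_def by (rule sum.cong[OF refl], rule matrix_map_mult_entry[OF f1 f2 \<alpha> y z W' k])
      also have "\<dots> = (\<Sum>h\<in>H. f1 (gcomp G (arrow_of y z k) (ginv G h)) * f2 h)"
        using finH finW by (intro sum.group) (auto simp: W'_def)
      also have "\<dots> = convolution G f1 f2 (arrow_of y z k)"
        by (rule convolution_eq_sum[symmetric]) (use g finH in \<open>auto simp: H_def\<close>)
      also have "\<dots> = matrix_map (convolution G f1 f2) \<alpha> y z k"
        using True \<alpha> by (simp add: matrix_map_def del: isotropy_group_simps)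
      finally show ?thesis .
    qed
    finally show ?thesis by simp
  qed
qed

theorem finite_support_algebra_iso_matrix_sum:
  fixes R :: "'r::comm_ring_1 itself"
  shows "algebra_isomorphic (finite_support_algebra R G) (matrix_sum R)"
proof -
  have "matrix_map (\<lambda>g. f1 g + f2 g) = matrix_map f1 \<oplus>\<^bsub>matrix_sum R\<^esub> matrix_map f2" for f1 f2 :: "'g \<Rightarrow> 'r"
    by (auto simp: matrix_map_def fun_eq_iff)
  then have "matrix_map \<in> ring_isos (finite_support_algebra R G) (matrix_sum R)"
    unfolding ring_isos_def using matrix_map_bij[of R] matrix_map_mult[of _ R]
    by (simp del: direct_sum_algebra_simps)
  moreover have "matrix_map (\<lambda>g. r * f g) = r \<odot>\<^bsub>matrix_sum R\<^esub> matrix_map f" for r and f :: "'g \<Rightarrow> 'r"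
    by (auto simp: matrix_map_def fun_eq_iff)
  ultimately show ?thesis
    unfolding algebra_isomorphic_def by (intro bexI[of _ matrix_map]) (simp_all del: direct_sum_algebra_simps)
qed

end

section \<open>Semisimple groupoid algebras\<close>

theorem theorem5p2:
  fixes R :: "'r::comm_ring_1 itself"
    and G :: "'g top_groupoid"
    and J :: "'j set" and x :: "'j \<Rightarrow> 'g"
  assumes "ample_groupoid G"
    and "orbit_representatives G J x"
  shows "(semisimple_ring (groupoid_algebra R G) \<longleftrightarrow>
            locally_semisimple_ring (groupoid_algebra R G)) \<and>
         (semisimple_ring (groupoid_algebra R G) \<longleftrightarrow>
            discrete_groupoid G \<and>
            (\<forall>y\<in>units G. semisimple_ring (group_algebra R (isotropy_group G y)))) \<and>
         (semisimple_ring (groupoid_algebra R G) \<longleftrightarrow>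
            ring_isomorphic (groupoid_algebra R G)
              (direct_sum_algebra J (\<lambda>\<alpha>. matrix_algebra (orbit G (x \<alpha>))
                 (group_algebra R (isotropy_group G (x \<alpha>))))) \<and>
            (\<forall>\<alpha>\<in>J. semisimple_ring (group_algebra R (isotropy_group G (x \<alpha>))))) \<and>
         (semisimple_ring (groupoid_algebra R G) \<longleftrightarrow>
            algebra_isomorphic (groupoid_algebra R G)
              (direct_sum_algebra J (\<lambda>\<alpha>. matrix_algebra (orbit G (x \<alpha>))
                 (group_algebra R (isotropy_group G (x \<alpha>))))) \<and>
            (\<forall>\<alpha>\<in>J. semisimple_ring (group_algebra R (isotropy_group G (x \<alpha>)))))"
proof -
  interpret ample G using assms(1) by unfold_locales
  interpret groupoid_representatives G J x using assms(2) by unfold_locales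
  let ?A = "groupoid_algebra R G" and ?D = "finite_support_algebra R G"
  let ?discrete = "discrete_groupoid G \<and> (\<forall>y\<in>units G. semisimple_ring (group_algebra R (isotropy_group G y)))"
  let ?groups = "\<forall>\<alpha>\<in>J. semisimple_ring (group_algebra R (isotropy_group G (x \<alpha>)))"
  have locally: "locally_semisimple_ring ?A" if "semisimple_ring ?A"
    using that by (rule semisimple_imp_locally_semisimple)
  have discrete: ?discrete if ls: "locally_semisimple_ring ?A"
  proof
    show d: "discrete_groupoid G" using ls by (rule locally_semisimple_imp_discrete)
    show "\<forall>y\<in>units G. semisimple_ring (group_algebra R (isotropy_group G y))"
      using ls unit_idempotent unfolding groupoid_algebra_discrete[OF d]
      by (auto simp: locally_semisimple_ring_def semisimple_group_algebra_iff_corner)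
  qed
  have D_semisimple: "semisimple_ring ?D" if ?groups
  proof (rule finite_support_semisimple)
    fix y assume "y \<in> units G"
    then show "\<exists>x\<in>units G. y \<in> orbit G x \<and> semisimple_ring (group_algebra R (isotropy_group G x))"
      using that orbit_index representative_unit by blast
  qed
  have algebra: "algebra_isomorphic ?A (matrix_sum R) \<and> ?groups \<and> semisimple_ring ?A" if d: ?discrete
  proof -
    have AD: "?A = ?D" using d groupoid_algebra_discrete by blast
    have gr: ?groups using d representative_unit by blast
    show ?thesis
      using finite_support_algebra_iso_matrix_sum[of R] D_semisimple[OF gr] gr unfolding AD by blast
  qed
  have ring: "ring_isomorphic A B" if "algebra_isomorphic A B"
    for A :: "('r, 'g \<Rightarrow> 'r) module" and B :: "('r, 'j \<Rightarrow> 'g \<Rightarrow> 'g \<Rightarrow> 'g \<Rightarrow> 'r) module"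
    using that by (auto simp: algebra_isomorphic_def ring_isomorphic_def)
  have converse: "semisimple_ring ?A" if iso: "ring_isomorphic ?A (matrix_sum R)" and gr: ?groups
  proof -
    have "ring_isomorphic ?D ?A"
      using ring[OF finite_support_algebra_iso_matrix_sum] iso groupoid_algebra_nonunital_ring
      by (rule ring_isomorphic_common_target)
    then show ?thesis
      by (rule semisimple_ring_isomorphic[OF D_semisimple[OF gr] _ groupoid_algebra_nonunital_ring])
  qed
  show ?thesis using locally discrete algebra ring converse by blast
qed

end
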